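(* Let $\Omega\subset\mathbb{C}$ be a bounded convex domain with smooth boundary, let $H$ be a complex Hilbert space, and let $A$ be a bounded linear operator on $H$ with $W(A)\subset\overline{\Omega}$. Then $$w(f(A))\le\sqrt{2}\,\|f\|_\infty\qquad\text{for all } f\in\mathcal{A}(\Omega).$$
   Context: For a bounded linear operator $B$ on a complex Hilbert space $(H,\langle\cdot,\cdot\rangle)$, the numerical range is $W(B)=\{\langle Bv,v\rangle : v\in H,\ \|v\|=1\}$ and the numerical radius is $w(B)=\sup_{z\in W(B)}|z|$. $\mathcal{A}(\Omega)$ is the algebra of functions holomorphic in $\Omega$ and continuous on $\overline\Omega$, with norm $\|f\|_\infty=\max\{|f(z)| : z\in\overline\Omega\}$. For $f\in\mathcal{A}(\Omega)$, $f(A)$ is defined as the operator-norm limit of $p_n(A)$, where $(p_n)$ is any sequence of polynomials converging to $f$ uniformly on $\overline\Omega$ (such sequences exist by Mergelyan's theorem, and the limit exists and is independent of the sequence because there is a finite constant $K$ with $\|p(A)\|\le K\|p\|_\infty$ for all polynomials $p$). When $\overline{W(A)}\subset\Omega$ this agrees with the holomorphic functional calculus. *)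

theory Defs
  imports "HOL-Complex_Analysis.Complex_Analysis"
begin

text \<open>
  Complex Hilbert spaces. The real vector space structure is the restriction of the complex one,
  the inner product is linear in its \<^emph>\<open>first\<close> argument, and the norm is the one it induces.
\<close>

class complex_vector = real_vector +
  fixes scaleC :: "complex \<Rightarrow> 'a \<Rightarrow> 'a"  (infixr "*\<^sub>C" 75)
  assumes scaleC_add_right: "a *\<^sub>C (x + y) = a *\<^sub>C x + a *\<^sub>C y"
    and scaleC_add_left: "(a + b) *\<^sub>C x = a *\<^sub>C x + b *\<^sub>C x"
    and scaleC_scaleC: "a *\<^sub>C (b *\<^sub>C x) = (a * b) *\<^sub>C x"
    and scaleC_of_real: "complex_of_real r *\<^sub>C x = r *\<^sub>R x"

class complex_inner = complex_vector + real_normed_vector +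
  fixes cinner :: "'a \<Rightarrow> 'a \<Rightarrow> complex"
  assumes cinner_commute: "cinner x y = cnj (cinner y x)"
    and cinner_add_left: "cinner (x + y) z = cinner x z + cinner y z"
    and cinner_scaleC_left: "cinner (a *\<^sub>C x) y = a * cinner x y"
    and cinner_self: "cinner x x = complex_of_real ((norm x)\<^sup>2)"

class chilbert_space = complex_inner + complete_space

definition bounded_clinear :: "('a::complex_inner \<Rightarrow> 'a) \<Rightarrow> bool"
  where "bounded_clinear B \<longleftrightarrow> bounded_linear B \<and> (\<forall>c x. B (c *\<^sub>C x) = c *\<^sub>C B x)"

definition numerical_range :: "('a::complex_inner \<Rightarrow> 'a) \<Rightarrow> complex set"
  where "numerical_range B = {cinner (B v) v |v. norm v = 1}"

text \<open>
  Inserting \<open>0\<close> only matters on the zero space, where the numerical range is empty: the supremum is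
  taken in \<open>[0, \<infinity>)\<close>, so the numerical radius is then \<open>0\<close>.
\<close>

definition numerical_radius :: "('a::complex_inner \<Rightarrow> 'a) \<Rightarrow> real"
  where "numerical_radius B = Sup (insert 0 (cmod ` numerical_range B))"

text \<open>
  The boundary is a \<open>C\<^sup>\<infinity>\<close> regular Jordan curve: it has a 1-periodic parametrization \<open>D 0\<close>, injective
  on a period, with derivatives \<open>D k\<close> of all orders \<open>k\<close> and nowhere vanishing velocity \<open>D 1\<close>.
\<close>

definition smooth_boundary :: "complex set \<Rightarrow> bool"
  where "smooth_boundary \<Omega> \<longleftrightarrow>
    (\<exists>D :: nat \<Rightarrow> real \<Rightarrow> complex.
       (\<forall>k t. (D k has_vector_derivative D (Suc k) t) (at t)) \<and>
       (\<forall>t. D 0 (t + 1) = D 0 t) \<and>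
       inj_on (D 0) {0..<1} \<and>
       (\<forall>t. D 1 t \<noteq> 0) \<and>
       D 0 ` {0..<1} = frontier \<Omega>)"

definition holo_alg :: "complex set \<Rightarrow> (complex \<Rightarrow> complex) set"
  where "holo_alg \<Omega> = {f. f holomorphic_on \<Omega> \<and> continuous_on (closure \<Omega>) f}"

definition sup_norm :: "complex set \<Rightarrow> (complex \<Rightarrow> complex) \<Rightarrow> real"
  where "sup_norm \<Omega> f = (SUP z\<in>closure \<Omega>. cmod (f z))"

definition poly_op :: "complex poly \<Rightarrow> ('a::complex_vector \<Rightarrow> 'a) \<Rightarrow> 'a \<Rightarrow> 'a"
  where "poly_op p A = (\<lambda>x. \<Sum>i\<le>degree p. coeff p i *\<^sub>C (A ^^ i) x)"

text \<open>
  \<open>f(A)\<close> is the bounded operator to which \<open>p\<^sub>n(A)\<close> converges in operator norm, for every sequence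
  of polynomials \<open>p\<^sub>n\<close> converging to \<open>f\<close> uniformly on the closure of \<open>\<Omega>\<close>. If no such
  sequence existed, the condition would hold vacuously for all bounded operators and the description
  would be improper, so a property of \<open>f(A)\<close> can only be derived by proving that it is well defined.
\<close>

definition fun_calc :: "complex set \<Rightarrow> (complex \<Rightarrow> complex) \<Rightarrow> ('a::complex_inner \<Rightarrow> 'a) \<Rightarrow> 'a \<Rightarrow> 'a"
  where "fun_calc \<Omega> f A =
    (THE T. bounded_clinear T \<and>
       (\<forall>p :: nat \<Rightarrow> complex poly.
          uniform_limit (closure \<Omega>) (\<lambda>n. poly (p n)) f sequentially \<longrightarrow>
          (\<lambda>n. onorm (\<lambda>x. poly_op (p n) A x - T x)) \<longlonglongrightarrow> 0))"

end

theory Submission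
  imports Defs "HOL-Real_Asymp.Real_Asymp"
begin

text \<open>
  Let \<open>\<omega>\<close> be the supremum of \<open>\<bar>\<langle>p(A)x, x\<rangle>\<bar>\<close> over unit vectors \<open>x\<close> and polynomials \<open>p\<close> bounded by 1 on a
  dilation of the closure of \<open>\<Omega>\<close>. The bound \<open>\<omega> \<le> \<surd>2\<close> follows from one consequence of convexity,
  due to Crouzeix and Palencia, and from first-order optimality conditions at a near-extremal pair.

  Convexity enters as follows. If the numerical range of \<open>A\<close> lies inside a positively oriented convex
  curve \<open>\<gamma>\<close>, then the operator density \<open>(\<gamma>' (\<gamma> - A)\<^sup>-\<^sup>1 - adjoint) / 2\<pi>\<i>\<close> on the curve is positive,
  because the numerical range lies to the left of every tangent. Its total mass is 2. Integrating
  \<open>h\<close> against it gives \<open>h(A) + g(A)\<^sup>*\<close>, where \<open>g\<close> is the Cauchy transform of the conjugate of \<open>h\<close>; hence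
  \<open>\<parallel>h(A) + g(A)\<^sup>*\<parallel> \<le> 2 \<parallel>h\<parallel>\<close> (\<open>positive_measure_bound\<close>). Moreover \<open>\<parallel>g\<parallel> \<le> \<parallel>h\<parallel>\<close>
  (\<open>cmod_conj_transform_le_1\<close>): the conjugate of \<open>g(z)\<close> is the integral of \<open>h\<close> against the same measure for the scalar
  \<open>z\<close> in place of \<open>A\<close>, minus \<open>h(z)\<close>. If \<open>z\<close> is close to a boundary point, at most about half of the mass 2 lies away from that
  point; on the rest \<open>h\<close> is nearly \<open>h(z)\<close>, and subtracting \<open>h(z)\<close> removes one unit of that mass.

  For the extremal argument suppose \<open>\<omega> > 1\<close>, and let \<open>f\<close>, \<open>x\<close> attain \<open>\<langle>S x, x\<rangle> = \<omega>\<close> with \<open>S = f(A)\<close>; the proof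
  works with nearly extremal pairs and a limit. Write \<open>\<phi>(p) = \<langle>p(A)x, x\<rangle>\<close>.
  Optimality in \<open>x\<close> says \<open>S x + S\<^sup>* x = 2\<omega> x\<close>. Optimality in \<open>f\<close> under the perturbation by
  \<open>\<plusminus>\<epsilon>(1 - f\<^sup>2)\<close> gives \<open>Re \<phi>(f\<^sup>2) = 1\<close>, and with the previous equation \<open>\<parallel>S x\<parallel>\<^sup>2 = 2\<omega>\<^sup>2 - 1\<close>. Put
  \<open>s = \<surd>(\<omega>\<^sup>2 - 1)\<close> and \<open>\<rho> = \<omega> - s\<close>, so that \<open>1 + \<rho>\<^sup>2 = 2\<rho>\<omega>\<close> and \<open>1 - \<rho>\<^sup>2 = 2\<rho>s\<close>. A second perturbation shows that
  \<open>\<bar>\<phi>(g (f - \<rho>)\<^sup>2)\<bar> \<le> 2\<rho>s\<^sup>2\<close> for all \<open>g\<close> in the unit ball. Now test \<open>h(A) + g(A)\<^sup>*\<close> for the Blaschke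
  factor \<open>h = (f - \<rho>) / (1 - \<rho>f)\<close> on the vectors \<open>u = (1 - \<rho>S) x\<close> and \<open>v = (S - \<rho>) x\<close>. One has
  \<open>h(A) u = v\<close>, \<open>\<parallel>v\<parallel>\<^sup>2 = 2s\<^sup>2\<close>, \<open>\<parallel>u\<parallel> = \<rho> \<parallel>v\<parallel>\<close>, and \<open>\<langle>g(A) v, u\<rangle> = \<rho> \<phi>(g (f - \<rho>)\<^sup>2)\<close> by the equation for \<open>S\<^sup>* x\<close>. So
  \<open>2s\<^sup>2 \<le> 2 (2\<rho>s\<^sup>2) + \<rho> (2\<rho>s\<^sup>2)\<close>, which says \<open>1 - \<rho>\<^sup>2 \<le> 2\<rho>\<close>, that is \<open>s \<le> 1\<close> and \<open>\<omega> \<le> \<surd>2\<close>.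

  The extremal argument multiplies functions of \<open>A\<close>, so it is carried out for polynomials:
  \<open>g\<close> is replaced by a polynomial, with one convex curve inside which \<open>g\<close> is defined and a smaller one
  inside which it is approximated (\<open>exists_conjugate_polynomial\<close>), and the curves are dilations of the
  boundary of \<open>\<Omega>\<close> that shrink to it in the end. Adjoints are only used through inner products.
  For \<open>f\<close> in the algebra, dilation and Cauchy's formula provide the approximating polynomials, and the bound
  for polynomials makes \<open>f(A)\<close> well defined and passes to the limit.
\<close>

section \<open>Complex Hilbert spaces\<close>

interpretation scaleC: vector_space "scaleC :: complex \<Rightarrow> 'a \<Rightarrow> 'a::complex_vector"
proof
  show "1 *\<^sub>C x = x" for x :: 'a
    using scaleC_of_real[of 1 x] by simp
qed (simp_all add: scaleC_add_right scaleC_add_left scaleC_scaleC)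

lemma cinner_add_right: "cinner x (y + z) = cinner x y + cinner x z"
  by (metis cinner_add_left cinner_commute complex_cnj_add)

lemma cinner_scaleC_right: "cinner x (a *\<^sub>C y) = cnj a * cinner x y"
  by (metis cinner_commute cinner_scaleC_left complex_cnj_mult)

lemma cinner_zero_left [simp]: "cinner 0 x = 0"
  using cinner_scaleC_left[of 0 0 x] by simp

lemma cinner_zero_right [simp]: "cinner x 0 = 0"
  by (metis cinner_commute cinner_zero_left complex_cnj_zero)

lemma cinner_minus_left: "cinner (- x) y = - cinner x y"
  using cinner_add_left[of x "- x" y] by (simp add: add_eq_0_iff2 minus_equation_iff)

lemma cinner_minus_right: "cinner x (- y) = - cinner x y"
  by (metis cinner_commute cinner_minus_left complex_cnj_minus)

lemma cinner_diff_left: "cinner (x - y) z = cinner x z - cinner y z"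
  using cinner_add_left[of x "- y" z] by (simp add: cinner_minus_left)

lemma cinner_diff_right: "cinner x (y - z) = cinner x y - cinner x z"
  using cinner_add_right[of x y "- z"] by (simp add: cinner_minus_right)

lemma norm_scaleC [simp]: "norm (a *\<^sub>C x) = cmod a * norm (x::'a::complex_inner)"
proof -
  have "complex_of_real ((norm (a *\<^sub>C x))\<^sup>2) = a * cnj a * complex_of_real ((norm x)\<^sup>2)"
    by (simp only: cinner_self[symmetric] cinner_scaleC_left cinner_scaleC_right mult_ac)
  also have "\<dots> = complex_of_real ((cmod a * norm x)\<^sup>2)"
    by (simp add: complex_norm_square power_mult_distrib del: of_real_power)
  finally have "(norm (a *\<^sub>C x))\<^sup>2 = (cmod a * norm x)\<^sup>2"
    by (simp only: of_real_eq_iff)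
  then show ?thesis
    by (simp add: power2_eq_iff_nonneg)
qed

lemma Re_cinner_commute: "Re (cinner x y) = Re (cinner y x)"
  by (metis cinner_commute complex_cnj(1) complex_surj complex.sel(1) cnj.simps(1))

text \<open>Cauchy-Schwarz is needed for three different forms: the inner product, the density of the
  positive operator measure on the boundary, and the form \<open>2 \<omega> \<langle>u, v\<rangle> - \<langle>S u, v\<rangle> - \<langle>u, S v\<rangle>\<close> of
  an operator with numerical radius at most \<open>\<omega>\<close>.\<close>

lemma Cauchy_Schwarz_hermitian:
  fixes B :: "'a::complex_vector \<Rightarrow> 'a \<Rightarrow> complex"
  assumes add: "\<And>x y z. B (x + y) z = B x z + B y z"
    and scale: "\<And>a x y. B (a *\<^sub>C x) y = a * B x y"
    and herm: "\<And>x y. B x y = cnj (B y x)"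
    and pos: "\<And>x. 0 \<le> Re (B x x)"
  shows "(cmod (B x y))\<^sup>2 \<le> Re (B x x) * Re (B y y)"
proof -
  define c where "c = B x y"
  have add': "B x (y + z) = B x y + B x z" for x y z
    by (metis add herm complex_cnj_add)
  have scale': "B x (a *\<^sub>C y) = cnj a * B x y" for a x y
    by (metis scale herm complex_cnj_mult)
  have key: "0 \<le> Re (B x x) - 2 * s * (cmod c)\<^sup>2 + s\<^sup>2 * (cmod c)\<^sup>2 * Re (B y y)" for s :: real
  proof -
    define k where "k = - (of_real s * c)"
    have "B y x = cnj c" unfolding c_def by (rule herm)
    then have "B (x + k *\<^sub>C y) (x + k *\<^sub>C y) = B x x + cnj k * c + k * cnj c + k * cnj k * B y y"
      by (simp add: add add' scale scale' c_def algebra_simps)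
    moreover have cc: "cnj c * c = of_real ((cmod c)\<^sup>2)"
      using complex_norm_square[of c] by (simp only: mult.commute)
    moreover have "cnj k * c = - (of_real s * (cnj c * c))" "k * cnj c = - (of_real s * (cnj c * c))"
        "k * cnj k = of_real (s\<^sup>2) * (cnj c * c)"
      unfolding k_def by (simp_all add: power2_eq_square)
    then have "cnj k * c = - of_real (s * (cmod c)\<^sup>2)" "k * cnj c = - of_real (s * (cmod c)\<^sup>2)"
        "k * cnj k = of_real (s\<^sup>2 * (cmod c)\<^sup>2)"
      unfolding cc by simp_all
    ultimately have "Re (B (x + k *\<^sub>C y) (x + k *\<^sub>C y)) =
        Re (B x x) - 2 * s * (cmod c)\<^sup>2 + s\<^sup>2 * (cmod c)\<^sup>2 * Re (B y y)"
      by simp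
    with pos show ?thesis by metis
  qed
  show ?thesis
  proof (cases "Re (B y y) = 0")
    case True
    have "c = 0"
    proof (rule ccontr)
      assume "c \<noteq> 0"
      then show False
        using key[of "(Re (B x x) + 1) / (2 * (cmod c)\<^sup>2)"] True pos[of x] by (simp add: field_simps)
    qed
    then show ?thesis using True by (simp add: c_def)
  next
    case False
    with pos[of y] have p: "Re (B y y) > 0" by linarith
    show ?thesis
      using key[of "1 / Re (B y y)"] p
      by (simp add: c_def field_simps power2_eq_square)
  qed
qed

lemma cmod_cinner_le: "cmod (cinner x y) \<le> norm x * norm (y::'a::complex_inner)"
proof -
  have "(cmod (cinner x y))\<^sup>2 \<le> Re (cinner x x) * Re (cinner y y)"
    by (rule Cauchy_Schwarz_hermitian)
      (simp_all add: cinner_add_left cinner_scaleC_left cinner_self cinner_commute[symmetric]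
        del: of_real_power)
  then have "(cmod (cinner x y))\<^sup>2 \<le> (norm x * norm y)\<^sup>2"
    by (simp add: cinner_self power_mult_distrib del: of_real_power)
  then show ?thesis
    by (simp add: power2_le_iff_abs_le)
qed

lemma norm_le_of_cinner:
  fixes x :: "'a::complex_inner"
  assumes "0 \<le> C" and "\<And>v. cmod (cinner x v) \<le> C * norm v"
  shows "norm x \<le> C"
proof (cases "x = 0")
  case False
  have "norm x * norm x \<le> C * norm x"
    using assms(2)[of x] by (simp add: cinner_self power2_eq_square norm_mult flip: of_real_mult)
  with False show ?thesis by simp
qed (use assms in simp)

lemma bounded_clinear_add: "bounded_clinear A \<Longrightarrow> A (x + y) = A x + A y"
  by (simp add: bounded_clinear_def bounded_linear.linear linear_add)

lemma bounded_clinear_diff: "bounded_clinear A \<Longrightarrow> A (x - y) = A x - A y"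
  by (simp add: bounded_clinear_def bounded_linear.linear linear_diff)

lemma bounded_clinear_scaleC: "bounded_clinear A \<Longrightarrow> A (c *\<^sub>C x) = c *\<^sub>C A x"
  by (simp add: bounded_clinear_def)

lemma bounded_clinear_zero: "bounded_clinear A \<Longrightarrow> A 0 = 0"
  by (simp add: bounded_clinear_def bounded_linear.linear linear_0)

lemma bounded_clinear_sum: "bounded_clinear A \<Longrightarrow> A (\<Sum>i\<in>I. f i) = (\<Sum>i\<in>I. A (f i))"
  by (simp add: bounded_clinear_def bounded_linear.linear linear_sum)

lemma bounded_clinear_pow:
  assumes "bounded_clinear A" shows "bounded_clinear (A ^^ n)"
proof (induction n)
  case (Suc n)
  have "bounded_linear (\<lambda>x. A ((A ^^ n) x))"
    using Suc assms bounded_linear_compose[of A "A ^^ n"] by (simp add: bounded_clinear_def)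
  then show ?case
    using Suc assms by (simp add: bounded_clinear_def o_def)
qed (simp add: bounded_clinear_def id_def)

lemma scaleR_conv_scaleC: "r *\<^sub>R (x::'a::complex_vector) = complex_of_real r *\<^sub>C x"
  by (simp add: scaleC_of_real)

lemma bounded_clinearI:
  fixes T :: "'a::complex_inner \<Rightarrow> 'a"
  assumes "\<And>x y. T (x + y) = T x + T y" and "\<And>c x. T (c *\<^sub>C x) = c *\<^sub>C T x"
    and "\<And>x. norm (T x) \<le> norm x * K"
  shows "bounded_clinear T"
  unfolding bounded_clinear_def
  by (intro conjI bounded_linear_intro[where K = K] allI) (simp_all add: assms scaleR_conv_scaleC)

text \<open>By polarization, \<open>4 \<langle>B u, v\<rangle>\<close> is a combination of the values of the quadratic form of \<open>B\<close> at
  \<open>u + \<i>\<^sup>k v\<close>, and for unit vectors the squared norms of these four vectors add up to 8.\<close>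

lemma norm_le_2_of_numerical_bound:
  fixes B :: "'a::complex_inner \<Rightarrow> 'a"
  assumes B: "bounded_clinear B" and w: "\<And>x. cmod (cinner (B x) x) \<le> w * (norm x)\<^sup>2"
  shows "norm (B u) \<le> 2 * w * norm u"
proof -
  have w0: "0 \<le> w" if "u \<noteq> 0"
    using order_trans[OF norm_ge_zero w[of u]] that by (simp add: zero_le_mult_iff)
  have unit: "cmod (cinner (B u) v) \<le> 2 * w" if u: "norm u = 1" and v: "norm v = 1" for u v
  proof -
    define q where "q k = cinner (B (u + k *\<^sub>C v)) (u + k *\<^sub>C v)" for k
    have q: "q k = cinner (B u) u + cnj k * cinner (B u) v + k * cinner (B v) u + k * cnj k * cinner (B v) v" for k
      unfolding q_def
      by (simp add: bounded_clinear_add[OF B] bounded_clinear_scaleC[OF B] cinner_add_left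
          cinner_add_right cinner_scaleC_left cinner_scaleC_right algebra_simps)
    have pol: "4 * cinner (B u) v = q 1 - q (-1) + \<i> * q \<i> - \<i> * q (-\<i>)"
      unfolding q by (simp add: algebra_simps)
    have n: "(norm (u + k *\<^sub>C v))\<^sup>2 = 1 + (cmod k)\<^sup>2 + 2 * Re (cnj k * cinner u v)" for k
    proof -
      have "cinner (u + k *\<^sub>C v) (u + k *\<^sub>C v)
          = cinner u u + k * cnj k * cinner v v + (cnj k * cinner u v + cnj (cnj k * cinner u v))"
        unfolding cinner_add_left cinner_add_right cinner_scaleC_left cinner_scaleC_right
          complex_cnj_mult complex_cnj_cnj cinner_commute[symmetric] by (simp add: ring_distribs)
      moreover have "Re (k * cnj k) = (cmod k)\<^sup>2" for k
        using cmod_power2[of k] by (simp add: power2_eq_square)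
      ultimately have "Re (cinner (u + k *\<^sub>C v) (u + k *\<^sub>C v)) = 1 + (cmod k)\<^sup>2 + 2 * Re (cnj k * cinner u v)"
        by (simp add: cinner_self u v)
      then show ?thesis by (simp add: cinner_self)
    qed
    have "cmod (4 * cinner (B u) v) \<le> cmod (q 1) + cmod (q (-1)) + cmod (q \<i>) + cmod (q (-\<i>))"
    proof -
      have "cmod (a - b + \<i> * c - \<i> * d) \<le> cmod a + cmod b + cmod c + cmod d" for a b c d
        using norm_triangle_ineq4[of "a - b + \<i> * c" "\<i> * d"] norm_triangle_ineq[of "a - b" "\<i> * c"]
          norm_triangle_ineq4[of a b] by (simp add: norm_mult)
      then show ?thesis unfolding pol .
    qed
    also have "\<dots> \<le> w * ((norm (u + 1 *\<^sub>C v))\<^sup>2 + (norm (u + (-1) *\<^sub>C v))\<^sup>2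
        + (norm (u + \<i> *\<^sub>C v))\<^sup>2 + (norm (u + (-\<i>) *\<^sub>C v))\<^sup>2)"
      using w[of "u + 1 *\<^sub>C v"] w[of "u + (-1) *\<^sub>C v"] w[of "u + \<i> *\<^sub>C v"] w[of "u + (-\<i>) *\<^sub>C v"]
      unfolding q_def distrib_left by linarith
    also have "\<dots> = 8 * w" unfolding n by simp
    finally show ?thesis by (simp add: norm_mult)
  qed
  show ?thesis
  proof (cases "u = 0")
    case True
    then show ?thesis by (simp add: bounded_clinear_zero[OF B])
  next
    case u0: False
    show ?thesis
    proof (rule norm_le_of_cinner)
      show "0 \<le> 2 * w * norm u" using w0 u0 by simp
      fix v
      show "cmod (cinner (B u) v) \<le> 2 * w * norm u * norm v"
      proof (cases "v = 0")
        case False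
        have "cmod (cinner (B (complex_of_real (1 / norm u) *\<^sub>C u)) (complex_of_real (1 / norm v) *\<^sub>C v)) \<le> 2 * w"
          by (rule unit) (use u0 False in \<open>simp_all add: norm_divide\<close>)
        then show ?thesis using u0 False
          by (simp add: bounded_clinear_scaleC[OF B] cinner_scaleC_left cinner_scaleC_right norm_mult norm_divide field_simps)
      qed simp
    qed
  qed
qed

section \<open>Polynomials of an operator\<close>

lemma poly_op_eq_sum:
  assumes "degree p \<le> n"
  shows "poly_op p A x = (\<Sum>i\<le>n. coeff p i *\<^sub>C (A ^^ i) x)"
  unfolding poly_op_def
  by (rule sum.mono_neutral_left) (use assms in \<open>auto simp: not_le coeff_eq_0\<close>)

lemma poly_op_0 [simp]: "poly_op 0 A x = 0"
  by (simp add: poly_op_def)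

lemma poly_op_pCons:
  assumes A: "bounded_clinear A"
  shows "poly_op (pCons c p) A x = c *\<^sub>C x + A (poly_op p A x)"
proof -
  have "poly_op (pCons c p) A x = (\<Sum>i\<le>Suc (degree p). coeff (pCons c p) i *\<^sub>C (A ^^ i) x)"
    by (rule poly_op_eq_sum) (rule degree_pCons_le)
  also have "\<dots> = c *\<^sub>C x + (\<Sum>i\<le>degree p. coeff p i *\<^sub>C A ((A ^^ i) x))"
    by (subst sum.atMost_Suc_shift) simp
  also have "\<dots> = c *\<^sub>C x + A (poly_op p A x)"
    by (simp add: poly_op_def bounded_clinear_sum[OF A] bounded_clinear_scaleC[OF A])
  finally show ?thesis .
qed

lemma poly_op_1 [simp]: "poly_op 1 A x = x"
  by (simp add: poly_op_def)

lemma poly_op_const [simp]: "poly_op [:c:] A x = c *\<^sub>C x"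
  by (simp add: poly_op_def)

lemma poly_op_add: "poly_op (p + q) A x = poly_op p A x + poly_op q A x"
proof -
  define n where "n = max (degree p) (degree q)"
  have "degree (p + q) \<le> n" "degree p \<le> n" "degree q \<le> n"
    by (auto simp: n_def degree_add_le_max)
  then show ?thesis
    by (simp add: poly_op_eq_sum[where n = n] scaleC_add_left sum.distrib)
qed

lemma poly_op_smult: "poly_op (smult c p) A x = c *\<^sub>C poly_op p A x"
  by (subst poly_op_eq_sum[where n = "degree p"]; simp add: poly_op_def degree_smult_le scaleC.scale_sum_right)

lemma poly_op_diff: "poly_op (p - q) A x = poly_op p A x - poly_op q A x"
  using poly_op_add[of "p - q" q A x] by (simp add: algebra_simps)

lemma poly_op_minus: "poly_op (- p) A x = - poly_op p A x"
  using poly_op_diff[of 0 p A x] by simp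

lemma bounded_clinear_poly_op:
  assumes A: "bounded_clinear A" shows "bounded_clinear (poly_op p A)"
proof -
  have "bounded_linear (\<lambda>x. coeff p i *\<^sub>C (A ^^ i) x)" for i
  proof -
    obtain K where K: "\<And>x. norm ((A ^^ i) x) \<le> norm x * K"
      using bounded_clinear_pow[OF A, of i] bounded_linear.bounded unfolding bounded_clinear_def by blast
    have "bounded_clinear (\<lambda>x. coeff p i *\<^sub>C (A ^^ i) x)"
    proof (rule bounded_clinearI)
      show "norm (coeff p i *\<^sub>C (A ^^ i) x) \<le> norm x * (cmod (coeff p i) * K)" for x
        using mult_left_mono[OF K[of x], of "cmod (coeff p i)"] by (simp add: mult_ac)
    qed (simp_all add: bounded_clinear_add[OF bounded_clinear_pow[OF A]]
          bounded_clinear_scaleC[OF bounded_clinear_pow[OF A]] scaleC_add_right mult.commute)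
    then show ?thesis by (simp add: bounded_clinear_def)
  qed
  then have "bounded_linear (poly_op p A)"
    unfolding poly_op_def by (rule bounded_linear_sum)
  moreover have "poly_op p A (c *\<^sub>C x) = c *\<^sub>C poly_op p A x" for c x
    by (simp add: poly_op_def bounded_clinear_scaleC[OF bounded_clinear_pow[OF A]]
        scaleC.scale_sum_right mult.commute)
  ultimately show ?thesis by (simp add: bounded_clinear_def)
qed

lemma poly_op_mult:
  assumes A: "bounded_clinear A"
  shows "poly_op (p * q) A x = poly_op p A (poly_op q A x)"
proof (induction p)
  case (pCons c p)
  then show ?case
    by (simp add: poly_op_pCons[OF A] poly_op_add poly_op_smult)
qed simp

section \<open>Uniform approximation by polynomials on convex sets\<close>

definition poly_approximable :: "complex set \<Rightarrow> (complex \<Rightarrow> complex) \<Rightarrow> bool"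
  where "poly_approximable E f \<longleftrightarrow> (\<forall>e>0. \<exists>p. \<forall>z\<in>E. cmod (f z - poly p z) \<le> e)"

lemma poly_approximableD:
  "poly_approximable E f \<Longrightarrow> 0 < e \<Longrightarrow> \<exists>p. \<forall>z\<in>E. cmod (f z - poly p z) \<le> e"
  by (simp add: poly_approximable_def)

lemma poly_approximable_cmult:
  assumes "poly_approximable E f" shows "poly_approximable E (\<lambda>z. c * f z)"
  unfolding poly_approximable_def
proof (intro allI impI)
  fix e :: real assume "0 < e"
  then obtain p where p: "\<And>z. z \<in> E \<Longrightarrow> cmod (f z - poly p z) \<le> e / (cmod c + 1)"
    using poly_approximableD[OF assms, of "e / (cmod c + 1)"] by (auto simp: add_nonneg_pos)
  have "cmod (c * f z - poly (smult c p) z) \<le> e" if "z \<in> E" for z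
  proof -
    have "cmod (c * f z - poly (smult c p) z) = cmod c * cmod (f z - poly p z)"
      by (simp add: norm_mult flip: right_diff_distrib)
    also have "\<dots> \<le> (cmod c + 1) * (e / (cmod c + 1))"
      by (intro mult_mono p that) auto
    also have "\<dots> = e"
      using add_nonneg_pos[of "cmod c" 1] by (simp add: field_simps)
    finally show ?thesis .
  qed
  then show "\<exists>p. \<forall>z\<in>E. cmod (c * f z - poly p z) \<le> e" by blast
qed

lemma poly_approximable_cong:
  "(\<And>z. z \<in> E \<Longrightarrow> f z = g z) \<Longrightarrow> poly_approximable E f \<longleftrightarrow> poly_approximable E g"
  by (simp add: poly_approximable_def)

lemma separating_direction:
  fixes E :: "complex set"
  assumes "convex E" "closed E" "E \<noteq> {}" "w \<notin> E"
  obtains n where "cmod n = 1" "\<And>a. a \<in> E \<Longrightarrow> infdist w E \<le> Re (cnj n * (w - a))"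
proof -
  obtain y where y: "y \<in> E" "\<And>z. z \<in> E \<Longrightarrow> dist w y \<le> dist w z"
    using distance_attains_inf[OF assms(2,3)] by blast
  have d: "infdist w E = cmod (w - y)"
    using y assms(3) unfolding infdist_def dist_norm
    by (auto intro!: antisym cInf_greatest cInf_lower2[of "cmod (w - y)"] bdd_belowI[where m = 0])
  have wy: "cmod (w - y) > 0" using y assms(4) by auto
  define n where "n = (w - y) / of_real (cmod (w - y))"
  show thesis
  proof
    show "cmod n = 1" using wy by (simp add: n_def norm_divide)
    fix a assume a: "a \<in> E"
    have "inner (w - y) (a - y) \<le> 0"
      by (rule any_closest_point_dot[OF assms(1,2) y(1) a]) (use y in blast)
    moreover have "Re (cnj n * (w - a)) = (inner (w - y) (w - y) - inner (w - y) (a - y)) / cmod (w - y)"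
      using wy by (simp add: n_def inner_complex_def field_simps)
    moreover have "inner (w - y) (w - y) / cmod (w - y) = cmod (w - y)"
      using wy by (simp add: dot_square_norm power2_eq_square)
    ultimately show "infdist w E \<le> Re (cnj n * (w - a))"
      using wy unfolding d by (simp add: diff_divide_distrib divide_nonpos_pos)
  qed
qed

text \<open>A point outside a compact convex set is also outside some disc containing the set, so the
  geometric series about the centre of that disc converges uniformly on the set.\<close>

lemma poly_approximable_inverse:
  assumes E: "convex E" "compact E" and w: "w \<notin> E"
  shows "poly_approximable E (\<lambda>z. 1 / (w - z))"
proof (cases "E = {}")
  case False
  have "closed E" using E by (simp add: compact_imp_closed)
  then obtain n where n: "cmod n = 1" and sep: "\<And>a. a \<in> E \<Longrightarrow> infdist w E \<le> Re (cnj n * (w - a))"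
    using separating_direction[OF E(1) _ False w] by blast
  define d where "d = infdist w E"
  have d: "0 < d"
    using infdist_pos_not_in_closed[OF \<open>closed E\<close> False w] by (simp add: d_def)
  obtain D where D: "0 < D" "\<And>a. a \<in> E \<Longrightarrow> cmod (w - a) \<le> D"
  proof -
    have "bounded ((\<lambda>a. w - a) ` E)"
      using E(2) by (intro compact_imp_bounded compact_continuous_image continuous_intros)
    then show thesis using that unfolding bounded_pos by auto
  qed
  \<comment> \<open>The disc of radius \<open>R\<close> about \<open>c = w - R n\<close> has \<open>w\<close> on its boundary; for this \<open>R\<close> it contains \<open>E\<close> in its
    interior, since \<open>\<bar>z - c\<bar>\<^sup>2 \<le> D\<^sup>2 - 2 R d + R\<^sup>2\<close> on \<open>E\<close>.\<close>
  define R where "R = D\<^sup>2 / d + d"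
  have R: "0 < R" "D\<^sup>2 < R * d"
    using d D by (auto simp: R_def add_pos_pos distrib_right)
  define c where "c = w - of_real R * n"
  have wc: "w - c = of_real R * n" "cmod (w - c) = R" using R n by (auto simp: c_def norm_mult)
  define q where "q = sqrt (1 - d / R)"
  have dR: "d \<le> R" using D d by (simp add: R_def)
  have q: "0 \<le> q" "q < 1" using d R dR by (auto simp: q_def)
  define y where "y z = (z - c) / (w - c)" for z
  have yq: "cmod (y z) \<le> q" if z: "z \<in> E" for z
  proof -
    have "(cmod (z - c))\<^sup>2 = (cmod (w - z))\<^sup>2 - 2 * R * Re (cnj n * (w - z)) + R\<^sup>2 * (cmod n)\<^sup>2"
      unfolding c_def cmod_power2 by (simp add: power2_eq_square algebra_simps)
    also have "\<dots> \<le> D\<^sup>2 - 2 * R * d + R\<^sup>2 * 1\<^sup>2"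
      using sep[OF z] D(2)[OF z] R n unfolding d_def[symmetric]
      by (intro add_mono diff_mono mult_left_mono power_mono) auto
    also have "\<dots> \<le> R\<^sup>2 - R * d" using R by simp
    also have "\<dots> = (q * R)\<^sup>2"
      using R dR by (simp add: q_def power_mult_distrib field_simps power2_eq_square)
    finally have "cmod (z - c) \<le> q * R" by (rule power2_le_imp_le) (use q R in simp)
    then show ?thesis unfolding y_def norm_divide wc(2) using R by (simp add: field_simps)
  qed
  define P where "P N = smult (1 / (w - c)) (\<Sum>k<N. [:- c / (w - c), 1 / (w - c):] ^ k)" for N
  have P: "cmod (1 / (w - z) - poly (P N) z) \<le> q ^ N / d" if z: "z \<in> E" for z N
  proof -
    have wz: "w - z \<noteq> 0" using z w by auto
    have wc0: "w - c \<noteq> 0" using wc R by auto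
    have y1: "1 - y z = (w - z) / (w - c)" using wc0 by (simp add: y_def field_simps)
    have "poly (P N) z = 1 / (w - c) * (\<Sum>k<N. y z ^ k)"
      by (simp add: P_def poly_sum poly_power y_def diff_divide_distrib)
    moreover have "(w - z) / (w - c) * (\<Sum>k<N. y z ^ k) = 1 - y z ^ N"
      using one_diff_power_eq[of "y z" N] by (simp only: y1)
    then have "(\<Sum>k<N. y z ^ k) = (1 - y z ^ N) * ((w - c) / (w - z))"
      using wz wc0 by (simp add: field_simps)
    ultimately have "poly (P N) z = (1 - y z ^ N) / (w - z)"
      using wc0 by simp
    then have "1 / (w - z) - poly (P N) z = y z ^ N / (w - z)"
      by (simp add: diff_divide_distrib)
    then have "cmod (1 / (w - z) - poly (P N) z) = cmod (y z) ^ N / cmod (w - z)"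
      by (simp add: norm_divide norm_power)
    also have "\<dots> \<le> q ^ N / d"
    proof (intro frac_le power_mono yq[OF z])
      show "d \<le> cmod (w - z)" using infdist_le[OF z, of w] by (simp add: d_def dist_norm)
    qed (use d q in auto)
    finally show ?thesis .
  qed
  have lim: "(\<lambda>N. q ^ N / d) \<longlonglongrightarrow> 0"
    using tendsto_divide[OF LIMSEQ_power_zero[of q] tendsto_const[of d]] q d by simp
  show ?thesis
    unfolding poly_approximable_def
  proof (intro allI impI)
    fix e :: real assume "0 < e"
    with lim have "\<forall>\<^sub>F N in sequentially. q ^ N / d < e" by (rule order_tendstoD)
    then obtain N where "q ^ N / d < e" by (auto simp: eventually_sequentially)
    then show "\<exists>p. \<forall>z\<in>E. cmod (1 / (w - z) - poly p z) \<le> e"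
      using P[of _ N] by (intro exI[of _ "P N"]) force
  qed
qed (simp add: poly_approximable_def)

text \<open>A Riemann sum of the integral is a combination of functions \<open>1 / (\<gamma> t - z)\<close>, each of which is
  approximable. Uniform continuity of the integrand in both variables makes the error uniform in \<open>z\<close>.\<close>

lemma poly_approximable_Cauchy_transform:
  fixes \<gamma> \<psi> :: "real \<Rightarrow> complex"
  assumes E: "convex E" "compact E"
    and \<gamma>: "continuous_on {0..1} \<gamma>" "\<And>t. t \<in> {0..1} \<Longrightarrow> \<gamma> t \<notin> E" and \<psi>: "continuous_on {0..1} \<psi>"
  shows "poly_approximable E (\<lambda>z. integral {0..1} (\<lambda>t. \<psi> t / (\<gamma> t - z)))"
  unfolding poly_approximable_def
proof (intro allI impI)
  fix e :: real assume e: "0 < e"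
  define k where "k t z = \<psi> t / (\<gamma> t - z)" for t z
  have nz: "\<gamma> t - z \<noteq> 0" if "t \<in> {0..1}" "z \<in> E" for t z using \<gamma>(2) that by auto
  have "continuous_on ({0..1} \<times> E) (\<lambda>(t, z). k t z)"
    unfolding k_def case_prod_beta
    by (intro continuous_intros continuous_on_compose2[OF \<psi>] continuous_on_compose2[OF \<gamma>(1)])
      (use \<gamma>(2) in auto)
  moreover have "compact ({0..1::real} \<times> E)" using E by (intro compact_Times) auto
  ultimately have "uniformly_continuous_on ({0..1} \<times> E) (\<lambda>(t, z). k t z)"
    by (rule compact_uniformly_continuous)
  then obtain \<delta> where \<delta>: "0 < \<delta>" "\<And>p p'. p \<in> {0..1} \<times> E \<Longrightarrow> p' \<in> {0..1} \<times> E \<Longrightarrow> dist p' p < \<delta>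
      \<Longrightarrow> dist (case p' of (t, z) \<Rightarrow> k t z) (case p of (t, z) \<Rightarrow> k t z) < e / 2"
    unfolding uniformly_continuous_on_def using e by (meson half_gt_zero)
  have uc: "cmod (k t z - k t' z) \<le> e / 2" if "t \<in> {0..1}" "t' \<in> {0..1}" "\<bar>t - t'\<bar> < \<delta>" "z \<in> E" for t t' z
    using \<delta>(2)[of "(t', z)" "(t, z)"] that by (simp add: dist_norm dist_Pair_Pair)
  have kc: "continuous_on S (\<lambda>t. k t z)" if "S \<subseteq> {0..1}" "z \<in> E" for S z
    unfolding k_def using that nz
    by (intro continuous_intros continuous_on_subset[OF \<psi>] continuous_on_subset[OF \<gamma>(1)])
      (auto simp: subset_iff)
  obtain n :: nat where n: "0 < n" "1 / real n < \<delta>"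
    using real_arch_inverse[of \<delta>] \<delta>(1) by (auto simp: field_simps)
  have "\<exists>p. \<forall>z\<in>E. cmod (integral {0..real j / real n} (\<lambda>t. k t z) - poly p z) \<le> real j / real n * e" if "j \<le> n" for j
    using that
  proof (induction j)
    case 0
    then show ?case by (auto intro!: exI[of _ 0])
  next
    case (Suc j)
    then obtain p where p: "\<And>z. z \<in> E \<Longrightarrow> cmod (integral {0..real j / real n} (\<lambda>t. k t z) - poly p z) \<le> real j / real n * e"
      by auto
    define a where "a = real j / real n"
    define b where "b = real (Suc j) / real n"
    have ab: "0 \<le> a" "a \<le> b" "b \<le> 1" "b - a = 1 / real n"
      using Suc.prems n by (auto simp: a_def b_def field_simps)
    have "poly_approximable E (\<lambda>z. (\<psi> a / of_nat n) * (1 / (\<gamma> a - z)))"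
      by (intro poly_approximable_cmult poly_approximable_inverse E \<gamma>) (use ab in auto)
    from poly_approximableD[OF this, of "e / (2 * real n)"] obtain p' where
      p': "\<And>z. z \<in> E \<Longrightarrow> cmod ((\<psi> a / of_nat n) * (1 / (\<gamma> a - z)) - poly p' z) \<le> e / (2 * real n)"
      using e n by auto
    have "cmod (integral {0..b} (\<lambda>t. k t z) - poly (p + p') z) \<le> b * e" if z: "z \<in> E" for z
    proof -
      have int: "(\<lambda>t. k t z) integrable_on {0..b}"
        using ab z by (intro integrable_continuous_interval kc) auto
      have intab: "(\<lambda>t. k t z) integrable_on {a..b}"
        using ab z by (intro integrable_continuous_interval kc) auto
      have "integral {0..b} (\<lambda>t. k t z) = integral {0..a} (\<lambda>t. k t z) + integral {a..b} (\<lambda>t. k t z)"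
        using Henstock_Kurzweil_Integration.integral_combine[OF ab(1,2) int] by simp
      moreover have "cmod (integral {a..b} (\<lambda>t. k t z) - (\<psi> a / of_nat n) * (1 / (\<gamma> a - z))) \<le> e / 2 * (b - a)"
      proof -
        have "integral {a..b} (\<lambda>t. k t z - k a z) = integral {a..b} (\<lambda>t. k t z) - (b - a) *\<^sub>R k a z"
          using ab by (subst integral_diff[OF intab]) auto
        moreover have "(b - a) *\<^sub>R k a z = (\<psi> a / of_nat n) * (1 / (\<gamma> a - z))"
          using ab by (simp add: k_def scaleR_conv_of_real)
        moreover have "cmod (integral {a..b} (\<lambda>t. k t z - k a z)) \<le> e / 2 * (b - a)"
        proof (rule integral_bound)
          show "cmod (k t z - k a z) \<le> e / 2" if "t \<in> {a..b}" for t
            using that ab n z by (intro uc) auto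
          show "continuous_on {a..b} (\<lambda>t. k t z - k a z)"
            using ab z by (intro continuous_intros kc) auto
        qed (use ab in auto)
        ultimately show ?thesis by simp
      qed
      ultimately have "cmod (integral {0..b} (\<lambda>t. k t z) - poly (p + p') z)
          \<le> real j / real n * e + e / 2 * (b - a) + e / (2 * real n)"
        using p[OF z, folded a_def] p'[OF z]
          norm_triangle_ineq[of "integral {0..a} (\<lambda>t. k t z) - poly p z"
            "integral {a..b} (\<lambda>t. k t z) - (\<psi> a / of_nat n) * (1 / (\<gamma> a - z))"]
          norm_triangle_ineq[of "integral {0..a} (\<lambda>t. k t z) - poly p z
            + (integral {a..b} (\<lambda>t. k t z) - (\<psi> a / of_nat n) * (1 / (\<gamma> a - z)))"
            "(\<psi> a / of_nat n) * (1 / (\<gamma> a - z)) - poly p' z"]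
        by (simp add: a_def algebra_simps)
      also have "\<dots> = b * e" using ab(4) n by (simp add: b_def field_simps)
      finally show ?thesis .
    qed
    then show ?case unfolding b_def by blast
  qed
  from this[of n] n show "\<exists>p. \<forall>z\<in>E. cmod (integral {0..1} (\<lambda>t. \<psi> t / (\<gamma> t - z)) - poly p z) \<le> e"
    by (simp add: k_def)
qed

section \<open>A maximum principle without boundary values\<close>

text \<open>A set where \<open>\<bar>g\<bar>\<close> exceeds \<open>M\<close> by a fixed amount stays away from the boundary, so it is compact and
  contains a maximum point of \<open>\<bar>g\<bar>\<close>. The bound on upper limits replaces continuity on the closure: a Cauchy
  transform is defined by its integral only off the curve.\<close>

lemma maximum_modulus_limsup:
  assumes \<Omega>: "open \<Omega>" "connected \<Omega>" "bounded \<Omega>" and g: "g holomorphic_on \<Omega>"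
    and bd: "\<And>\<sigma> e. \<sigma> \<in> frontier \<Omega> \<Longrightarrow> 0 < e \<Longrightarrow> \<exists>\<delta>>0. \<forall>z\<in>\<Omega>. dist z \<sigma> < \<delta> \<longrightarrow> cmod (g z) \<le> M + e"
    and z0: "z0 \<in> \<Omega>"
  shows "cmod (g z0) \<le> M"
proof (rule ccontr)
  assume "\<not> cmod (g z0) \<le> M"
  then have gt: "cmod (g z0) > M" by simp
  define e where "e = (cmod (g z0) - M) / 2"
  have e: "0 < e" "M + e < cmod (g z0)" using gt by (auto simp: e_def field_simps)
  define C where "C = {z \<in> \<Omega>. cmod (g z0) \<le> cmod (g z)}"
  have cont: "continuous_on \<Omega> (\<lambda>z. cmod (g z))"
    using g by (intro continuous_intros holomorphic_on_imp_continuous_on)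
  have "closed C"
    unfolding closed_sequential_limits
  proof (intro allI impI, elim conjE)
    fix x l assume x: "\<forall>n. x n \<in> C" "x \<longlonglongrightarrow> l"
    then have "l \<in> closure \<Omega>" unfolding closure_sequential C_def by blast
    moreover have "l \<notin> frontier \<Omega>"
    proof
      assume "l \<in> frontier \<Omega>"
      from bd[OF this e(1)] obtain \<delta> where \<delta>: "\<delta> > 0" "\<And>z. z \<in> \<Omega> \<Longrightarrow> dist z l < \<delta> \<Longrightarrow> cmod (g z) \<le> M + e" by blast
      from x(2) \<delta>(1) obtain n where "dist (x n) l < \<delta>" unfolding lim_sequentially by blast
      then have "cmod (g (x n)) \<le> M + e" using x(1) \<delta>(2) by (auto simp: C_def)
      moreover have "cmod (g z0) \<le> cmod (g (x n))" using x(1) by (simp add: C_def)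
      ultimately show False using e by linarith
    qed
    ultimately have l: "l \<in> \<Omega>" using \<Omega>(1) by (simp add: frontier_def interior_open)
    have "(\<lambda>n. cmod (g (x n))) \<longlonglongrightarrow> cmod (g l)"
      using cont l x by (auto simp: continuous_on_sequentially C_def o_def)
    then have "cmod (g z0) \<le> cmod (g l)"
      by (rule LIMSEQ_le_const) (use x in \<open>auto simp: C_def\<close>)
    then show "l \<in> C" using l by (simp add: C_def)
  qed
  moreover have "bounded C" using \<Omega>(3) by (rule bounded_subset) (auto simp: C_def)
  ultimately have "compact C" by (simp add: compact_eq_bounded_closed)
  moreover have "z0 \<in> C" using z0 by (simp add: C_def)
  moreover have "continuous_on C (\<lambda>z. cmod (g z))"
    using cont by (rule continuous_on_subset) (auto simp: C_def)
  ultimately obtain \<xi> where \<xi>: "\<xi> \<in> C" "\<And>z. z \<in> C \<Longrightarrow> cmod (g z) \<le> cmod (g \<xi>)"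
    using continuous_attains_sup[of C] by blast
  have \<xi>\<Omega>: "\<xi> \<in> \<Omega>" using \<xi> by (simp add: C_def)
  have "cmod (g z) \<le> cmod (g \<xi>)" if "z \<in> \<Omega>" for z
    using \<xi>(2)[of z] \<xi>(1) that by (cases "cmod (g z0) \<le> cmod (g z)") (auto simp: C_def)
  then have "g constant_on \<Omega>"
    using maximum_modulus_principle[OF g \<Omega>(1,2,1) subset_refl \<xi>\<Omega>] by blast
  then have const: "g z = g z0" if "z \<in> \<Omega>" for z
    using z0 that by (auto simp: constant_on_def)
  have "frontier \<Omega> \<noteq> {}"
    using z0 \<Omega>(3) by (intro frontier_not_empty) auto
  then obtain \<sigma> where \<sigma>: "\<sigma> \<in> frontier \<Omega>" by blast
  from bd[OF \<sigma> e(1)] obtain \<delta> where \<delta>: "\<delta> > 0" "\<And>z. z \<in> \<Omega> \<Longrightarrow> dist z \<sigma> < \<delta> \<Longrightarrow> cmod (g z) \<le> M + e" by blast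
  have "\<sigma> \<in> closure \<Omega>" using \<sigma> by (simp add: frontier_def)
  then obtain z where "z \<in> \<Omega>" "dist z \<sigma> < \<delta>" using \<delta>(1) unfolding closure_approachable by blast
  then show False using \<delta>(2) const e by fastforce
qed

section \<open>Dilations\<close>

definition dil :: "complex \<Rightarrow> real \<Rightarrow> complex \<Rightarrow> complex"
  where "dil c s z = c + of_real s * (z - c)"

lemma dil_1 [simp]: "dil c 1 z = z"
  by (simp add: dil_def)

lemma dil_dil: "dil c s (dil c t z) = dil c (s * t) z"
  by (simp add: dil_def)

lemma dil_center [simp]: "dil c s c = c"
  by (simp add: dil_def)

lemma dil_diff: "dil c s z - dil c s w = of_real s * (z - w)"
  by (simp add: dil_def algebra_simps)

lemma inj_dil: "s \<noteq> 0 \<Longrightarrow> inj (dil c s)"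
  by (simp add: dil_def inj_on_def)

lemma dil_image: "dil c s ` S = (+) (c - of_real s * c) ` ((*\<^sub>R) s ` S)"
  by (simp add: image_image dil_def scaleR_conv_of_real algebra_simps)

lemma closure_dil: "closure (dil c s ` S) = dil c s ` closure S"
  by (simp only: dil_image closure_translation closure_scaleR)

lemma open_dil: "s \<noteq> 0 \<Longrightarrow> open S \<Longrightarrow> open (dil c s ` S)"
  unfolding dil_image by (intro open_translation open_scaling)

lemma convex_dil: "convex S \<Longrightarrow> convex (dil c s ` S)"
  unfolding dil_image by (intro convex_translation convex_scaling)

lemma bounded_dil: "bounded S \<Longrightarrow> bounded (dil c s ` S)"
  unfolding dil_image by (intro bounded_translation bounded_scaling)

lemma frontier_dil:
  assumes "s \<noteq> 0" "open S" shows "frontier (dil c s ` S) = dil c s ` frontier S"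
  using assms by (simp add: frontier_def interior_open open_dil closure_dil image_set_diff inj_dil)

lemma closure_subset_dil:
  assumes "open S" "convex S" "c \<in> S" "1 < s"
  shows "closure S \<subseteq> dil c s ` S"
proof
  fix z assume z: "z \<in> closure S"
  have "z - (1 - 1 / s) *\<^sub>R (z - c) \<in> interior S"
    by (rule mem_interior_closure_convex_shrink[OF assms(2) _ z]) (use assms in \<open>auto simp: interior_open\<close>)
  moreover have "z - (1 - 1 / s) *\<^sub>R (z - c) = dil c (1 / s) z"
    by (simp add: dil_def scaleR_conv_of_real algebra_simps)
  ultimately have "dil c (1 / s) z \<in> S" using assms by (simp add: interior_open)
  then have "dil c s (dil c (1 / s) z) \<in> dil c s ` S" by blast
  then show "z \<in> dil c s ` S" using assms by (simp add: dil_dil)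
qed

lemma dil_subset:
  assumes "open S" "convex S" "c \<in> S" "0 < r" "r < s"
  shows "closure (dil c r ` S) \<subseteq> dil c s ` S"
proof -
  have "dil c r ` closure S \<subseteq> dil c r ` dil c (s / r) ` S"
    using closure_subset_dil[OF assms(1-3), of "s / r"] assms by (intro image_mono) simp
  then show ?thesis using assms by (simp add: closure_dil image_image dil_dil)
qed

section \<open>Contours around convex domains\<close>

lemma integral_periodic:
  fixes F :: "real \<Rightarrow> 'a::banach"
  assumes F: "continuous_on UNIV F" "\<And>t. F (t + 1) = F t" and a: "0 \<le> a" "a \<le> 1"
  shows "integral {a..a + 1} F = integral {0..1} F"
proof -
  have int: "F integrable_on {x..y}" for x y
    using continuous_on_subset[OF F(1)] by (intro integrable_continuous_interval) auto
  have "F \<circ> (+) 1 = F" by (auto simp: F(2) add.commute)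
  then have "integral {1..a + 1} F = integral {0..a} F"
    using integral_shift_Icc_real[of 0 a F 1] by simp
  moreover have "integral {a..1} F + integral {1..a + 1} F = integral {a..a + 1} F"
    by (rule Henstock_Kurzweil_Integration.integral_combine) (use a int in auto)
  moreover have "integral {0..a} F + integral {a..1} F = integral {0..1} F"
    by (rule Henstock_Kurzweil_Integration.integral_combine) (use a int in auto)
  ultimately show ?thesis by (simp add: add.commute)
qed

lemma periodic_frac:
  fixes g :: "real \<Rightarrow> 'a"
  assumes "\<And>t. g (t + 1) = g t"
  shows "g (frac t) = g t"
proof -
  have nat: "g (x + real n) = g x" for x n
  proof (induction n)
    case (Suc n)
    have "x + real (Suc n) = (x + real n) + 1" by simp
    with Suc show ?case by (simp only: assms)
  qed simp
  show ?thesis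
  proof (cases "0 \<le> \<lfloor>t\<rfloor>")
    case True
    then have "t = frac t + real (nat \<lfloor>t\<rfloor>)" by (simp add: frac_def)
    then show ?thesis by (metis nat)
  next
    case False
    then have "frac t = t + real (nat (- \<lfloor>t\<rfloor>))" by (simp add: frac_def)
    then show ?thesis by (metis nat)
  qed
qed

text \<open>The condition \<open>left\<close> says that \<open>\<Omega>\<close> lies to the left of every tangent line; it expresses both the
  positive orientation and the fact that tangents are supporting lines.\<close>

locale convex_contour =
  fixes \<Omega> :: "complex set" and \<gamma> \<gamma>' :: "real \<Rightarrow> complex"
  assumes open_\<Omega>: "open \<Omega>" and convex_\<Omega>: "convex \<Omega>" and bounded_\<Omega>: "bounded \<Omega>"
    and deriv: "\<And>t. (\<gamma> has_vector_derivative \<gamma>' t) (at t)"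
    and cont': "continuous_on UNIV \<gamma>'"
    and periodic: "\<And>t. \<gamma> (t + 1) = \<gamma> t"
    and inj: "inj_on \<gamma> {0..<1}"
    and image: "\<gamma> ` {0..<1} = frontier \<Omega>"
    and nz: "\<And>t. \<gamma>' t \<noteq> 0"
    and left: "\<And>a t. a \<in> \<Omega> \<Longrightarrow> 0 \<le> Im (\<gamma>' t * cnj (\<gamma> t - a))"
begin

lemma cont: "continuous_on S \<gamma>"
  by (intro continuous_at_imp_continuous_on ballI has_vector_derivative_continuous[OF deriv])

lemma cont'': "continuous_on S \<gamma>'"
  using cont' continuous_on_subset by blast

lemma periodic': "\<gamma>' (t + 1) = \<gamma>' t"
proof -
  have "((\<lambda>x. \<gamma> (x + 1)) has_vector_derivative \<gamma>' (t + 1)) (at t)"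
    using vector_diff_chain_at[of "\<lambda>x. x + 1" 1 t \<gamma> "\<gamma>' (t + 1)"] deriv[of "t + 1"]
    by (simp add: o_def has_vector_derivative_add_const)
  then show ?thesis unfolding periodic using deriv vector_derivative_unique_at by blast
qed

lemma frac_eq: "\<gamma> (frac t) = \<gamma> t"
  by (rule periodic_frac) (rule periodic)

lemma in_frontier: "\<gamma> t \<in> frontier \<Omega>"
  using image frac_eq[of t] frac_ge_0[of t] frac_lt_1[of t]
  by (metis atLeastLessThan_iff image_eqI)

lemma in_closure: "\<gamma> t \<in> closure \<Omega>"
  using in_frontier[of t] by (simp add: frontier_def)

lemma not_in: "\<gamma> t \<notin> \<Omega>"
  using in_frontier[of t] open_\<Omega> by (simp add: frontier_def interior_open)

lemma eq_imp_Ints: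
  assumes "\<gamma> s = \<gamma> t" shows "s - t \<in> \<int>"
proof -
  have "frac s = frac t"
    using assms by (intro inj_onD[OF inj]) (simp_all add: frac_eq frac_ge_0 frac_lt_1)
  then have "s - t = of_int (\<lfloor>s\<rfloor> - \<lfloor>t\<rfloor>)" by (simp add: frac_def)
  then show ?thesis by (metis Ints_of_int)
qed

lemma neq_within_period:
  assumes "t0 < t" "t < t0 + 1" shows "\<gamma> t \<noteq> \<gamma> t0"
proof
  assume "\<gamma> t = \<gamma> t0"
  then obtain n :: int where "t - t0 = of_int n" using eq_imp_Ints Ints_cases by metis
  with assms have "0 < n" "n < 1" by (metis diff_gt_0_iff_gt of_int_0_less_iff, metis add.commute diff_less_eq of_int_less_1_iff)
  then show False by simp
qed

lemma left_closure:
  assumes "a \<in> closure \<Omega>" shows "0 \<le> Im (\<gamma>' t * cnj (\<gamma> t - a))"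
proof (rule continuous_ge_on_closure[OF _ assms])
  show "continuous_on (closure \<Omega>) (\<lambda>a. Im (\<gamma>' t * cnj (\<gamma> t - a)))"
    by (intro continuous_intros)
qed (rule left)

lemma path: "path \<gamma>"
  by (simp add: path_def cont)

lemma closed: "pathfinish \<gamma> = pathstart \<gamma>"
  using periodic[of 0] by (simp add: pathfinish_def pathstart_def)

lemma path_image: "path_image \<gamma> = frontier \<Omega>"
proof -
  have "{0..1::real} = {0..<1} \<union> {1}" by auto
  then have "path_image \<gamma> = \<gamma> ` {0..<1} \<union> {\<gamma> 1}" by (simp add: path_image_def)
  also have "\<gamma> 1 = \<gamma> 0" using periodic[of 0] by simp
  finally show ?thesis using image by auto
qed

lemma vector_derivative: "vector_derivative \<gamma> (at t) = \<gamma>' t"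
  by (rule vector_derivative_at[OF deriv])

lemma valid_path: "valid_path \<gamma>"
  unfolding valid_path_def
  by (rule C1_differentiable_imp_piecewise) (auto simp: C1_differentiable_on_def intro!: exI[of _ \<gamma>'] deriv cont'')

lemma simple_path: "simple_path \<gamma>"
  unfolding simple_path_def loop_free_def
proof (intro conjI ballI impI path)
  fix x y :: real assume xy: "x \<in> {0..1}" "y \<in> {0..1}" "\<gamma> x = \<gamma> y"
  then obtain n :: int where n: "x - y = of_int n" using eq_imp_Ints Ints_cases by metis
  then have "of_int n \<le> (of_int 1::real)" "(of_int (-1)::real) \<le> of_int n" using xy by auto
  then have "n \<le> 1" "-1 \<le> n" by (simp_all only: of_int_le_iff)
  then have "n = 0 \<or> n = 1 \<or> n = -1" by auto
  then show "x = y \<or> x = 0 \<and> y = 1 \<or> x = 1 \<and> y = 0" using n xy by auto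
qed

lemma has_contour_integral_iff:
  "(f has_contour_integral I) \<gamma> \<longleftrightarrow> ((\<lambda>t. f (\<gamma> t) * \<gamma>' t) has_integral I) {0..1}"
  by (simp add: has_contour_integral vector_derivative)

lemma contour_integral_eq_integral: "contour_integral \<gamma> f = integral {0..1} (\<lambda>t. f (\<gamma> t) * \<gamma>' t)"
  by (simp add: contour_integral_integral vector_derivative)

lemma contour_integral_cmult: "contour_integral \<gamma> (\<lambda>z. c * f z) = c * contour_integral \<gamma> f"
  by (simp add: contour_integral_eq_integral mult.assoc)

lemma inside: "inside (path_image \<gamma>) = \<Omega>"
  unfolding path_image using inside_frontier_eq_interior[OF bounded_\<Omega> convex_\<Omega>] open_\<Omega>
  by (simp add: interior_open)

lemma winding_number_1:
  assumes "z \<in> \<Omega>" shows "winding_number \<gamma> z = 1"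
proof -
  have z: "z \<notin> path_image \<gamma>" using assms open_\<Omega> by (simp add: path_image frontier_def interior_open)
  have "0 \<le> Re (winding_number \<gamma> z)"
    by (rule winding_number_pos_le[OF valid_path z]) (use left[OF assms] vector_derivative in simp)
  moreover have "(\<forall>z\<in>\<Omega>. winding_number \<gamma> z = 1) \<or> (\<forall>z\<in>\<Omega>. winding_number \<gamma> z = - 1)"
    by (rule simple_closed_path_winding_number_inside[OF simple_path]) (simp_all add: inside)
  then have "winding_number \<gamma> z = 1 \<or> winding_number \<gamma> z = - 1" using assms by blast
  ultimately show ?thesis by auto
qed

lemma Cauchy_formula:
  assumes S: "open S" "convex S" "closure \<Omega> \<subseteq> S" "f holomorphic_on S" and z: "z \<in> \<Omega>"
  shows "((\<lambda>t. f (\<gamma> t) * (\<gamma>' t / (\<gamma> t - z))) has_integral (2 * pi * \<i> * f z)) {0..1}"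
proof -
  have "((\<lambda>w. f w / (w - z)) has_contour_integral (2*pi * \<i> * winding_number \<gamma> z * f z)) \<gamma>"
  proof (rule Cauchy_integral_formula_convex_simple[OF S(2,4)])
    show "z \<in> interior S" using z S closure_subset by (auto simp: interior_open)
    show "path_image \<gamma> \<subseteq> S - {z}"
      using S(3) z open_\<Omega> by (auto simp: path_image frontier_def interior_open)
  qed (simp_all add: valid_path closed)
  then show ?thesis by (simp add: has_contour_integral_iff winding_number_1[OF z])
qed

subsection \<open>The double layer kernel\<close>

definition kernel :: "complex \<Rightarrow> real \<Rightarrow> real"
  where "kernel z t = Im (\<gamma>' t / (\<gamma> t - z))"

lemma kernel_nonneg:
  assumes "z \<in> closure \<Omega>" shows "0 \<le> kernel z t"
  using left_closure[OF assms, of t]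
  by (simp only: kernel_def complex_div_cnj[of "\<gamma>' t"] Im_divide_of_real zero_le_power2 divide_nonneg_nonneg
      flip: of_real_power)

lemma kernel_continuous: "continuous_on S (kernel z)" if "\<And>t. t \<in> S \<Longrightarrow> \<gamma> t \<noteq> z"
  unfolding kernel_def by (intro continuous_intros cont cont'') (use that in auto)

lemma kernel_periodic: "kernel z (t + 1) = kernel z t"
  by (simp add: kernel_def periodic periodic')

lemma integral_kernel: "(kernel z has_integral 2 * pi) {0..1}" if "z \<in> \<Omega>"
proof -
  have "((\<lambda>t. 1 * (\<gamma>' t / (\<gamma> t - z))) has_integral (2 * pi * \<i> * 1)) {0..1}"
    by (rule Cauchy_formula[OF open_UNIV convex_UNIV _ _ that]) auto
  from has_integral_linear[OF this bounded_linear_Im] show ?thesis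
    by (simp add: o_def kernel_def[abs_def])
qed

text \<open>The boundary curve, seen from one of its own points, stays in a half plane, so it subtends an
  angle of at most \<open>\<pi>\<close> there: half of what it subtends at an interior point.\<close>

lemma integral_kernel_boundary:
  assumes "t0 < a" "a \<le> b" "b < t0 + 1"
  shows "integral {a..b} (kernel (\<gamma> t0)) \<le> pi"
proof -
  define \<tau> where "\<tau> = \<gamma>' t0"
  \<comment> \<open>Divided by the tangent direction and rotated into the closed right half plane, where the principal logarithm
    is smooth off the origin and its imaginary part is at most \<open>\<pi> / 2\<close> in modulus.\<close>
  define y where "y t = - \<i> * ((\<gamma> t - \<gamma> t0) / \<tau>)" for t
  have \<tau>: "\<tau> \<noteq> 0" using nz by (simp add: \<tau>_def)
  have ne: "\<gamma> t \<noteq> \<gamma> t0" if "t \<in> {a..b}" for t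
    using neq_within_period[of t0 t] assms that by auto
  have y0: "y t \<noteq> 0" if "t \<in> {a..b}" for t using ne[OF that] \<tau> by (simp add: y_def)
  have Re_y: "0 \<le> Re (y t)" for t
  proof -
    define q where "q = (\<gamma> t - \<gamma> t0) / \<tau>"
    have "\<gamma> t0 - \<gamma> t = - (\<tau> * q)" using \<tau> by (simp add: q_def)
    then have "\<tau> * cnj (\<gamma> t0 - \<gamma> t) = of_real ((cmod \<tau>)\<^sup>2) * (- cnj q)"
      by (simp add: complex_norm_square del: of_real_power)
    then have "Im (\<tau> * cnj (\<gamma> t0 - \<gamma> t)) = (cmod \<tau>)\<^sup>2 * Re (y t)"
      by (simp add: y_def q_def[symmetric] del: of_real_power)
    then have "0 \<le> (cmod \<tau>)\<^sup>2 * Re (y t)"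
      using left_closure[OF in_closure[of t], of t0] unfolding \<tau>_def[symmetric] by simp
    then show ?thesis using \<tau> by (simp add: zero_le_mult_iff)
  qed
  have der: "((Ln \<circ> y) has_vector_derivative (\<gamma>' t / (\<gamma> t - \<gamma> t0))) (at t)" if t: "t \<in> {a..b}" for t
  proof -
    have "y t \<notin> \<real>\<^sub>\<le>\<^sub>0"
      using y0[OF t] Re_y[of t] by (auto simp: complex_nonpos_Reals_iff complex_eq_iff)
    then have "(Ln has_field_derivative inverse (y t)) (at (y t))" by (rule has_field_derivative_Ln)
    moreover have "(y has_vector_derivative (- \<i> * (\<gamma>' t / \<tau>))) (at t)"
      unfolding y_def using has_vector_derivative_mult_right[OF has_vector_derivative_divide[OF
          iffD2[OF has_vector_derivative_diff_const deriv[of t], of "\<gamma> t0"], of \<tau>], of "- \<i>"] by simp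
    ultimately have "((Ln \<circ> y) has_vector_derivative (- \<i> * (\<gamma>' t / \<tau>)) * inverse (y t)) (at t)"
      by (rule field_vector_diff_chain_at[rotated])
    moreover have "(- \<i> * (\<gamma>' t / \<tau>)) * inverse (y t) = \<gamma>' t / (\<gamma> t - \<gamma> t0)"
      using \<tau> ne[OF t] by (simp add: y_def field_simps)
    ultimately show ?thesis by simp
  qed
  have "((\<lambda>t. \<gamma>' t / (\<gamma> t - \<gamma> t0)) has_integral ((Ln \<circ> y) b - (Ln \<circ> y) a)) {a..b}"
    by (rule fundamental_theorem_of_calculus[OF assms(2)])
      (rule has_vector_derivative_at_within, rule der)
  from has_integral_linear[OF this bounded_linear_Im]
  have "integral {a..b} (kernel (\<gamma> t0)) = Im (Ln (y b)) - Im (Ln (y a))"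
    by (simp add: o_def kernel_def[abs_def] integral_unique)
  moreover have "\<bar>Im (Ln (y a))\<bar> \<le> pi / 2" "\<bar>Im (Ln (y b))\<bar> \<le> pi / 2"
    using Re_Ln_pos_le[OF y0] Re_y assms by auto
  ultimately show ?thesis by linarith
qed

subsection \<open>The Cauchy transform of a conjugate\<close>

text \<open>The antilinear map of Crouzeix and Palencia.\<close>

definition conj_transform :: "(complex \<Rightarrow> complex) \<Rightarrow> complex \<Rightarrow> complex"
  where "conj_transform h z = contour_integral \<gamma> (\<lambda>\<zeta>. cnj (h \<zeta>) / (\<zeta> - z)) / (2 * pi * \<i>)"

text \<open>The kernel is real, so Cauchy's formula for \<open>h\<close> differs from the integral against the kernel by the
  conjugate of the Cauchy integral of \<open>cnj h\<close>.\<close>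

lemma integral_kernel_mult:
  assumes S: "open S" "convex S" "closure \<Omega> \<subseteq> S" "h holomorphic_on S" and z: "z \<in> \<Omega>"
  shows "((\<lambda>t. h (\<gamma> t) * of_real (kernel z t)) has_integral pi * (h z + cnj (conj_transform h z))) {0..1}"
proof -
  define I where "I = integral {0..1} (\<lambda>t. cnj (h (\<gamma> t)) * (\<gamma>' t / (\<gamma> t - z)))"
  have ne: "\<gamma> t \<noteq> z" for t using not_in[of t] z by auto
  have "continuous_on (closure \<Omega>) h"
    by (rule holomorphic_on_imp_continuous_on[OF holomorphic_on_subset[OF S(4,3)]])
  then have "continuous_on {0..1} (\<lambda>t. h (\<gamma> t))"
    by (rule continuous_on_compose2) (auto simp: cont in_closure)
  then have "continuous_on {0..1} (\<lambda>t. cnj (h (\<gamma> t)) * (\<gamma>' t / (\<gamma> t - z)))"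
    by (intro continuous_intros cont cont'') (use ne in auto)
  then have I: "((\<lambda>t. cnj (h (\<gamma> t)) * (\<gamma>' t / (\<gamma> t - z))) has_integral I) {0..1}"
    unfolding I_def by (intro integrable_integral integrable_continuous_interval)
  have "((\<lambda>t. h (\<gamma> t) * (\<gamma>' t / (\<gamma> t - z)) - cnj (cnj (h (\<gamma> t)) * (\<gamma>' t / (\<gamma> t - z))))
      has_integral (2 * pi * \<i> * h z - cnj I)) {0..1}"
    using has_integral_linear[OF I bounded_linear_cnj] 
    by (intro has_integral_diff Cauchy_formula[OF S z]) (simp add: o_def)
  then have "((\<lambda>t. (1 / (2 * \<i>)) * (h (\<gamma> t) * (\<gamma>' t / (\<gamma> t - z)) - cnj (cnj (h (\<gamma> t)) * (\<gamma>' t / (\<gamma> t - z)))))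
      has_integral (1 / (2 * \<i>)) * (2 * pi * \<i> * h z - cnj I)) {0..1}"
    by (rule has_integral_mult_right)
  moreover have "(1 / (2 * \<i>)) * (h (\<gamma> t) * (\<gamma>' t / (\<gamma> t - z)) - cnj (cnj (h (\<gamma> t)) * (\<gamma>' t / (\<gamma> t - z))))
      = h (\<gamma> t) * of_real (kernel z t)" for t
  proof -
    define w where "w = \<gamma>' t / (\<gamma> t - z)"
    have "w - cnj w = 2 * \<i> * of_real (Im w)" by (simp add: complex_eq_iff)
    then have "h (\<gamma> t) * (w - cnj w) = (2 * \<i>) * (h (\<gamma> t) * of_real (Im w))"
      by (simp only: mult_ac)
    moreover have "h (\<gamma> t) * w - cnj (cnj (h (\<gamma> t)) * w) = h (\<gamma> t) * (w - cnj w)"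
      by (simp add: right_diff_distrib)
    ultimately have eq: "h (\<gamma> t) * w - cnj (cnj (h (\<gamma> t)) * w) = (2 * \<i>) * (h (\<gamma> t) * of_real (Im w))"
      by (rule trans[rotated])
    have "(1 / (2 * \<i>)) * (h (\<gamma> t) * w - cnj (cnj (h (\<gamma> t)) * w)) = h (\<gamma> t) * of_real (Im w)"
      unfolding eq by simp
    then show ?thesis by (simp add: w_def kernel_def)
  qed
  moreover have "(1 / (2 * \<i>)) * (2 * pi * \<i> * h z - cnj I) = pi * (h z + cnj (conj_transform h z))"
    by (simp add: conj_transform_def contour_integral_eq_integral I_def field_simps)
  ultimately show ?thesis by simp
qed

lemma conj_transform_holomorphic:
  assumes "continuous_on (closure \<Omega>) h"
  shows "conj_transform h holomorphic_on \<Omega>"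
  unfolding holomorphic_on_open[OF open_\<Omega>]
proof
  fix z assume z: "z \<in> \<Omega>"
  have fr: "path_image \<gamma> \<subseteq> closure \<Omega>" unfolding path_image frontier_def by auto
  have cnjh: "continuous_on (path_image \<gamma>) (\<lambda>\<zeta>. cnj (h \<zeta>))"
    by (intro continuous_intros continuous_on_subset[OF assms fr])
  obtain B where B: "\<And>t. t \<in> {0..1} \<Longrightarrow> norm (vector_derivative \<gamma> (at t)) \<le> B"
  proof -
    have "bounded (\<gamma>' ` {0..1})" by (intro compact_imp_bounded compact_continuous_image cont'') auto
    then obtain B where "\<forall>x\<in>\<gamma>' ` {0..1}. norm x \<le> B" unfolding bounded_iff by blast
    then show thesis by (intro that) (auto simp: vector_derivative)
  qed
  have int: "((\<lambda>\<zeta>. cnj (h \<zeta>) / (\<zeta> - w) ^ 1) has_contour_integral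
      contour_integral \<gamma> (\<lambda>\<zeta>. cnj (h \<zeta>) / (\<zeta> - w))) \<gamma>" if w: "w \<in> \<Omega> - path_image \<gamma>" for w
  proof -
    have "continuous_on {0..1} (\<lambda>t. cnj (h (\<gamma> t)) / (\<gamma> t - w) * \<gamma>' t)"
      using w by (intro continuous_intros cont cont'' continuous_on_compose2[OF cnjh])
        (auto simp: path_image_def)
    then show ?thesis
      unfolding has_contour_integral_iff contour_integral_eq_integral
      by (simp add: integrable_integral integrable_continuous_interval)
  qed
  have "z \<in> \<Omega> - path_image \<gamma>" using z open_\<Omega> by (simp add: path_image frontier_def interior_open)
  from Cauchy_next_derivative(2)[OF cnjh B int _ open_\<Omega> valid_path this]
  have "((\<lambda>w. contour_integral \<gamma> (\<lambda>\<zeta>. cnj (h \<zeta>) / (\<zeta> - w))) has_field_derivative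
      (1 * contour_integral \<gamma> (\<lambda>\<zeta>. cnj (h \<zeta>) / (\<zeta> - z) ^ Suc 1))) (at z)" by simp
  then show "\<exists>f'. (conj_transform h has_field_derivative f') (at z)"
    unfolding conj_transform_def[abs_def] by (auto dest: DERIV_cdivide)
qed

text \<open>For \<open>z\<close> near a boundary point \<open>\<sigma>\<close>, the kernel of total mass \<open>2 \<pi>\<close> puts at most about \<open>\<pi>\<close> on the part of the
  boundary away from \<open>\<sigma>\<close>. On the rest \<open>h\<close> is almost the constant \<open>h \<sigma>\<close>, which the term \<open>- \<pi> h z\<close> offsets.\<close>

lemma conj_transform_near_boundary:
  assumes S: "open S" "convex S" "closure \<Omega> \<subseteq> S" "h holomorphic_on S"
    and h1: "\<And>z. z \<in> closure \<Omega> \<Longrightarrow> cmod (h z) \<le> 1"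
    and \<sigma>: "\<sigma> \<in> frontier \<Omega>" and e: "0 < e"
  shows "\<exists>\<delta>>0. \<forall>z\<in>\<Omega>. dist z \<sigma> < \<delta> \<longrightarrow> cmod (conj_transform h z) \<le> 1 + 5 * e"
proof -
  obtain t0 where t0: "t0 \<in> {0..<1}" "\<gamma> t0 = \<sigma>" using \<sigma> unfolding image[symmetric] by blast
  have \<sigma>cl: "\<sigma> \<in> closure \<Omega>" using \<sigma> by (simp add: frontier_def)
  have hcont: "continuous_on S h" using S(4) by (rule holomorphic_on_imp_continuous_on)
  have h\<gamma>: "continuous_on T (\<lambda>t. h (\<gamma> t))" for T
    by (rule continuous_on_compose2[OF hcont cont]) (use in_closure S(3) in auto)
  obtain \<kappa> where \<kappa>: "0 < \<kappa>" "\<kappa> < 1/2" "\<And>t. \<bar>t - t0\<bar> \<le> \<kappa> \<Longrightarrow> cmod (h (\<gamma> t) - h \<sigma>) \<le> e"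
  proof -
    have "isCont (\<lambda>t. h (\<gamma> t)) t0"
      using h\<gamma>[of UNIV] by (simp add: continuous_on_eq_continuous_at)
    then obtain d where d: "d > 0" "\<And>t. dist t t0 < d \<Longrightarrow> dist (h (\<gamma> t)) (h (\<gamma> t0)) < e"
      using e unfolding continuous_at_eps_delta by blast
    show thesis
    proof (rule that[of "min (d / 2) (1 / 4)"])
      show "cmod (h (\<gamma> t) - h \<sigma>) \<le> e" if "\<bar>t - t0\<bar> \<le> min (d / 2) (1 / 4)" for t
        using d(2)[of t] d(1) that t0 by (simp add: dist_norm)
    qed (use d in auto)
  qed
  define a where "a = t0 + \<kappa>"
  define b where "b = t0 + 1 - \<kappa>"
  have ab: "t0 < a" "a \<le> b" "b < t0 + 1" "t0 \<le> a" "a \<le> t0 + 1" "b \<le> t0 + 1" using \<kappa> by (auto simp: a_def b_def)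
  have near: "cmod (h (\<gamma> t) - h \<sigma>) \<le> e" if "t \<in> {t0..a} \<or> t \<in> {b..t0 + 1}" for t
    using that
  proof
    assume "t \<in> {t0..a}" then show ?thesis by (intro \<kappa>) (auto simp: a_def)
  next
    assume "t \<in> {b..t0 + 1}"
    then have "cmod (h (\<gamma> (t - 1)) - h \<sigma>) \<le> e" by (intro \<kappa>) (auto simp: b_def)
    then show ?thesis using periodic[of "t - 1"] by simp
  qed
  obtain d where d: "d > 0" "\<And>t. t \<in> {a..b} \<Longrightarrow> d \<le> dist \<sigma> (\<gamma> t)"
  proof -
    have "closed (\<gamma> ` {a..b})"
      by (intro compact_imp_closed compact_continuous_image cont) auto
    moreover have "\<sigma> \<notin> \<gamma> ` {a..b}"
    proof
      assume "\<sigma> \<in> \<gamma> ` {a..b}"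
      then obtain t where "t \<in> {a..b}" "\<gamma> t = \<gamma> t0" using t0 by auto
      then show False using neq_within_period[of t0 t] ab by auto
    qed
    ultimately show thesis using separate_point_closed[of "\<gamma> ` {a..b}" \<sigma>] that by blast
  qed
  have "continuous_on (ball \<sigma> d) (\<lambda>z. integral (cbox a b) (\<lambda>t. kernel z t))"
  proof (rule integral_continuous_on_param)
    have "\<gamma> t \<noteq> z" if "t \<in> cbox a b" "z \<in> ball \<sigma> d" for t z
      using d(2)[of t] that by auto
    then show "continuous_on (ball \<sigma> d \<times> cbox a b) (\<lambda>(z, t). kernel z t)"
      unfolding kernel_def case_prod_beta
      by (intro continuous_intros continuous_on_compose2[OF cont] continuous_on_compose2[OF cont'']) auto
  qed
  then have "isCont (\<lambda>z. integral {a..b} (kernel z)) \<sigma>"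
    using d(1) by (simp add: continuous_on_eq_continuous_at)
  then obtain d1 where d1: "d1 > 0" "\<And>z. dist z \<sigma> < d1 \<Longrightarrow>
      dist (integral {a..b} (kernel z)) (integral {a..b} (kernel \<sigma>)) < pi * e"
    unfolding continuous_at_eps_delta using e by (metis mult_pos_pos pi_gt_zero)
  have "\<sigma> \<in> S" using \<sigma>cl S(3) by blast
  then have "isCont h \<sigma>" using hcont S(1) by (simp add: continuous_on_eq_continuous_at)
  then obtain d2 where d2: "d2 > 0" "\<And>z. dist z \<sigma> < d2 \<Longrightarrow> dist (h z) (h \<sigma>) < e"
    unfolding continuous_at_eps_delta using e by blast
  show ?thesis
  proof (intro exI[of _ "min d1 d2"] conjI ballI impI)
    show "0 < min d1 d2" using d1 d2 by simp
    fix z assume z: "z \<in> \<Omega>" "dist z \<sigma> < min d1 d2"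
    define F where "F t = h (\<gamma> t) * of_real (kernel z t)" for t
    define m where "m = integral {a..b} (kernel z)"
    define n1 where "n1 = integral {t0..a} (kernel z)"
    define n2 where "n2 = integral {b..t0 + 1} (kernel z)"
    have z': "z \<in> closure \<Omega>" using z closure_subset by blast
    have ne: "\<gamma> t \<noteq> z" for t using not_in[of t] z by auto
    have kc: "continuous_on T (kernel z)" for T by (rule kernel_continuous) (rule ne)
    have Fc: "continuous_on T F" for T unfolding F_def by (intro continuous_intros h\<gamma> kc)
    have Fp: "F (t + 1) = F t" for t by (simp add: F_def kernel_periodic periodic)
    have ki: "kernel z integrable_on {x..y}" and Fi: "F integrable_on {x..y}" for x y
      using kc Fc by (auto intro: integrable_continuous_interval)
    have k0: "0 \<le> kernel z t" for t by (rule kernel_nonneg[OF z'])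
    have split: "integral {t0..a} f + integral {a..b} f + integral {b..t0 + 1} f = integral {0..1} f"
      if "\<And>x y. f integrable_on {x..y}" "continuous_on UNIV f" "\<And>t. f (t + 1) = f t"
      for f :: "real \<Rightarrow> 'b::banach"
    proof -
      have "integral {t0..a} f + integral {a..b} f = integral {t0..b} f"
        by (rule Henstock_Kurzweil_Integration.integral_combine) (use ab that in auto)
      moreover have "integral {t0..b} f + integral {b..t0 + 1} f = integral {t0..t0 + 1} f"
        by (rule Henstock_Kurzweil_Integration.integral_combine) (use ab that in auto)
      moreover have "integral {t0..t0 + 1} f = integral {0..1} f"
        by (rule integral_periodic) (use that t0 in auto)
      ultimately show ?thesis by simp
    qed
    have ksum: "n1 + m + n2 = 2 * pi"
      unfolding n1_def m_def n2_def using split[OF ki kc] integral_kernel[OF z(1)]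
      by (simp add: kernel_periodic integral_unique)
    have Fsum: "integral {t0..a} F + integral {a..b} F + integral {b..t0 + 1} F
        = pi * (h z + cnj (conj_transform h z))"
      using split[OF Fi Fc] integral_unique[OF integral_kernel_mult[OF S z(1)], folded F_def]
      by (simp add: Fp)
    have far: "cmod (integral {a..b} F) \<le> m"
      unfolding m_def
    proof (rule integral_norm_bound_integral[OF Fi ki])
      show "cmod (F t) \<le> kernel z t" for t
        using h1[OF in_closure[of t]] k0[of t] by (simp add: F_def norm_mult mult_left_le_one_le)
    qed
    have nearI: "cmod (integral {x..y} F - h \<sigma> * of_real (integral {x..y} (kernel z))) \<le> e * integral {x..y} (kernel z)"
      if xy: "\<And>t. t \<in> {x..y} \<Longrightarrow> cmod (h (\<gamma> t) - h \<sigma>) \<le> e" for x y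
    proof -
      have "((\<lambda>t. complex_of_real (kernel z t)) has_integral of_real (integral {x..y} (kernel z))) {x..y}"
        by (rule has_integral_of_real[OF integrable_integral[OF ki]])
      then have hk: "((\<lambda>t. h \<sigma> * of_real (kernel z t)) has_integral (h \<sigma> * of_real (integral {x..y} (kernel z)))) {x..y}"
        by (rule has_integral_mult_right)
      have "cmod (integral {x..y} (\<lambda>t. F t - h \<sigma> * of_real (kernel z t))) \<le> integral {x..y} (\<lambda>t. e * kernel z t)"
      proof (rule integral_norm_bound_integral)
        show "(\<lambda>t. F t - h \<sigma> * of_real (kernel z t)) integrable_on {x..y}"
          using Fi hk by (intro integrable_diff) (auto simp: integrable_on_def)
        show "(\<lambda>t. e * kernel z t) integrable_on {x..y}"
          using ki by (intro integrable_on_mult_right)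
        show "cmod (F t - h \<sigma> * of_real (kernel z t)) \<le> e * kernel z t" if "t \<in> {x..y}" for t
          using xy[OF that] k0[of t]
          by (simp add: F_def norm_mult mult_right_mono flip: left_diff_distrib)
      qed
      then show ?thesis
        by (simp only: integral_unique[OF has_integral_diff[OF integrable_integral[OF Fi] hk]] integral_mult_right)
    qed
    have "cmod (integral {t0..a} F - h \<sigma> * of_real n1) \<le> e * n1"
      "cmod (integral {b..t0+1} F - h \<sigma> * of_real n2) \<le> e * n2"
      unfolding n1_def n2_def by (rule nearI; use near in blast)+
    moreover have "cmod (h \<sigma> * of_real (pi - m)) \<le> \<bar>pi - m\<bar>"
      using h1[OF \<sigma>cl] by (simp add: norm_mult mult_left_le_one_le flip: of_real_diff)
    moreover have "cmod (of_real pi * (h \<sigma> - h z)) \<le> pi * e"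
      using d2(2)[of z] z by (simp add: norm_mult dist_norm norm_minus_commute)
    moreover have "of_real pi * cnj (conj_transform h z) =
      integral {a..b} F + (integral {t0..a} F - h \<sigma> * of_real n1) + (integral {b..t0+1} F - h \<sigma> * of_real n2)
      + h \<sigma> * of_real (pi - m) + of_real pi * (h \<sigma> - h z)"
    proof -
      have n: "complex_of_real n1 + of_real n2 = 2 * of_real pi - of_real m"
        using arg_cong[OF ksum, of complex_of_real] by (simp add: algebra_simps)
      have "of_real pi * cnj (conj_transform h z)
          = (integral {t0..a} F + integral {a..b} F + integral {b..t0 + 1} F) - of_real pi * h z"
        unfolding Fsum by (simp add: algebra_simps)
      moreover have "h \<sigma> * of_real n1 + h \<sigma> * of_real n2 = h \<sigma> * (2 * of_real pi - of_real m)"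
        unfolding n[symmetric] by (simp add: algebra_simps)
      ultimately show ?thesis by (simp add: algebra_simps)
    qed
    ultimately have "cmod (of_real pi * cnj (conj_transform h z)) \<le> m + e * n1 + e * n2 + \<bar>pi - m\<bar> + pi * e"
      using far by (smt (verit, ccfv_threshold) norm_triangle_ineq)
    moreover have "e * n1 + e * n2 \<le> 2 * pi * e"
    proof -
      have "0 \<le> m" unfolding m_def by (intro Henstock_Kurzweil_Integration.integral_nonneg ki k0)
      then have "e * (n1 + n2) \<le> e * (2 * pi)" using ksum e by (intro mult_left_mono) auto
      then show ?thesis by (simp add: algebra_simps)
    qed
    moreover have "m \<le> pi + pi * e"
      using d1(2)[of z] z integral_kernel_boundary[OF ab(1-3)] unfolding t0(2) m_def
      by (simp add: dist_real_def)
    moreover have "0 < pi * e" using e by simp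
    ultimately have "pi * cmod (conj_transform h z) \<le> pi * (1 + 5 * e)"
      by (simp add: norm_mult algebra_simps abs_if split: if_splits)
    then show "cmod (conj_transform h z) \<le> 1 + 5 * e"
      by (simp add: mult_le_cancel_left_pos)
  qed
qed

theorem cmod_conj_transform_le_1:
  assumes S: "open S" "convex S" "closure \<Omega> \<subseteq> S" "h holomorphic_on S"
    and h1: "\<And>z. z \<in> closure \<Omega> \<Longrightarrow> cmod (h z) \<le> 1" and z: "z \<in> \<Omega>"
  shows "cmod (conj_transform h z) \<le> 1"
proof (rule maximum_modulus_limsup[OF open_\<Omega> convex_connected[OF convex_\<Omega>] bounded_\<Omega> _ _ z])
  show "conj_transform h holomorphic_on \<Omega>"
    by (rule conj_transform_holomorphic[OF holomorphic_on_imp_continuous_on[OF holomorphic_on_subset[OF S(4,3)]]])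
  show "\<exists>\<delta>>0. \<forall>z\<in>\<Omega>. dist z \<sigma> < \<delta> \<longrightarrow> cmod (conj_transform h z) \<le> 1 + e"
    if "\<sigma> \<in> frontier \<Omega>" "0 < e" for \<sigma> e
    using conj_transform_near_boundary[OF S h1 that(1), of "e / 5"] that(2) by simp
qed

subsection \<open>Scaled contours and polynomial approximation\<close>

lemma dilated:
  assumes s: "0 < s" shows "convex_contour (dil c s ` \<Omega>) (\<lambda>t. dil c s (\<gamma> t)) (\<lambda>t. of_real s * \<gamma>' t)"
proof
  have "inj (dil c s)" using s by (intro inj_dil) simp
  then show "inj_on (\<lambda>t. dil c s (\<gamma> t)) {0..<1}"
    using inj by (auto simp: inj_on_def)
  show "(\<lambda>t. dil c s (\<gamma> t)) ` {0..<1} = frontier (dil c s ` \<Omega>)"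
    using s by (simp add: frontier_dil open_\<Omega> image[symmetric] image_image)
  show "((\<lambda>t. dil c s (\<gamma> t)) has_vector_derivative of_real s * \<gamma>' t) (at t)" for t
    unfolding dil_def using has_vector_derivative_mult_right[OF
        iffD2[OF has_vector_derivative_diff_const deriv[of t], of c], of "of_real s"]
    by (simp add: has_vector_derivative_add_const add.commute[of c])
  show "0 \<le> Im (of_real s * \<gamma>' t * cnj (dil c s (\<gamma> t) - a))" if a: "a \<in> dil c s ` \<Omega>" for a t
  proof -
    obtain b where b: "b \<in> \<Omega>" "a = dil c s b" using a by blast
    have "of_real s * \<gamma>' t * cnj (dil c s (\<gamma> t) - a) = of_real (s * s) * (\<gamma>' t * cnj (\<gamma> t - b))"
      unfolding b dil_diff by simp
    moreover have "Im (of_real r * w) = r * Im w" for r w by simp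
    ultimately show ?thesis using left[OF b(1), of t] by (simp only: mult_nonneg_nonneg zero_le_square)
  qed
qed (use s in \<open>auto simp: open_dil open_\<Omega> convex_dil convex_\<Omega> bounded_dil bounded_\<Omega> periodic nz
      intro!: continuous_intros cont'\<close>)

lemma poly_approximable_holomorphic:
  assumes S: "open S" "convex S" "closure \<Omega> \<subseteq> S" "f holomorphic_on S"
    and E: "compact E" "convex E" "E \<subseteq> \<Omega>"
  shows "poly_approximable E f"
proof -
  have "continuous_on (closure \<Omega>) f"
    by (rule holomorphic_on_imp_continuous_on[OF holomorphic_on_subset[OF S(4,3)]])
  then have "continuous_on {0..1} (\<lambda>t. f (\<gamma> t))"
    by (rule continuous_on_compose2) (auto simp: cont in_closure)
  then have "poly_approximable E (\<lambda>z. integral {0..1} (\<lambda>t. (f (\<gamma> t) * \<gamma>' t) / (\<gamma> t - z)))"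
    using E not_in by (intro poly_approximable_Cauchy_transform continuous_intros cont cont'') auto
  then have "poly_approximable E (\<lambda>z. 1 / (2 * pi * \<i>) * integral {0..1} (\<lambda>t. (f (\<gamma> t) * \<gamma>' t) / (\<gamma> t - z)))"
    by (rule poly_approximable_cmult)
  moreover have "1 / (2 * pi * \<i>) * integral {0..1} (\<lambda>t. (f (\<gamma> t) * \<gamma>' t) / (\<gamma> t - z)) = f z" if "z \<in> E" for z
    using integral_unique[OF Cauchy_formula[OF S, of z]] that E by auto
  ultimately show ?thesis by (subst poly_approximable_cong[symmetric]) auto
qed

lemma poly_approximable_conj_transform:
  assumes h: "continuous_on (closure \<Omega>) h" and E: "compact E" "convex E" "E \<subseteq> \<Omega>"
  shows "poly_approximable E (conj_transform h)"
proof -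
  have "continuous_on {0..1} (\<lambda>t. h (\<gamma> t))"
    using h by (rule continuous_on_compose2) (auto simp: cont in_closure)
  then have "poly_approximable E (\<lambda>z. integral {0..1} (\<lambda>t. (cnj (h (\<gamma> t)) * \<gamma>' t) / (\<gamma> t - z)))"
    using E not_in by (intro poly_approximable_Cauchy_transform continuous_intros cont cont'') auto
  then have "poly_approximable E (\<lambda>z. 1 / (2 * pi * \<i>) * integral {0..1} (\<lambda>t. (cnj (h (\<gamma> t)) * \<gamma>' t) / (\<gamma> t - z)))"
    by (rule poly_approximable_cmult)
  then show ?thesis
    by (simp add: conj_transform_def[abs_def] contour_integral_eq_integral)
qed

end

section \<open>Orientation of a smooth convex curve\<close>

text \<open>The linear functional that defines a supporting line at a boundary point has an extremum along the curve
  there, so the supporting line is the tangent. By continuity \<open>\<Omega>\<close> stays on the same side of the tangent all along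
  the curve, and reversing the curve makes this the left side.\<close>

theorem smooth_boundary_convex_contour:
  assumes \<Omega>: "open \<Omega>" "\<Omega> \<noteq> {}" "convex \<Omega>" "bounded \<Omega>" and sm: "smooth_boundary \<Omega>"
  shows "\<exists>\<gamma> \<gamma>'. convex_contour \<Omega> \<gamma> \<gamma>'"
proof -
  obtain D :: "nat \<Rightarrow> real \<Rightarrow> complex" where
    der: "\<And>k t. (D k has_vector_derivative D (Suc k) t) (at t)"
    and per: "\<And>t. D 0 (t + 1) = D 0 t" and inj: "inj_on (D 0) {0..<1}"
    and nz: "\<And>t. D 1 t \<noteq> 0" and im: "D 0 ` {0..<1} = frontier \<Omega>"
    using sm unfolding smooth_boundary_def by blast
  obtain c where c: "c \<in> \<Omega>" using \<Omega> by blast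
  have Dcont: "continuous_on UNIV (D k)" for k
    by (intro continuous_at_imp_continuous_on ballI has_vector_derivative_continuous[OF der])
  have fr: "D 0 t \<in> frontier \<Omega>" for t
  proof -
    have "D 0 (frac t) = D 0 t" by (rule periodic_frac) (rule per)
    then show ?thesis using im frac_ge_0[of t] frac_lt_1[of t] by (metis atLeastLessThan_iff image_eqI)
  qed
  define side where "side t a = Im (D 1 t * cnj (D 0 t - a))" for t a
  have key: "side t c \<noteq> 0 \<and> (\<forall>a\<in>\<Omega>. 0 \<le> side t a * side t c)" for t
  proof -
    have "D 0 t \<in> closure \<Omega>" "D 0 t \<notin> rel_interior \<Omega>"
      using fr[of t] \<Omega> by (auto simp: frontier_def interior_open rel_interior_open)
    then obtain n where n: "n \<noteq> 0" "\<And>y. y \<in> closure \<Omega> \<Longrightarrow> inner n (D 0 t) \<le> inner n y"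
      "\<And>y. y \<in> \<Omega> \<Longrightarrow> inner n (D 0 t) < inner n y"
      using supporting_hyperplane_relative_frontier[OF \<Omega>(3), of "D 0 t"] \<Omega>(1)
      by (metis rel_interior_open)
    have "((\<lambda>s. inner n (D 0 s)) has_real_derivative inner n (D 1 t)) (at t)"
      unfolding has_real_derivative_iff_has_vector_derivative
      using bounded_linear.has_vector_derivative[OF bounded_linear_inner_right der[of 0 t]] by simp
    moreover have "inner n (D 0 t) \<le> inner n (D 0 s)" for s
      using n(2) fr[of s] by (simp add: frontier_def)
    ultimately have orth: "inner n (D 1 t) = 0"
      using DERIV_local_min[of "\<lambda>s. inner n (D 0 s)" _ t 1] by auto
    define k where "k = inner (\<i> * D 1 t) n / (cmod (D 1 t))\<^sup>2"
    have nk: "n = of_real k * (\<i> * D 1 t)"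
    proof -
      have "(cmod (D 1 t))\<^sup>2 \<noteq> 0" using nz by simp
      moreover have "of_real ((cmod (D 1 t))\<^sup>2) * n = of_real (inner (\<i> * D 1 t) n) * (\<i> * D 1 t)"
        using orth unfolding inner_complex_def cmod_power2 
        by (simp add: complex_eq_iff power2_eq_square) algebra
      ultimately show ?thesis by (simp add: k_def field_simps del: of_real_power)
    qed
    have inn: "inner n a - inner n (D 0 t) = k * side t a" for a
      unfolding nk side_def inner_complex_def by (simp add: algebra_simps)
    have pos: "0 < k * side t a" if "a \<in> \<Omega>" for a
      using n(3)[OF that] inn[of a] by linarith
    have "0 \<le> side t a * side t c" if "a \<in> \<Omega>" for a
      using pos[OF that] pos[OF c] by (smt (verit) mult_pos_pos zero_less_mult_iff)
    then show ?thesis using pos[OF c] by auto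
  qed
  have sc: "continuous_on UNIV (\<lambda>t. side t c)"
    unfolding side_def by (intro continuous_intros Dcont)
  have sign: "(\<forall>t. side t c > 0) \<or> (\<forall>t. side t c < 0)"
  proof (rule ccontr)
    assume "\<not> ?thesis"
    then obtain t1 t2 where "side t1 c < 0" "side t2 c > 0"
      using key by (metis linorder_neqE_linordered_idom)
    moreover have "connected ((\<lambda>t. side t c) ` UNIV)"
      by (intro connected_continuous_image sc) auto
    ultimately have "0 \<in> (\<lambda>t. side t c) ` UNIV"
      using connectedD_interval[of _ "side t1 c" "side t2 c" 0] by (metis less_imp_le rangeI)
    then show False using key by auto
  qed
  then show ?thesis
  proof
    assume p: "\<forall>t. side t c > 0"
    have "convex_contour \<Omega> (D 0) (D 1)"
    proof
      show "0 \<le> Im (D 1 t * cnj (D 0 t - a))" if "a \<in> \<Omega>" for a t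
        using key[of t] p that unfolding side_def[symmetric] by (metis zero_le_mult_iff not_less_iff_gr_or_eq not_le)
    qed (use \<Omega> per inj im nz Dcont der[of 0] in auto)
    then show ?thesis by blast
  next
    assume p: "\<forall>t. side t c < 0"
    have "convex_contour \<Omega> (\<lambda>t. D 0 (- t)) (\<lambda>t. - D 1 (- t))"
    proof
      show "0 \<le> Im (- D 1 (- t) * cnj (D 0 (- t) - a))" if "a \<in> \<Omega>" for a t
      proof -
        have "side (- t) a \<le> 0"
          using key[of "- t"] p that by (metis zero_le_mult_iff not_less_iff_gr_or_eq not_le)
        then show ?thesis by (simp add: side_def)
      qed
      show "((\<lambda>t. D 0 (- t)) has_vector_derivative - D 1 (- t)) (at t)" for t
        using vector_diff_chain_at[of uminus "-1" t "D 0" "D 1 (- t)"] der[of 0 "- t"]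
        by (simp add: o_def has_vector_derivative_minus[OF has_vector_derivative_id, unfolded id_def])
      show perm: "D 0 (- (t + 1)) = D 0 (- t)" for t
        using per[of "- t - 1"] by simp
      have refl: "D 0 (- t) = D 0 (if t = 0 then 0 else 1 - t)" for t
        using per[of "- t"] by simp
      have bij: "bij_betw (\<lambda>t::real. if t = 0 then 0 else 1 - t) {0..<1} {0..<1}"
        by (rule bij_betwI[where g = "\<lambda>t. if t = 0 then 0 else 1 - t"]) auto
      show "inj_on (\<lambda>t. D 0 (- t)) {0..<1}"
        unfolding refl using comp_inj_on[OF bij_betw_imp_inj_on[OF bij]] inj bij_betw_imp_surj_on[OF bij]
        by (metis (no_types, lifting) comp_apply inj_on_cong)
      show "(\<lambda>t. D 0 (- t)) ` {0..<1} = frontier \<Omega>"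
        unfolding refl using bij_betw_imp_surj_on[OF bij] im by (metis image_image)
      show "continuous_on UNIV (\<lambda>t. - D 1 (- t))"
        by (intro continuous_intros continuous_on_compose2[OF Dcont]) auto
    qed (use \<Omega> nz in auto)
    then show ?thesis by blast
  qed
qed

section \<open>The resolvent outside a convex set containing the numerical range\<close>

lemma norm_diff_squared:
  "(norm (x - y))\<^sup>2 = (norm x)\<^sup>2 + (norm y)\<^sup>2 - 2 * Re (cinner (y::'a::complex_inner) x)"
proof -
  have "(norm (x - y))\<^sup>2 = Re (cinner (x - y) (x - y))" by (simp add: cinner_self)
  also have "\<dots> = (norm x)\<^sup>2 + (norm y)\<^sup>2 - 2 * Re (cinner y x)"
    using Re_cinner_commute[of x y]
    unfolding cinner_diff_left cinner_diff_right by (simp add: cinner_self)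
  finally show ?thesis .
qed

text \<open>The contraction \<open>w \<mapsto> w - \<tau> (B w - v)\<close> has the solution of \<open>B w = v\<close> as its fixed point.\<close>

lemma surj_of_coercive:
  fixes B :: "'a::chilbert_space \<Rightarrow> 'a"
  assumes B: "bounded_clinear B" and d: "0 < d" and n: "cmod n = 1"
    and co: "\<And>w. d * (norm w)\<^sup>2 \<le> Re (cnj n * cinner (B w) w)"
  shows "surj B"
proof (rule surjI)
  fix v
  obtain M0 where M0: "\<And>w. norm (B w) \<le> norm w * M0"
    using B unfolding bounded_clinear_def by (meson bounded_linear.bounded)
  define M where "M = max (max M0 d) 1"
  have M: "norm (B w) \<le> M * norm w" for w
  proof -
    have "M0 \<le> M" by (simp add: M_def)
    then have "norm w * M0 \<le> norm w * M" by (intro mult_left_mono) auto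
    then show ?thesis using M0[of w] by (simp add: mult.commute)
  qed
  have M': "0 < M" "d \<le> M" by (auto simp: M_def)
  \<comment> \<open>This \<open>\<tau>\<close> minimizes \<open>1 - 2 \<tau> d + \<tau>\<^sup>2 M\<^sup>2\<close>, the bound for the squared Lipschitz constant.\<close>
  define \<tau> where "\<tau> = d / M\<^sup>2"
  define T where "T w = w - (of_real \<tau> * cnj n) *\<^sub>C (B w - v)" for w
  define c where "c = sqrt (1 - d\<^sup>2 / M\<^sup>2)"
  have "d\<^sup>2 \<le> M\<^sup>2" using M' d by (intro power_mono) auto
  then have c: "0 \<le> c" "c < 1" "c\<^sup>2 = 1 - d\<^sup>2 / M\<^sup>2"
    using M' d by (auto simp: c_def)
  have \<tau>: "0 < \<tau>" using d M' by (simp add: \<tau>_def)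
  have lip: "dist (T w) (T w') \<le> c * dist w w'" for w w'
  proof -
    define D where "D = w - w'"
    have "T w - T w' = D - (of_real \<tau> * cnj n) *\<^sub>C B D"
      by (simp add: T_def D_def bounded_clinear_diff[OF B] scaleC.scale_right_diff_distrib)
    then have "(norm (T w - T w'))\<^sup>2
        = (norm D)\<^sup>2 + (\<tau> * norm (B D))\<^sup>2 - 2 * Re ((of_real \<tau> * cnj n) * cinner (B D) D)"
      using \<tau> n by (simp add: norm_diff_squared cinner_scaleC_left norm_mult del: times_complex.sel)
    also have "Re ((of_real \<tau> * cnj n) * cinner (B D) D) = \<tau> * Re (cnj n * cinner (B D) D)"
      by (simp only: mult.assoc Re_complex_of_real times_complex.sel(1) Im_complex_of_real)
    also have "(norm D)\<^sup>2 + (\<tau> * norm (B D))\<^sup>2 - 2 * (\<tau> * Re (cnj n * cinner (B D) D))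
        \<le> (norm D)\<^sup>2 + (\<tau> * (M * norm D))\<^sup>2 - 2 * (\<tau> * (d * (norm D)\<^sup>2))"
      using \<tau> M[of D] co[of D]
      by (intro diff_mono add_mono power_mono mult_left_mono) auto
    also have "\<dots> = (c * norm D)\<^sup>2"
      unfolding power_mult_distrib c(3) using M' by (simp add: \<tau>_def field_simps power2_eq_square)
    finally have "norm (T w - T w') \<le> c * norm D"
      by (rule power2_le_imp_le) (use c in simp)
    then show ?thesis by (simp add: dist_norm D_def)
  qed
  then obtain w where "T w = w" using banach_fix_type[OF c(1,2), of T] by blast
  then have "(of_real \<tau> * cnj n) *\<^sub>C (B w - v) = 0" by (simp add: T_def)
  then have "B w = v" using \<tau> n by (auto simp: scaleC.scale_eq_0_iff)
  then show "B (SOME w. B w = v) = v" by (rule someI)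
qed

locale numrange_in =
  fixes A :: "'a::chilbert_space \<Rightarrow> 'a" and E :: "complex set"
  assumes A: "bounded_clinear A" and E: "convex E" "compact E" "E \<noteq> {}"
    and W: "numerical_range A \<subseteq> E"
begin

lemma closed_E: "closed E"
  using E by (simp add: compact_imp_closed)

lemma infdist_pos: "\<zeta> \<notin> E \<Longrightarrow> 0 < infdist \<zeta> E"
  using infdist_pos_not_in_closed[OF closed_E E(3)] .

lemma numrange_point:
  obtains a where "a \<in> E" "cinner (A w) w = of_real ((norm w)\<^sup>2) * a"
proof (cases "w = 0")
  case True
  then show thesis using that E(3) by (auto simp: bounded_clinear_zero[OF A])
next
  case False
  define v where "v = complex_of_real (1 / norm w) *\<^sub>C w"
  have "norm v = 1" using False by (simp add: v_def norm_divide)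
  then have "cinner (A v) v \<in> E" using W by (auto simp: numerical_range_def)
  moreover have "cinner (A w) w = of_real ((norm w)\<^sup>2) * cinner (A v) v"
    using False by (simp add: v_def bounded_clinear_scaleC[OF A] cinner_scaleC_left
        cinner_scaleC_right power2_eq_square)
  ultimately show thesis by (rule that)
qed

definition shift :: "complex \<Rightarrow> 'a \<Rightarrow> 'a"
  where "shift \<zeta> w = \<zeta> *\<^sub>C w - A w"

definition R :: "complex \<Rightarrow> 'a \<Rightarrow> 'a"
  where "R \<zeta> = inv (shift \<zeta>)"

lemma bounded_clinear_shift: "bounded_clinear (shift \<zeta>)"
proof -
  obtain M where M: "\<And>w. norm (A w) \<le> norm w * M"
    using A unfolding bounded_clinear_def by (meson bounded_linear.bounded)
  show ?thesis
  proof (rule bounded_clinearI)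
    show "norm (shift \<zeta> x) \<le> norm x * (cmod \<zeta> + M)" for x
      using norm_triangle_ineq4[of "\<zeta> *\<^sub>C x" "A x"] M[of x] by (simp add: shift_def algebra_simps)
  qed (simp_all add: shift_def bounded_clinear_add[OF A] bounded_clinear_scaleC[OF A]
      scaleC_add_right scaleC.scale_right_diff_distrib mult.commute)
qed

lemma shift_point:
  obtains a where "a \<in> E" "cinner (shift \<zeta> w) w = of_real ((norm w)\<^sup>2) * (\<zeta> - a)"
proof -
  obtain a where "a \<in> E" "cinner (A w) w = of_real ((norm w)\<^sup>2) * a" by (rule numrange_point)
  then show thesis
    using that by (simp add: shift_def cinner_diff_left cinner_scaleC_left cinner_self algebra_simps)
qed

text \<open>A line separating \<open>\<zeta>\<close> from \<open>E\<close> bounds a half plane that contains the numerical range of \<open>\<zeta> - A\<close> and whose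
  distance from 0 is that of \<open>\<zeta>\<close> from \<open>E\<close>.\<close>

lemma coercive:
  assumes "\<zeta> \<notin> E"
  obtains n where "cmod n = 1" "\<And>w. infdist \<zeta> E * (norm w)\<^sup>2 \<le> Re (cnj n * cinner (shift \<zeta> w) w)"
proof -
  obtain n where n: "cmod n = 1" "\<And>a. a \<in> E \<Longrightarrow> infdist \<zeta> E \<le> Re (cnj n * (\<zeta> - a))"
    using separating_direction[OF E(1) closed_E E(3) assms] by blast
  show thesis
  proof (rule that[OF n(1)])
    fix w
    obtain a where a: "a \<in> E" "cinner (shift \<zeta> w) w = of_real ((norm w)\<^sup>2) * (\<zeta> - a)"
      by (rule shift_point)
    have "cnj n * cinner (shift \<zeta> w) w = of_real ((norm w)\<^sup>2) * (cnj n * (\<zeta> - a))"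
      unfolding a(2) by (simp only: mult_ac)
    moreover have "Re (of_real r * z) = r * Re z" for r z by simp
    ultimately have "Re (cnj n * cinner (shift \<zeta> w) w) = (norm w)\<^sup>2 * Re (cnj n * (\<zeta> - a))"
      by (simp only:)
    then show "infdist \<zeta> E * (norm w)\<^sup>2 \<le> Re (cnj n * cinner (shift \<zeta> w) w)"
      using mult_left_mono[OF n(2)[OF a(1)], of "(norm w)\<^sup>2"] by (simp only: mult.commute zero_le_power2)
  qed
qed

lemma shift_lower_bound:
  assumes "\<zeta> \<notin> E" shows "infdist \<zeta> E * norm w \<le> norm (shift \<zeta> w)"
proof (cases "w = 0")
  case False
  obtain n where n: "cmod n = 1" "infdist \<zeta> E * (norm w)\<^sup>2 \<le> Re (cnj n * cinner (shift \<zeta> w) w)"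
    using coercive[OF assms] by metis
  have "infdist \<zeta> E * (norm w)\<^sup>2 \<le> cmod (cnj n * cinner (shift \<zeta> w) w)"
    using n(2) complex_Re_le_cmod order_trans by blast
  also have "\<dots> \<le> norm (shift \<zeta> w) * norm w"
    using cmod_cinner_le[of "shift \<zeta> w" w] n(1) by (simp add: norm_mult)
  finally show ?thesis using False by (simp add: power2_eq_square flip: mult.assoc)
qed simp

lemma bij_shift:
  assumes "\<zeta> \<notin> E" shows "bij (shift \<zeta>)"
proof (rule bijI)
  obtain n where "cmod n = 1" "\<And>w. infdist \<zeta> E * (norm w)\<^sup>2 \<le> Re (cnj n * cinner (shift \<zeta> w) w)"
    using coercive[OF assms] by blast
  then show "surj (shift \<zeta>)"
    by (intro surj_of_coercive[OF bounded_clinear_shift infdist_pos[OF assms]])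
  show "inj (shift \<zeta>)"
  proof (rule injI)
    fix x y assume "shift \<zeta> x = shift \<zeta> y"
    then have "shift \<zeta> (x - y) = 0" by (simp add: bounded_clinear_diff[OF bounded_clinear_shift])
    then have "norm (x - y) \<le> 0"
      using shift_lower_bound[OF assms, of "x - y"] infdist_pos[OF assms] by (simp add: mult_le_0_iff)
    then show "x = y" by simp
  qed
qed

lemma shift_R: "\<zeta> \<notin> E \<Longrightarrow> shift \<zeta> (R \<zeta> v) = v"
  unfolding R_def by (simp add: bij_shift bij_is_surj surj_f_inv_f)

lemma R_shift: "\<zeta> \<notin> E \<Longrightarrow> R \<zeta> (shift \<zeta> v) = v"
  unfolding R_def by (simp add: bij_shift bij_is_inj)

lemma R_unique: "\<zeta> \<notin> E \<Longrightarrow> shift \<zeta> w = v \<Longrightarrow> R \<zeta> v = w"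
  using R_shift by blast

lemma norm_R_le: "\<zeta> \<notin> E \<Longrightarrow> norm (R \<zeta> v) \<le> norm v / infdist \<zeta> E"
  using shift_lower_bound[of \<zeta> "R \<zeta> v"] infdist_pos[of \<zeta>] by (simp add: shift_R field_simps)

lemma R_add: "\<zeta> \<notin> E \<Longrightarrow> R \<zeta> (u + v) = R \<zeta> u + R \<zeta> v"
  by (rule R_unique) (simp_all add: bounded_clinear_add[OF bounded_clinear_shift] shift_R)

lemma R_scaleC: "\<zeta> \<notin> E \<Longrightarrow> R \<zeta> (c *\<^sub>C v) = c *\<^sub>C R \<zeta> v"
  by (rule R_unique) (simp_all add: bounded_clinear_scaleC[OF bounded_clinear_shift] shift_R)

lemma R_commute:
  assumes "\<zeta> \<notin> E" shows "R \<zeta> (A v) = A (R \<zeta> v)"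
proof (rule R_unique[OF assms])
  have "shift \<zeta> (A (R \<zeta> v)) = A (shift \<zeta> (R \<zeta> v))"
    by (simp add: shift_def bounded_clinear_diff[OF A] bounded_clinear_scaleC[OF A])
  then show "shift \<zeta> (A (R \<zeta> v)) = A v" by (simp add: shift_R assms)
qed

lemma resolvent_identity:
  assumes "\<zeta> \<notin> E" "z \<notin> E"
  shows "R z v = R \<zeta> v + (\<zeta> - z) *\<^sub>C R z (R \<zeta> v)"
proof (rule R_unique[OF assms(2)])
  have "shift z w = shift \<zeta> w - (\<zeta> - z) *\<^sub>C w" for w
    by (simp add: shift_def scaleC.scale_left_diff_distrib)
  then have "shift z (R \<zeta> v) = v - (\<zeta> - z) *\<^sub>C R \<zeta> v"
    by (simp add: shift_R assms)
  then show "shift z (R \<zeta> v + (\<zeta> - z) *\<^sub>C R z (R \<zeta> v)) = v"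
    by (simp add: bounded_clinear_add[OF bounded_clinear_shift]
        bounded_clinear_scaleC[OF bounded_clinear_shift] shift_R assms)
qed

lemma cinner_resolvent_diff:
  assumes "\<zeta> \<notin> E" "z \<notin> E"
  shows "cinner (R \<zeta> u) v - cinner (R z u) v = (z - \<zeta>) * cinner (R \<zeta> (R z u)) v"
  by (subst resolvent_identity[OF assms(2,1), of u]) (simp add: cinner_add_left cinner_scaleC_left)

lemma resolvent_continuous: "continuous_on (- E) (\<lambda>\<zeta>. cinner (R \<zeta> u) v)"
  unfolding continuous_on_def
proof
  fix z assume "z \<in> - E"
  then have z: "z \<notin> E" by simp
  define C where "C = norm (R z u) * norm v"
  have "((\<lambda>\<zeta>. cinner (R \<zeta> u) v - cinner (R z u) v) \<longlongrightarrow> 0) (at z within - E)"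
  proof (rule Lim_null_comparison)
    show "\<forall>\<^sub>F \<zeta> in at z within - E. norm (cinner (R \<zeta> u) v - cinner (R z u) v)
        \<le> cmod (z - \<zeta>) * (C / infdist \<zeta> E)"
      unfolding eventually_at_filter
    proof (rule always_eventually, intro allI impI)
      fix \<zeta> assume "\<zeta> \<in> - E"
      then have \<zeta>: "\<zeta> \<notin> E" by simp
      have "cmod (cinner (R \<zeta> (R z u)) v) \<le> norm (R z u) / infdist \<zeta> E * norm v"
        using cmod_cinner_le[of "R \<zeta> (R z u)" v] mult_right_mono[OF norm_R_le[OF \<zeta>, of "R z u"] norm_ge_zero[of v]]
        by linarith
      also have "\<dots> = C / infdist \<zeta> E" by (simp add: C_def)
      finally have "cmod (z - \<zeta>) * cmod (cinner (R \<zeta> (R z u)) v) \<le> cmod (z - \<zeta>) * (C / infdist \<zeta> E)"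
        by (rule mult_left_mono) simp
      then show "norm (cinner (R \<zeta> u) v - cinner (R z u) v) \<le> cmod (z - \<zeta>) * (C / infdist \<zeta> E)"
        unfolding cinner_resolvent_diff[OF \<zeta> z] norm_mult .
    qed
    have "((\<lambda>\<zeta>. cmod (z - \<zeta>) * (C / infdist \<zeta> E)) \<longlongrightarrow> cmod (z - z) * (C / infdist z E)) (at z within - E)"
      using infdist_pos[OF z] by (intro tendsto_intros) auto
    then show "((\<lambda>\<zeta>. cmod (z - \<zeta>) * (C / infdist \<zeta> E)) \<longlongrightarrow> 0) (at z within - E)" by simp
  qed
  then show "((\<lambda>\<zeta>. cinner (R \<zeta> u) v) \<longlongrightarrow> cinner (R z u) v) (at z within - E)"
    by (rule LIM_zero_cancel)
qed

lemma resolvent_holomorphic: "(\<lambda>\<zeta>. cinner (R \<zeta> u) v) holomorphic_on (- E)"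
  unfolding holomorphic_on_def field_differentiable_def has_field_derivative_iff
proof
  fix z assume "z \<in> - E"
  then have z: "z \<notin> E" by simp
  have "((\<lambda>\<zeta>. - cinner (R \<zeta> (R z u)) v) \<longlongrightarrow> - cinner (R z (R z u)) v) (at z within - E)"
    using resolvent_continuous[of "R z u" v] z by (intro tendsto_minus) (simp add: continuous_on_def)
  moreover have "\<forall>\<^sub>F \<zeta> in at z within - E. - cinner (R \<zeta> (R z u)) v = (cinner (R \<zeta> u) v - cinner (R z u) v) / (\<zeta> - z)"
    unfolding eventually_at_filter
  proof (rule always_eventually, intro allI impI)
    fix \<zeta> assume "\<zeta> \<noteq> z" "\<zeta> \<in> - E"
    then have "cinner (R \<zeta> u) v - cinner (R z u) v = (\<zeta> - z) * (- cinner (R \<zeta> (R z u)) v)"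
      using cinner_resolvent_diff[of \<zeta> z u v] z by (simp add: left_diff_distrib)
    then show "- cinner (R \<zeta> (R z u)) v = (cinner (R \<zeta> u) v - cinner (R z u) v) / (\<zeta> - z)"
      using \<open>\<zeta> \<noteq> z\<close> by simp
  qed
  ultimately have "((\<lambda>\<zeta>. (cinner (R \<zeta> u) v - cinner (R z u) v) / (\<zeta> - z)) \<longlongrightarrow> - cinner (R z (R z u)) v) (at z within - E)"
    by (rule Lim_transform_eventually)
  then show "\<exists>f'. ((\<lambda>\<zeta>. (cinner (R \<zeta> u) v - cinner (R z u) v) / (\<zeta> - z)) \<longlongrightarrow> f') (at z within - E)" by blast
qed

end

section \<open>Contour integrals of the resolvent\<close>

locale contour_operator = convex_contour \<Omega> \<gamma> \<gamma>' + numrange_in A E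
  for \<Omega> :: "complex set" and \<gamma> \<gamma>' :: "real \<Rightarrow> complex" and A :: "'a::chilbert_space \<Rightarrow> 'a" and E +
  assumes E_subset: "E \<subseteq> \<Omega>"
begin

lemma \<gamma>_notin: "\<gamma> t \<notin> E"
  using not_in E_subset by blast

lemma frontier_notin: "z \<in> frontier \<Omega> \<Longrightarrow> z \<notin> E"
  using E_subset open_\<Omega> by (auto simp: frontier_def interior_open)

lemma resolvent_continuous_\<gamma>: "continuous_on S (\<lambda>t. cinner (R (\<gamma> t) u) v)"
  by (rule continuous_on_compose2[OF resolvent_continuous cont]) (use \<gamma>_notin in auto)

lemma speed_bound: obtains B where "0 < B" "\<And>t. t \<in> {0..1} \<Longrightarrow> cmod (\<gamma>' t) \<le> B"
proof -
  have "bounded (\<gamma>' ` {0..1})" by (intro compact_imp_bounded compact_continuous_image cont'') auto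
  then obtain B where "0 < B" "\<forall>x\<in>\<gamma>' ` {0..1}. norm x \<le> B" unfolding bounded_pos by blast
  then show thesis using that by blast
qed

text \<open>Expand the contour from a point of \<open>E\<close>: the integral does not change, and at infinity the resolvent
  at \<open>\<zeta>\<close> is \<open>1 / (\<zeta> - c)\<close> up to terms of second order.\<close>

lemma integral_resolvent:
  "contour_integral \<gamma> (\<lambda>\<zeta>. cinner (R \<zeta> u) v) = 2 * pi * \<i> * cinner u v"
proof -
  define F where "F \<zeta> = cinner (R \<zeta> u) v" for \<zeta>
  obtain c where c: "c \<in> E" using E(3) by blast
  have c\<Omega>: "c \<in> \<Omega>" using c E_subset by blast
  have FF: "F holomorphic_on (- E)" unfolding F_def by (rule resolvent_holomorphic)
  obtain B where B: "0 < B" "\<And>t. t \<in> {0..1} \<Longrightarrow> cmod (\<gamma>' t) \<le> B" using speed_bound by blast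
  obtain \<delta> where \<delta>: "0 < \<delta>" "\<And>t. \<delta> \<le> cmod (\<gamma> t - c)"
  proof -
    have "c \<notin> frontier \<Omega>" using c frontier_notin by blast
    then obtain d where d: "d > 0" "\<forall>x\<in>frontier \<Omega>. d \<le> dist c x"
      using separate_point_closed[OF frontier_closed] by blast
    show thesis
      by (rule that[OF d(1)]) (metis d(2) in_frontier dist_norm dist_commute)
  qed
  obtain D where D: "0 < D" "\<And>a. a \<in> E \<Longrightarrow> cmod (a - c) \<le> D"
  proof -
    have "bounded ((\<lambda>a. a - c) ` E)"
      using E(2) by (intro compact_imp_bounded compact_continuous_image continuous_intros)
    then show thesis using that unfolding bounded_pos by auto
  qed
  define K where "K = 2 * norm (A u - c *\<^sub>C u) * norm v"
  have K0: "0 \<le> K" by (simp add: K_def)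
  have large: "cmod (F \<zeta> - cinner u v * (1 / (\<zeta> - c))) \<le> K / (cmod (\<zeta> - c))\<^sup>2" if \<zeta>: "2 * D \<le> cmod (\<zeta> - c)" for \<zeta>
  proof -
    have half: "cmod (\<zeta> - c) / 2 \<le> infdist \<zeta> E"
      unfolding infdist_notempty[OF E(3)]
    proof (rule cINF_greatest[OF E(3)])
      fix a assume "a \<in> E"
      then show "cmod (\<zeta> - c) / 2 \<le> dist \<zeta> a"
        using D(2)[of a] norm_triangle_ineq[of "\<zeta> - a" "a - c"] \<zeta> by (simp add: dist_norm)
    qed
    have pos: "0 < cmod (\<zeta> - c)" using \<zeta> D by linarith
    then have \<zeta>E: "\<zeta> \<notin> E" using half infdist_zero[of \<zeta> E] by auto
    have ne: "\<zeta> - c \<noteq> 0" using pos by auto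
    have "R \<zeta> u = R \<zeta> ((1 / (\<zeta> - c)) *\<^sub>C (shift \<zeta> u + (A u - c *\<^sub>C u)))"
    proof -
      have "shift \<zeta> u + (A u - c *\<^sub>C u) = (\<zeta> - c) *\<^sub>C u"
        by (simp add: shift_def scaleC.scale_left_diff_distrib)
      then show ?thesis using ne by simp
    qed
    also have "\<dots> = (1 / (\<zeta> - c)) *\<^sub>C (u + R \<zeta> (A u - c *\<^sub>C u))"
      by (simp add: R_scaleC R_add R_shift \<zeta>E)
    finally have "F \<zeta> - cinner u v * (1 / (\<zeta> - c)) = (1 / (\<zeta> - c)) * cinner (R \<zeta> (A u - c *\<^sub>C u)) v"
      by (simp add: F_def cinner_scaleC_left cinner_add_left algebra_simps)
    then have "cmod (F \<zeta> - cinner u v * (1 / (\<zeta> - c))) = cmod (cinner (R \<zeta> (A u - c *\<^sub>C u)) v) / cmod (\<zeta> - c)"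
      by (simp add: norm_mult norm_divide)
    also have "\<dots> \<le> (norm (A u - c *\<^sub>C u) / (cmod (\<zeta> - c) / 2) * norm v) / cmod (\<zeta> - c)"
    proof (rule divide_right_mono)
      have "cmod (cinner (R \<zeta> (A u - c *\<^sub>C u)) v) \<le> norm (A u - c *\<^sub>C u) / infdist \<zeta> E * norm v"
        using cmod_cinner_le order_trans mult_right_mono[OF norm_R_le[OF \<zeta>E] norm_ge_zero] by blast
      also have "\<dots> \<le> norm (A u - c *\<^sub>C u) / (cmod (\<zeta> - c) / 2) * norm v"
        using half pos infdist_pos[OF \<zeta>E] by (intro mult_right_mono divide_left_mono mult_pos_pos) auto
      finally show "cmod (cinner (R \<zeta> (A u - c *\<^sub>C u)) v) \<le> norm (A u - c *\<^sub>C u) / (cmod (\<zeta> - c) / 2) * norm v" .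
    qed simp
    also have "\<dots> = K / (cmod (\<zeta> - c))\<^sup>2" by (simp add: K_def power2_eq_square)
    finally show ?thesis .
  qed
  have est: "cmod (contour_integral \<gamma> F - 2 * pi * \<i> * cinner u v) \<le> (K * B / \<delta>\<^sup>2) / s"
    if s: "1 \<le> s" "2 * D \<le> s * \<delta>" for s
  proof -
    define \<gamma>s where "\<gamma>s t = dil c s (\<gamma> t)" for t
    interpret s: convex_contour "dil c s ` \<Omega>" \<gamma>s "\<lambda>t. of_real s * \<gamma>' t"
      unfolding \<gamma>s_def by (rule dilated) (use s in simp)
    have seg: "closed_segment (\<gamma> t) (\<gamma>s t) \<subseteq> - E" for t
    proof
      fix x assume "x \<in> closed_segment (\<gamma> t) (\<gamma>s t)"
      then obtain q where q: "0 \<le> q" "q \<le> 1" "x = (1 - q) *\<^sub>R \<gamma> t + q *\<^sub>R \<gamma>s t"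
        by (auto simp: in_segment)
      define r where "r = 1 - q + q * s"
      have r: "1 \<le> r" using q s mult_left_mono[of 1 s q] by (simp add: r_def)
      have x: "x = dil c r (\<gamma> t)"
        by (simp add: q \<gamma>s_def dil_def r_def scaleR_conv_of_real algebra_simps)
      show "x \<in> - E"
      proof
        assume "x \<in> E"
        then have "(1 - 1 / r) *\<^sub>R c + (1 / r) *\<^sub>R x \<in> E"
          using E(1) c r by (intro convexD) auto
        moreover have "(1 - 1 / r) *\<^sub>R c + (1 / r) *\<^sub>R x = dil c (1 / r) x"
          by (simp add: dil_def scaleR_conv_of_real algebra_simps diff_divide_distrib)
        ultimately show False using \<gamma>_notin[of t] r by (simp add: x dil_dil)
      qed
    qed
    have "contour_integral \<gamma> F = contour_integral \<gamma>s F"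
    proof (rule Cauchy_theorem_homotopic_loops[OF _ _ FF valid_path s.valid_path])
      show "homotopic_loops (- E) \<gamma> \<gamma>s"
        by (rule homotopic_loops_linear) (simp_all add: path s.path closed s.closed seg)
      show "open (- E)" using closed_E by (simp add: open_Compl)
    qed
    have \<gamma>sE: "\<gamma>s t \<in> - E" for t using seg[of t] by auto
    have "continuous_on {0..1} (\<lambda>t. F (\<gamma>s t) * (of_real s * \<gamma>' t))"
      by (intro continuous_intros cont''
          continuous_on_compose2[OF holomorphic_on_imp_continuous_on[OF FF] s.cont]) (use \<gamma>sE in auto)
    then have 1: "((\<lambda>t. F (\<gamma>s t) * (of_real s * \<gamma>' t)) has_integral contour_integral \<gamma>s F) {0..1}"
      unfolding s.contour_integral_eq_integral
      by (intro integrable_integral integrable_continuous_interval)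
    have "c \<in> dil c s ` \<Omega>" using c\<Omega> by (metis dil_center image_eqI)
    then have "((\<lambda>t. 1 * (of_real s * \<gamma>' t / (\<gamma>s t - c))) has_integral (2 * pi * \<i> * 1)) {0..1}"
      by (intro s.Cauchy_formula[OF open_UNIV convex_UNIV]) auto
    from has_integral_mult_right[OF this, of "cinner u v"]
    have 2: "((\<lambda>t. cinner u v * (of_real s * \<gamma>' t / (\<gamma>s t - c))) has_integral (cinner u v * (2 * pi * \<i>))) {0..1}"
      by (simp only: mult_1 mult_1_right)
    have "cmod (contour_integral \<gamma>s F - cinner u v * (2 * pi * \<i>)) \<le> (K / (s * \<delta>)\<^sup>2 * (s * B)) * measure lborel (cbox 0 (1::real))"
    proof (rule has_integral_bound)
      show "0 \<le> K / (s * \<delta>)\<^sup>2 * (s * B)" using K0 s B by simp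
      show "((\<lambda>t. F (\<gamma>s t) * (of_real s * \<gamma>' t) - cinner u v * (of_real s * \<gamma>' t / (\<gamma>s t - c)))
          has_integral (contour_integral \<gamma>s F - cinner u v * (2 * pi * \<i>))) (cbox 0 1)"
        using has_integral_diff[OF 1 2] by simp
      fix t :: real assume t: "t \<in> cbox 0 1"
      have nrm: "cmod (\<gamma>s t - c) = s * cmod (\<gamma> t - c)"
        using s by (simp add: \<gamma>s_def dil_def norm_mult)
      have ge: "s * \<delta> \<le> cmod (\<gamma>s t - c)" unfolding nrm using \<delta> s by (intro mult_left_mono) auto
      have "F (\<gamma>s t) * (of_real s * \<gamma>' t) - cinner u v * (of_real s * \<gamma>' t / (\<gamma>s t - c))
          = (F (\<gamma>s t) - cinner u v * (1 / (\<gamma>s t - c))) * (of_real s * \<gamma>' t)"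
        by (simp add: algebra_simps)
      then have "norm (F (\<gamma>s t) * (of_real s * \<gamma>' t) - cinner u v * (of_real s * \<gamma>' t / (\<gamma>s t - c)))
          = cmod (F (\<gamma>s t) - cinner u v * (1 / (\<gamma>s t - c))) * (s * cmod (\<gamma>' t))"
        using s by (simp add: norm_mult)
      also have "\<dots> \<le> K / (s * \<delta>)\<^sup>2 * (s * B)"
      proof (rule mult_mono)
        have "cmod (F (\<gamma>s t) - cinner u v * (1 / (\<gamma>s t - c))) \<le> K / (cmod (\<gamma>s t - c))\<^sup>2"
          using ge s by (intro large) linarith
        also have "\<dots> \<le> K / (s * \<delta>)\<^sup>2"
        proof (rule frac_le)
          show "0 < (s * \<delta>)\<^sup>2" "(s * \<delta>)\<^sup>2 \<le> (cmod (\<gamma>s t - c))\<^sup>2"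
            using ge s \<delta>(1) by (auto intro!: power_mono)
        qed (use K0 in auto)
        finally show "cmod (F (\<gamma>s t) - cinner u v * (1 / (\<gamma>s t - c))) \<le> K / (s * \<delta>)\<^sup>2" .
        show "s * cmod (\<gamma>' t) \<le> s * B" using B t s by (intro mult_left_mono) auto
      qed (use K0 s in auto)
      finally show "norm (F (\<gamma>s t) * (of_real s * \<gamma>' t) - cinner u v * (of_real s * \<gamma>' t / (\<gamma>s t - c)))
          \<le> K / (s * \<delta>)\<^sup>2 * (s * B)" .
    qed
    also have "\<dots> = (K * B / \<delta>\<^sup>2) / s"
      using s \<delta> by (simp add: field_simps power2_eq_square)
    finally show ?thesis
      using \<open>contour_integral \<gamma> F = contour_integral \<gamma>s F\<close> by (simp add: mult.commute)
  qed
  have "((\<lambda>s. (K * B / \<delta>\<^sup>2) / s) \<longlongrightarrow> 0) at_top"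
    by (intro tendsto_divide_0[OF tendsto_const] filterlim_at_top_imp_at_infinity filterlim_ident)
  moreover have "\<forall>\<^sub>F s in at_top. cmod (contour_integral \<gamma> F - 2 * pi * \<i> * cinner u v) \<le> (K * B / \<delta>\<^sup>2) / s"
    using eventually_ge_at_top[of "max 1 (2 * D / \<delta>)"]
  proof eventually_elim
    case (elim s)
    then show ?case using \<delta> by (intro est) (auto simp: field_simps)
  qed
  ultimately have "cmod (contour_integral \<gamma> F - 2 * pi * \<i> * cinner u v) \<le> 0"
    by (intro tendsto_lowerbound[of _ 0 at_top]) auto
  then show ?thesis unfolding F_def by simp
qed

lemma has_integral_resolvent:
  assumes "continuous_on (frontier \<Omega>) f"
  shows "((\<lambda>t. f (\<gamma> t) * cinner (R (\<gamma> t) u) v * \<gamma>' t) has_integral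
    contour_integral \<gamma> (\<lambda>\<zeta>. f \<zeta> * cinner (R \<zeta> u) v)) {0..1}"
  unfolding contour_integral_eq_integral
  by (intro integrable_integral integrable_continuous_interval continuous_intros
      resolvent_continuous_\<gamma> cont'' continuous_on_compose2[OF assms cont]) (use in_frontier in auto)

text \<open>Since \<open>\<zeta> R(\<zeta>) u = u + R(\<zeta>) (A u)\<close>, a factor \<open>\<zeta>\<close> in the integrand amounts to applying \<open>A\<close>, up to a
  polynomial in \<open>\<zeta>\<close> whose integral vanishes. This is an induction on the polynomial.\<close>

lemma integral_poly_resolvent:
  "contour_integral \<gamma> (\<lambda>\<zeta>. poly p \<zeta> * cinner (R \<zeta> u) v) = 2 * pi * \<i> * cinner (poly_op p A u) v"
proof (induction p arbitrary: u)
  case (pCons a p)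
  have "((\<lambda>t. poly p (\<gamma> t) * cinner u v * \<gamma>' t) has_integral 0) {0..1}"
    unfolding has_contour_integral_iff[symmetric, of "\<lambda>z. poly p z * cinner u v"]
    by (rule Cauchy_theorem_convex_simple[of _ UNIV])
      (auto simp: valid_path closed intro!: holomorphic_intros)
  moreover have "((\<lambda>t. a * (cinner (R (\<gamma> t) u) v * \<gamma>' t)) has_integral a * (2 * pi * \<i> * cinner u v)) {0..1}"
    using has_integral_resolvent[of "\<lambda>_. 1" u v] integral_resolvent
    by (intro has_integral_mult_right) simp
  moreover have "((\<lambda>t. poly p (\<gamma> t) * cinner (R (\<gamma> t) (A u)) v * \<gamma>' t) has_integral
      2 * pi * \<i> * cinner (poly_op p A (A u)) v) {0..1}"
    using has_integral_resolvent[of "poly p" "A u" v] pCons.IH[of "A u"]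
    by (simp add: continuous_on_poly)
  ultimately have sum: "((\<lambda>t. a * (cinner (R (\<gamma> t) u) v * \<gamma>' t) + (poly p (\<gamma> t) * cinner u v * \<gamma>' t
      + poly p (\<gamma> t) * cinner (R (\<gamma> t) (A u)) v * \<gamma>' t)) has_integral
      (a * (2 * pi * \<i> * cinner u v) + (0 + 2 * pi * \<i> * cinner (poly_op p A (A u)) v))) {0..1}"
    by (intro has_integral_add)
  have eq: "a * (cinner (R (\<gamma> t) u) v * \<gamma>' t) + (poly p (\<gamma> t) * cinner u v * \<gamma>' t
      + poly p (\<gamma> t) * cinner (R (\<gamma> t) (A u)) v * \<gamma>' t)
      = poly (pCons a p) (\<gamma> t) * cinner (R (\<gamma> t) u) v * \<gamma>' t" for t
  proof -
    have "R (\<gamma> t) (A u) = \<gamma> t *\<^sub>C R (\<gamma> t) u - u"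
      using shift_R[OF \<gamma>_notin, of t u] R_commute[OF \<gamma>_notin, of t u] by (simp add: shift_def algebra_simps)
    then have eq: "cinner (R (\<gamma> t) (A u)) v = \<gamma> t * cinner (R (\<gamma> t) u) v - cinner u v"
      by (simp only: cinner_diff_left cinner_scaleC_left)
    show ?thesis unfolding eq by (simp add: algebra_simps)
  qed
  have "poly_op (pCons a p) A u = a *\<^sub>C u + poly_op p A (A u)"
  proof -
    have "poly_op (p * [:0, 1:]) A u = poly_op ([:0, 1:] * p) A u" by (simp only: mult.commute)
    then have "poly_op p A (A u) = A (poly_op p A u)"
      unfolding poly_op_mult[OF A] by (simp add: poly_op_pCons[OF A] bounded_clinear_zero[OF A])
    then show ?thesis by (simp add: poly_op_pCons[OF A])
  qed
  then have val: "a * (2 * pi * \<i> * cinner u v) + (0 + 2 * pi * \<i> * cinner (poly_op p A (A u)) v)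
      = 2 * pi * \<i> * cinner (poly_op (pCons a p) A u) v"
    by (simp add: cinner_add_left cinner_scaleC_left algebra_simps)
  show ?case
    unfolding contour_integral_eq_integral
    by (rule integral_unique) (use sum in \<open>simp only: eq val\<close>)
qed simp

text \<open>This crude bound, with a constant that depends on the distance between \<open>E\<close> and the curve, ensures that the suprema
  below are finite and controls the errors of polynomial approximation.\<close>

lemma resolvent_integral_bound:
  obtains C where "0 \<le> C" "\<And>f M u v. continuous_on (frontier \<Omega>) f \<Longrightarrow> (\<And>z. z \<in> frontier \<Omega> \<Longrightarrow> cmod (f z) \<le> M)
    \<Longrightarrow> cmod (contour_integral \<gamma> (\<lambda>\<zeta>. f \<zeta> * cinner (R \<zeta> u) v)) \<le> C * M * (norm u * norm v)"
proof -
  obtain B where B: "0 < B" "\<And>t. t \<in> {0..1} \<Longrightarrow> cmod (\<gamma>' t) \<le> B" using speed_bound by blast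
  obtain d where d: "0 < d" "\<And>t. d \<le> infdist (\<gamma> t) E"
  proof -
    have "frontier \<Omega> \<inter> E = {}" using frontier_notin by blast
    from separate_closed_compact[OF frontier_closed E(2) this]
    obtain d where d: "d > 0" "\<forall>x\<in>frontier \<Omega>. \<forall>y\<in>E. d \<le> dist x y" by blast
    show thesis
    proof (rule that[OF d(1)])
      show "d \<le> infdist (\<gamma> t) E" for t
        unfolding infdist_notempty[OF E(3)] using d(2) in_frontier[of t] by (intro cINF_greatest[OF E(3)]) auto
    qed
  qed
  show thesis
  proof (rule that[of "B / d"])
    show "0 \<le> B / d" using B d by simp
    fix f M u v assume f: "continuous_on (frontier \<Omega>) f" and M: "\<And>z. z \<in> frontier \<Omega> \<Longrightarrow> cmod (f z) \<le> M"
    have M0: "0 \<le> M" using M[OF in_frontier[of 0]] norm_ge_zero order_trans by blast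
    have "cmod (contour_integral \<gamma> (\<lambda>\<zeta>. f \<zeta> * cinner (R \<zeta> u) v))
        \<le> (M * (norm u / d * norm v) * B) * measure lborel (cbox 0 (1::real))"
    proof (rule has_integral_bound)
      show "0 \<le> M * (norm u / d * norm v) * B" using M0 B d by simp
      show "((\<lambda>t. f (\<gamma> t) * cinner (R (\<gamma> t) u) v * \<gamma>' t) has_integral
        contour_integral \<gamma> (\<lambda>\<zeta>. f \<zeta> * cinner (R \<zeta> u) v)) (cbox 0 1)"
        using has_integral_resolvent[OF f] by simp
      fix t :: real assume t: "t \<in> cbox 0 1"
      have "cmod (cinner (R (\<gamma> t) u) v) \<le> norm (R (\<gamma> t) u) * norm v" by (rule cmod_cinner_le)
      also have "\<dots> \<le> norm u / infdist (\<gamma> t) E * norm v"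
        by (intro mult_right_mono norm_R_le \<gamma>_notin) simp
      also have "\<dots> \<le> norm u / d * norm v"
        using d(1) d(2)[of t] by (intro mult_right_mono divide_left_mono) auto
      finally show "norm (f (\<gamma> t) * cinner (R (\<gamma> t) u) v * \<gamma>' t) \<le> M * (norm u / d * norm v) * B"
        unfolding norm_mult using M[OF in_frontier[of t]] B t M0 d
        by (intro mult_mono) auto
    qed
    then show "cmod (contour_integral \<gamma> (\<lambda>\<zeta>. f \<zeta> * cinner (R \<zeta> u) v)) \<le> B / d * M * (norm u * norm v)"
      by (simp add: mult_ac)
  qed
qed

subsection \<open>Positivity\<close>

text \<open>The density of the positive operator measure on the curve, as a sesquilinear form. It is the analogue of
  \<open>kernel\<close> (divided by \<open>\<pi>\<close>) with the operator \<open>A\<close> in place of the point \<open>z\<close>.\<close>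

definition density :: "real \<Rightarrow> 'a \<Rightarrow> 'a \<Rightarrow> complex"
  where "density t u v = (\<gamma>' t * cinner (R (\<gamma> t) u) v - cnj (\<gamma>' t * cinner (R (\<gamma> t) v) u)) / (2 * pi * \<i>)"

lemma Re_density: "Re (density t u u) = Im (\<gamma>' t * cinner (R (\<gamma> t) u) u) / pi"
proof -
  have "(x - cnj x) / (2 * pi * \<i>) = of_real (Im x / pi)" for x
    by (simp add: complex_eq_iff Re_divide Im_divide power2_eq_square)
  then show ?thesis unfolding density_def by (metis Re_complex_of_real)
qed

text \<open>With \<open>w = R(\<gamma> t) u\<close>, the value \<open>\<langle>w, u\<rangle>\<close> is the conjugate of \<open>\<langle>(\<gamma> t - A) w, w\<rangle>\<close>, hence a positive multiple of
  the conjugate of \<open>\<gamma> t - a\<close> for a point \<open>a\<close> to the left of the tangent.\<close>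

lemma density_nonneg: "0 \<le> Re (density t u u)"
proof -
  define w where "w = R (\<gamma> t) u"
  obtain a where a: "a \<in> E" "cinner (shift (\<gamma> t) w) w = of_real ((norm w)\<^sup>2) * (\<gamma> t - a)"
    by (rule shift_point)
  have "cinner w u = cnj (cinner (shift (\<gamma> t) w) w)"
    unfolding w_def shift_R[OF \<gamma>_notin] by (rule cinner_commute)
  then have "\<gamma>' t * cinner w u = of_real ((norm w)\<^sup>2) * (\<gamma>' t * cnj (\<gamma> t - a))"
    unfolding a by (simp only: complex_cnj_mult complex_cnj_complex_of_real mult_ac)
  moreover have "Im (of_real r * z) = r * Im z" for r z by simp
  ultimately have "Im (\<gamma>' t * cinner w u) = (norm w)\<^sup>2 * Im (\<gamma>' t * cnj (\<gamma> t - a))"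
    by (simp only:)
  moreover have "a \<in> \<Omega>" using a(1) E_subset by blast
  ultimately show ?thesis
    unfolding Re_density w_def[symmetric] using left[of a t] by (simp only: zero_le_mult_iff
        zero_le_power2 zero_le_divide_iff pi_ge_zero) simp
qed

lemma density_Cauchy_Schwarz:
  "(cmod (density t u v))\<^sup>2 \<le> Re (density t u u) * Re (density t v v)"
proof (rule Cauchy_Schwarz_hermitian)
  show "density t (x + y) z = density t x z + density t y z" for x y z
    by (simp add: density_def R_add[OF \<gamma>_notin] cinner_add_left cinner_add_right add_divide_distrib
        diff_divide_distrib algebra_simps)
  show "density t (a *\<^sub>C x) y = a * density t x y" for a x y
    by (simp add: density_def R_scaleC[OF \<gamma>_notin] cinner_scaleC_left cinner_scaleC_right algebra_simps)
  show "density t x y = cnj (density t y x)" for x y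
  proof -
    have "cnj ((b - cnj a) / (2 * pi * \<i>)) = (a - cnj b) / (2 * pi * \<i>)" for a b
      using minus_divide_divide[of "a - cnj b" "2 * pi * \<i>"] by simp
    then show ?thesis by (simp only: density_def)
  qed
  show "0 \<le> Re (density t x x)" for x by (rule density_nonneg)
qed

lemma integral_density: "((\<lambda>t. Re (density t u u)) has_integral 2 * (norm u)\<^sup>2) {0..1}"
proof -
  have "((\<lambda>t. cinner (R (\<gamma> t) u) u * \<gamma>' t) has_integral (2 * pi * \<i> * cinner u u)) {0..1}"
    using has_integral_resolvent[of "\<lambda>_. 1" u u] integral_resolvent by simp
  from has_integral_divide[OF has_integral_linear[OF this bounded_linear_Im], of pi]
  have "((\<lambda>t. Im (cinner (R (\<gamma> t) u) u * \<gamma>' t) / pi) has_integral Im (2 * pi * \<i> * cinner u u) / pi) {0..1}"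
    by (simp only: o_def)
  moreover have "Im (2 * pi * \<i> * cinner u u) / pi = 2 * (norm u)\<^sup>2"
    unfolding cinner_self by (simp del: of_real_power)
  ultimately show ?thesis
    by (simp only: Re_density mult.commute[of "\<gamma>' _"])
qed

text \<open>The operator \<open>h(A)\<close> plus the adjoint of the Cauchy integral of the conjugate of \<open>h\<close> is the
  integral of \<open>h\<close> against a positive operator measure of total mass 2.\<close>

lemma positive_measure_bound:
  assumes h: "\<And>z. z \<in> closure \<Omega> \<Longrightarrow> cmod (poly h z) \<le> 1"
  shows "cmod (cinner (poly_op h A u) v
      + cnj (contour_integral \<gamma> (\<lambda>\<zeta>. cnj (poly h \<zeta>) * cinner (R \<zeta> v) u) / (2 * pi * \<i>))) \<le> 2 * (norm u * norm v)"
proof (cases "u = 0 \<or> v = 0")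
  case True
  then have "contour_integral \<gamma> (\<lambda>\<zeta>. cnj (poly h \<zeta>) * cinner (R \<zeta> v) u) = 0"
  proof
    assume "v = 0"
    moreover have "R \<zeta> 0 = 0" if "\<zeta> \<notin> E" for \<zeta>
      using R_scaleC[OF that, of 0 0] by simp
    ultimately show ?thesis
      by (intro contour_integral_eq_0) (use frontier_notin path_image in auto)
  qed simp
  then show ?thesis using True by (auto simp: bounded_clinear_zero[OF bounded_clinear_poly_op[OF A]])
next
  case False
  define X where "X = contour_integral \<gamma> (\<lambda>\<zeta>. cnj (poly h \<zeta>) * cinner (R \<zeta> v) u)"
  have 1: "((\<lambda>t. poly h (\<gamma> t) * cinner (R (\<gamma> t) u) v * \<gamma>' t) has_integral 2 * pi * \<i> * cinner (poly_op h A u) v) {0..1}"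
    using has_integral_resolvent[of "poly h" u v] integral_poly_resolvent by (simp add: continuous_on_poly)
  have "((\<lambda>t. cnj (poly h (\<gamma> t)) * cinner (R (\<gamma> t) v) u * \<gamma>' t) has_integral X) {0..1}"
    unfolding X_def by (rule has_integral_resolvent) (intro continuous_intros continuous_on_poly)
  from has_integral_linear[OF this bounded_linear_cnj]
  have 2: "((\<lambda>t. cnj (cnj (poly h (\<gamma> t)) * cinner (R (\<gamma> t) v) u * \<gamma>' t)) has_integral cnj X) {0..1}"
    by (simp add: o_def)
  have "((\<lambda>t. (poly h (\<gamma> t) * cinner (R (\<gamma> t) u) v * \<gamma>' t - cnj (cnj (poly h (\<gamma> t)) * cinner (R (\<gamma> t) v) u * \<gamma>' t)) / (2 * pi * \<i>))
      has_integral (2 * pi * \<i> * cinner (poly_op h A u) v - cnj X) / (2 * pi * \<i>)) {0..1}"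
    by (intro has_integral_divide has_integral_diff 1 2)
  moreover have "(poly h (\<gamma> t) * cinner (R (\<gamma> t) u) v * \<gamma>' t - cnj (cnj (poly h (\<gamma> t)) * cinner (R (\<gamma> t) v) u * \<gamma>' t)) / (2 * pi * \<i>)
      = poly h (\<gamma> t) * density t u v" for t
    by (simp add: density_def algebra_simps)
  moreover have "(2 * pi * \<i> * cinner (poly_op h A u) v - cnj X) / (2 * pi * \<i>) = cinner (poly_op h A u) v + cnj (X / (2 * pi * \<i>))"
    by (simp add: field_simps)
  ultimately have int: "((\<lambda>t. poly h (\<gamma> t) * density t u v) has_integral (cinner (poly_op h A u) v + cnj (X / (2 * pi * \<i>)))) {0..1}"
    by simp
  \<comment> \<open>The weight that makes the two halves of the arithmetic-geometric mean bound have equal integrals.\<close>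
  define \<beta> where "\<beta> = norm v / norm u"
  have \<beta>: "0 < \<beta>" using False by (simp add: \<beta>_def)
  have bnd: "((\<lambda>t. (\<beta> * Re (density t u u) + Re (density t v v) / \<beta>) / 2) has_integral
      (\<beta> * (2 * (norm u)\<^sup>2) + 2 * (norm v)\<^sup>2 / \<beta>) / 2) {0..1}"
    by (intro has_integral_divide has_integral_add has_integral_mult_right integral_density)
  have amgm: "a * b \<le> ((a + b) / 2)\<^sup>2" for a b :: real
    using sum_squares_bound[of a b] by (simp add: power2_eq_square field_simps)
  have "cmod (cinner (poly_op h A u) v + cnj (X / (2 * pi * \<i>))) \<le> (\<beta> * (2 * (norm u)\<^sup>2) + 2 * (norm v)\<^sup>2 / \<beta>) / 2"
    unfolding integral_unique[OF int, symmetric] integral_unique[OF bnd, symmetric]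
  proof (rule integral_norm_bound_integral[OF has_integral_integrable[OF int] has_integral_integrable[OF bnd]])
    fix t
    define x where "x = Re (density t u u)"
    define y where "y = Re (density t v v)"
    have xy: "0 \<le> x" "0 \<le> y" using density_nonneg by (auto simp: x_def y_def)
    have "(cmod (density t u v))\<^sup>2 \<le> (\<beta> * x) * (y / \<beta>)"
      using density_Cauchy_Schwarz[of t u v] \<beta> by (simp add: x_def y_def)
    also have "\<dots> \<le> ((\<beta> * x + y / \<beta>) / 2)\<^sup>2"
      using amgm[of "\<beta> * x" "y / \<beta>"] .
    finally have "cmod (density t u v) \<le> (\<beta> * x + y / \<beta>) / 2"
      by (rule power2_le_imp_le) (use xy \<beta> in auto)
    then show "cmod (poly h (\<gamma> t) * density t u v) \<le> (\<beta> * Re (density t u u) + Re (density t v v) / \<beta>) / 2"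
      using h[OF in_closure[of t]] mult_left_le_one_le[of "cmod (density t u v)" "cmod (poly h (\<gamma> t))"]
      by (simp add: x_def y_def norm_mult)
  qed
  also have "\<dots> = 2 * (norm u * norm v)"
    using False by (simp add: \<beta>_def field_simps power2_eq_square)
  finally show ?thesis unfolding X_def .
qed

end

text \<open>Here \<open>G\<close> approximates the Cauchy transform of the conjugate of \<open>h\<close> along the outer contour. The inner
  contour serves to compare \<open>G(A)\<close> with the same transform of the resolvent.\<close>

theorem exists_conjugate_polynomial:
  fixes A :: "'a::chilbert_space \<Rightarrow> 'a"
  assumes inner: "contour_operator \<Omega>0 \<gamma>0 \<gamma>0' A E" and outer: "convex_contour \<Omega>1 \<gamma>1 \<gamma>1'"
    and sub: "closure \<Omega>0 \<subseteq> \<Omega>1"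
    and h: "\<And>z. z \<in> closure \<Omega>1 \<Longrightarrow> cmod (poly h z) \<le> 1" and e: "0 < e"
  shows "\<exists>G. (\<forall>z\<in>closure \<Omega>0. cmod (poly G z) \<le> 1 + e) \<and>
    (\<forall>u v. cmod (cinner (poly_op h A u) v + cinner u (poly_op G A v)) \<le> (2 + e) * (norm u * norm v))"
proof -
  interpret I: contour_operator \<Omega>0 \<gamma>0 \<gamma>0' A E by (rule inner)
  interpret C: convex_contour \<Omega>1 \<gamma>1 \<gamma>1' by (rule outer)
  have E1: "E \<subseteq> \<Omega>1" using I.E_subset sub closure_subset by blast
  interpret O: contour_operator \<Omega>1 \<gamma>1 \<gamma>1' A E
    by unfold_locales (rule E1)
  have fr0: "frontier \<Omega>0 \<subseteq> closure \<Omega>0" by (auto simp: frontier_def)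
  have fr01: "frontier \<Omega>0 \<subseteq> \<Omega>1" using fr0 sub by blast
  have disj: "\<zeta> \<notin> closure \<Omega>0" if "\<zeta> \<in> frontier \<Omega>1" for \<zeta>
    using that sub C.open_\<Omega> by (auto simp: frontier_def interior_open)
  obtain B where B: "0 \<le> B" "\<And>f M u v. continuous_on (frontier \<Omega>0) f \<Longrightarrow> (\<And>z. z \<in> frontier \<Omega>0 \<Longrightarrow> cmod (f z) \<le> M)
    \<Longrightarrow> cmod (contour_integral \<gamma>0 (\<lambda>\<zeta>. f \<zeta> * cinner (I.R \<zeta> u) v)) \<le> B * M * (norm u * norm v)"
    using I.resolvent_integral_bound by blast
  define e' where "e' = e / (B + 1)"
  have e': "0 < e'" "B * e' \<le> e" "e' \<le> e"
    using B(1) e by (auto simp: e'_def field_simps)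
  define g where "g = C.conj_transform (poly h)"
  have hol: "poly h holomorphic_on UNIV" by (auto intro!: holomorphic_intros)
  have g1: "cmod (g z) \<le> 1" if "z \<in> \<Omega>1" for z
    unfolding g_def by (rule C.cmod_conj_transform_le_1[OF open_UNIV convex_UNIV _ hol h that]) auto
  have gcont: "continuous_on \<Omega>1 g"
    unfolding g_def by (intro holomorphic_on_imp_continuous_on C.conj_transform_holomorphic continuous_on_poly continuous_intros)
  have "poly_approximable (closure \<Omega>0) g"
    unfolding g_def using I.bounded_\<Omega> I.convex_\<Omega> sub
    by (intro C.poly_approximable_conj_transform continuous_on_poly continuous_intros)
      (auto simp: convex_closure compact_closure)
  then obtain G where G: "\<And>z. z \<in> closure \<Omega>0 \<Longrightarrow> cmod (g z - poly G z) \<le> e'"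
    using poly_approximableD[of _ g e'] e' by blast
  have R_Cauchy: "contour_integral \<gamma>0 (\<lambda>z. cinner (I.R z w) x / (\<zeta> - z)) = 2 * pi * \<i> * cinner (I.R \<zeta> w) x"
    if \<zeta>: "\<zeta> \<in> frontier \<Omega>1" for \<zeta> w x
  proof -
    have \<zeta>E: "\<zeta> \<notin> E" using O.frontier_notin[OF \<zeta>] .
    have "((\<lambda>z. cinner (I.R z (I.R \<zeta> w)) x) has_contour_integral 2 * pi * \<i> * cinner (I.R \<zeta> w) x) \<gamma>0"
      unfolding I.has_contour_integral_iff
      using I.has_integral_resolvent[of "\<lambda>_. 1" "I.R \<zeta> w" x] I.integral_resolvent by simp
    moreover have "((\<lambda>z. 1 / (\<zeta> - z)) has_contour_integral 0) \<gamma>0"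
    proof (rule Cauchy_theorem_convex_simple[of _ "closure \<Omega>0"])
      show "(\<lambda>z. 1 / (\<zeta> - z)) holomorphic_on closure \<Omega>0"
        using disj[OF \<zeta>] by (intro holomorphic_intros) auto
      show "path_image \<gamma>0 \<subseteq> closure \<Omega>0" unfolding I.path_image by (rule fr0)
    qed (simp_all add: I.convex_\<Omega> convex_closure I.valid_path I.closed)
    ultimately have "((\<lambda>z. cinner (I.R z (I.R \<zeta> w)) x + cinner (I.R \<zeta> w) x * (1 / (\<zeta> - z)))
        has_contour_integral (2 * pi * \<i> * cinner (I.R \<zeta> w) x + cinner (I.R \<zeta> w) x * 0)) \<gamma>0"
      by (intro has_contour_integral_add has_contour_integral_lmul)
    then have "((\<lambda>z. cinner (I.R z w) x / (\<zeta> - z)) has_contour_integral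
        (2 * pi * \<i> * cinner (I.R \<zeta> w) x + cinner (I.R \<zeta> w) x * 0)) \<gamma>0"
    proof (rule has_contour_integral_eq)
      fix z assume "z \<in> path_image \<gamma>0"
      then have z: "z \<notin> E" "\<zeta> - z \<noteq> 0"
        using I.frontier_notin disj[OF \<zeta>] fr0 by (auto simp: I.path_image)
      have "cinner (I.R z w) x = cinner (I.R \<zeta> w) x + (\<zeta> - z) * cinner (I.R z (I.R \<zeta> w)) x"
        using I.cinner_resolvent_diff[OF z(1) \<zeta>E, of w x] by (simp add: diff_eq_eq add.commute)
      then show "cinner (I.R z (I.R \<zeta> w)) x + cinner (I.R \<zeta> w) x * (1 / (\<zeta> - z)) = cinner (I.R z w) x / (\<zeta> - z)"
        using z(2) by (simp add: add_divide_distrib)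
    qed
    then show ?thesis by (simp add: contour_integral_unique)
  qed
  have swap: "contour_integral \<gamma>0 (\<lambda>z. g z * cinner (I.R z w) x)
      = contour_integral \<gamma>1 (\<lambda>\<zeta>. cnj (poly h \<zeta>) * cinner (I.R \<zeta> w) x)" for w x
  proof -
    have "contour_integral \<gamma>0 (\<lambda>z. contour_integral \<gamma>1 (\<lambda>\<zeta>. cnj (poly h \<zeta>) / (\<zeta> - z) * cinner (I.R z w) x))
        = contour_integral \<gamma>1 (\<lambda>\<zeta>. contour_integral \<gamma>0 (\<lambda>z. cnj (poly h \<zeta>) / (\<zeta> - z) * cinner (I.R z w) x))"
    proof (rule contour_integral_swap)
      show "continuous_on (path_image \<gamma>0 \<times> path_image \<gamma>1)
          (\<lambda>(z, \<zeta>). cnj (poly h \<zeta>) / (\<zeta> - z) * cinner (I.R z w) x)"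
        unfolding case_prod_beta I.path_image C.path_image
        by (intro continuous_intros continuous_on_poly continuous_on_compose2[OF I.resolvent_continuous])
          (use I.frontier_notin disj fr0 in auto)
      show "continuous_on {0..1} (\<lambda>t. vector_derivative \<gamma>0 (at t))"
        "continuous_on {0..1} (\<lambda>t. vector_derivative \<gamma>1 (at t))"
        unfolding I.vector_derivative C.vector_derivative by (rule I.cont'' C.cont'')+
    qed (rule I.valid_path C.valid_path)+
    moreover have "contour_integral \<gamma>1 (\<lambda>\<zeta>. cnj (poly h \<zeta>) / (\<zeta> - z) * cinner (I.R z w) x)
        = 2 * pi * \<i> * (g z * cinner (I.R z w) x)" for z
    proof -
      have "contour_integral \<gamma>1 (\<lambda>\<zeta>. cnj (poly h \<zeta>) / (\<zeta> - z) * cinner (I.R z w) x)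
          = cinner (I.R z w) x * contour_integral \<gamma>1 (\<lambda>\<zeta>. cnj (poly h \<zeta>) / (\<zeta> - z))"
        unfolding mult.commute[of _ "cinner (I.R z w) x"] by (rule C.contour_integral_cmult)
      also have "contour_integral \<gamma>1 (\<lambda>\<zeta>. cnj (poly h \<zeta>) / (\<zeta> - z)) = 2 * pi * \<i> * g z"
        by (simp add: g_def C.conj_transform_def)
      finally show ?thesis by (simp add: mult_ac)
    qed
    moreover have "contour_integral \<gamma>1 (\<lambda>\<zeta>. contour_integral \<gamma>0 (\<lambda>z. cnj (poly h \<zeta>) / (\<zeta> - z) * cinner (I.R z w) x))
        = contour_integral \<gamma>1 (\<lambda>\<zeta>. 2 * pi * \<i> * (cnj (poly h \<zeta>) * cinner (I.R \<zeta> w) x))"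
    proof (rule contour_integral_eq)
      fix \<zeta> assume "\<zeta> \<in> path_image \<gamma>1"
      then have \<zeta>: "\<zeta> \<in> frontier \<Omega>1" by (simp add: C.path_image)
      have "contour_integral \<gamma>0 (\<lambda>z. cnj (poly h \<zeta>) / (\<zeta> - z) * cinner (I.R z w) x)
          = contour_integral \<gamma>0 (\<lambda>z. cnj (poly h \<zeta>) * (cinner (I.R z w) x / (\<zeta> - z)))" by simp
      also have "\<dots> = cnj (poly h \<zeta>) * contour_integral \<gamma>0 (\<lambda>z. cinner (I.R z w) x / (\<zeta> - z))"
        by (rule I.contour_integral_cmult)
      finally show "contour_integral \<gamma>0 (\<lambda>z. cnj (poly h \<zeta>) / (\<zeta> - z) * cinner (I.R z w) x)
          = 2 * pi * \<i> * (cnj (poly h \<zeta>) * cinner (I.R \<zeta> w) x)"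
        unfolding R_Cauchy[OF \<zeta>] by simp
    qed
    ultimately have "2 * pi * \<i> * contour_integral \<gamma>0 (\<lambda>z. g z * cinner (I.R z w) x)
        = 2 * pi * \<i> * contour_integral \<gamma>1 (\<lambda>\<zeta>. cnj (poly h \<zeta>) * cinner (I.R \<zeta> w) x)"
      by (simp only: I.contour_integral_cmult C.contour_integral_cmult)
    then show ?thesis by simp
  qed
  show ?thesis
  proof (intro exI[of _ G] conjI ballI allI)
    show "cmod (poly G z) \<le> 1 + e" if z: "z \<in> closure \<Omega>0" for z
      using norm_triangle_ineq4[of "g z" "g z - poly G z"] G[OF z] g1[of z] z sub e' by auto
    fix u v
    define X where "X = contour_integral \<gamma>1 (\<lambda>\<zeta>. cnj (poly h \<zeta>) * cinner (I.R \<zeta> v) u)"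
    have "contour_integral \<gamma>0 (\<lambda>z. poly G z * cinner (I.R z v) u) - contour_integral \<gamma>0 (\<lambda>z. g z * cinner (I.R z v) u)
        = contour_integral \<gamma>0 (\<lambda>z. (poly G z - g z) * cinner (I.R z v) u)"
    proof -
      have "((\<lambda>t. poly G (\<gamma>0 t) * cinner (I.R (\<gamma>0 t) v) u * \<gamma>0' t - g (\<gamma>0 t) * cinner (I.R (\<gamma>0 t) v) u * \<gamma>0' t) has_integral
        contour_integral \<gamma>0 (\<lambda>z. poly G z * cinner (I.R z v) u) - contour_integral \<gamma>0 (\<lambda>z. g z * cinner (I.R z v) u)) {0..1}"
        by (intro has_integral_diff I.has_integral_resolvent continuous_on_poly continuous_intros
            continuous_on_subset[OF gcont fr01])
      from integral_unique[OF this] show ?thesis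
        unfolding I.contour_integral_eq_integral by (simp add: left_diff_distrib)
    qed
    then have "2 * pi * \<i> * cinner (poly_op G A v) u - X = contour_integral \<gamma>0 (\<lambda>z. (poly G z - g z) * cinner (I.R z v) u)"
      unfolding X_def swap I.integral_poly_resolvent .
    moreover have "cmod (contour_integral \<gamma>0 (\<lambda>z. (poly G z - g z) * cinner (I.R z v) u)) \<le> B * e' * (norm v * norm u)"
      using G fr0 by (intro B(2) continuous_intros continuous_on_poly continuous_on_subset[OF gcont fr01])
        (auto simp: norm_minus_commute)
    ultimately have "cmod (2 * pi * \<i> * cinner (poly_op G A v) u - X) \<le> e * (norm v * norm u)"
      using mult_right_mono[OF e'(2), of "norm v * norm u"] by simp
    moreover have "cinner (poly_op G A v) u - X / (2 * pi * \<i>) = (2 * pi * \<i> * cinner (poly_op G A v) u - X) / (2 * pi * \<i>)"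
      by (simp add: diff_divide_distrib)
    ultimately have "cmod (cinner (poly_op G A v) u - X / (2 * pi * \<i>)) \<le> (e * (norm v * norm u)) / (2 * pi)"
      by (simp add: norm_divide norm_mult divide_right_mono)
    also have "\<dots> \<le> (e * (norm v * norm u)) / 1"
      using e pi_ge_two by (intro divide_left_mono) auto
    finally have "cmod (cnj (cinner (poly_op G A v) u - X / (2 * pi * \<i>))) \<le> e * (norm u * norm v)"
      unfolding complex_mod_cnj by (simp add: mult.commute)
    moreover have "cinner (poly_op h A u) v + cinner u (poly_op G A v) =
        (cinner (poly_op h A u) v + cnj (X / (2 * pi * \<i>))) + cnj (cinner (poly_op G A v) u - X / (2 * pi * \<i>))"
      unfolding complex_cnj_diff cinner_commute[symmetric] by simp
    moreover have "cmod (cinner (poly_op h A u) v + cnj (X / (2 * pi * \<i>))) \<le> 2 * (norm u * norm v)"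
      unfolding X_def by (rule O.positive_measure_bound[OF h])
    ultimately show "cmod (cinner (poly_op h A u) v + cinner u (poly_op G A v)) \<le> (2 + e) * (norm u * norm v)"
      using norm_triangle_ineq[of "cinner (poly_op h A u) v + cnj (X / (2 * pi * \<i>))"
          "cnj (cinner (poly_op G A v) u - X / (2 * pi * \<i>))"]
      by (simp add: distrib_right)
  qed
qed

section \<open>Two perturbations inside the unit disc\<close>

text \<open>On the unit circle \<open>z + t (1 - z\<^sup>2) = z (1 + t (cnj z - z))\<close>, and \<open>cnj z - z\<close> is imaginary: to first order in \<open>t\<close>
  the modulus does not change. The proof computes on the whole disc.\<close>

lemma cmod_perturb_le:
  assumes "cmod z \<le> 1" and t: "\<bar>t\<bar> \<le> 1/2"
  shows "cmod (z + of_real t * (1 - z\<^sup>2)) \<le> 1 + 2 * t\<^sup>2"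
proof -
  define r where "r = cmod z"
  have r: "0 \<le> r" "r \<le> 1" "r\<^sup>2 \<le> 1" using assms by (auto simp: r_def power_le_one)
  have eq: "(cmod (z + of_real t * (1 - z\<^sup>2)))\<^sup>2
      = r\<^sup>2 + 2 * t * ((1 - r\<^sup>2) * Re z) + t\<^sup>2 * (cmod (1 - z\<^sup>2))\<^sup>2"
    unfolding r_def cmod_power2 by (simp add: power2_eq_square algebra_simps)
  have "\<bar>Re z\<bar> \<le> 1" using abs_Re_le_cmod[of z] assms by linarith
  then have "\<bar>t * Re z\<bar> \<le> 1/2"
    using mult_mono[of "\<bar>t\<bar>" "1/2" "\<bar>Re z\<bar>" 1] t by (simp add: abs_mult)
  then have "2 * (t * Re z) * (1 - r\<^sup>2) \<le> 1 * (1 - r\<^sup>2)"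
    by (intro mult_right_mono) (use r in linarith)+
  moreover have "cmod (1 - z\<^sup>2) \<le> 2"
    using norm_triangle_ineq4[of 1 "z\<^sup>2"] r by (simp add: norm_power r_def)
  then have "t\<^sup>2 * (cmod (1 - z\<^sup>2))\<^sup>2 \<le> t\<^sup>2 * 4"
    using power_mono[of "cmod (1 - z\<^sup>2)" 2 2] by (intro mult_left_mono) auto
  ultimately have "(cmod (z + of_real t * (1 - z\<^sup>2)))\<^sup>2 \<le> 1 + 4 * t\<^sup>2"
    unfolding eq by (simp add: algebra_simps)
  also have "\<dots> \<le> 1 + 4 * t\<^sup>2 + (2 * t\<^sup>2)\<^sup>2"
    by simp
  also have "\<dots> = (1 + 2 * t\<^sup>2)\<^sup>2"
    by (simp add: power2_eq_square algebra_simps)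
  finally show ?thesis
    by (rule power2_le_imp_le) simp
qed

text \<open>On the unit circle \<open>(z - \<rho>) (1 - \<rho> z) = z \<bar>z - \<rho>\<bar>\<^sup>2\<close>, so the perturbed value is \<open>z (1 + t (w cnj z - \<bar>z - \<rho>\<bar>\<^sup>2))\<close>.
  The factor of \<open>t\<close> has nonpositive real part, so the modulus exceeds 1 by a term of second order only. The proof
  computes on the whole disc.\<close>

lemma cmod_Blaschke_perturb_le:
  assumes z: "cmod z \<le> 1" and w: "cmod w \<le> (cmod (z - of_real \<rho>))\<^sup>2"
    and \<rho>: "0 \<le> \<rho>" "\<rho> \<le> 1" and t: "0 \<le> t" "t \<le> 1/8"
  shows "cmod (z + of_real t * (w - (z - of_real \<rho>) * (1 - of_real \<rho> * z))) \<le> 1 + 16 * t\<^sup>2"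
proof -
  define r where "r = cmod z"
  define q where "q = (z - of_real \<rho>) * (1 - of_real \<rho> * z)"
  define m where "m = (cmod (z - of_real \<rho>))\<^sup>2"
  have r: "0 \<le> r" "r \<le> 1" "r\<^sup>2 \<le> 1" using z by (auto simp: r_def power_le_one)
  have z\<rho>: "cmod (z - of_real \<rho>) \<le> 2"
    using norm_triangle_ineq4[of z "of_real \<rho>"] z \<rho> by simp
  then have m4: "m \<le> 4" "0 \<le> m"
    using power_mono[of "cmod (z - of_real \<rho>)" 2 2] by (auto simp: m_def)
  have "cmod (1 - of_real \<rho> * z) \<le> 2"
    using norm_triangle_ineq4[of 1 "of_real \<rho> * z"] mult_mono[of \<rho> 1 "cmod z" 1] z \<rho>
    by (simp add: norm_mult)
  then have "cmod q \<le> 2 * 2"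
    unfolding q_def norm_mult by (intro mult_mono z\<rho>) auto
  then have q4: "(cmod q)\<^sup>2 \<le> 16"
    using power_mono[of "cmod q" 4 2] by simp
  have tm: "t * m \<le> 1/2" using mult_mono[of t "1/8" m 4] t m4 by simp
  have eq: "(cmod (z - of_real t * q))\<^sup>2 = r\<^sup>2 - 2 * t * (m - (1 - r\<^sup>2) * (\<rho> * (\<rho> - Re z))) + t\<^sup>2 * (cmod q)\<^sup>2"
    unfolding r_def cmod_power2 m_def q_def by (simp add: power2_eq_square algebra_simps)
  have "\<rho> - Re z \<le> 2" using abs_Re_le_cmod[of z] z \<rho> by linarith
  then have "\<rho> * (\<rho> - Re z) \<le> \<rho> * 2"
    using \<rho> by (intro mult_left_mono) auto
  then have "\<rho> * (\<rho> - Re z) \<le> 2" using \<rho> by linarith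
  then have "t * (\<rho> * (\<rho> - Re z)) \<le> t * 2"
    using t by (intro mult_left_mono) auto
  then have "2 * (t * (\<rho> * (\<rho> - Re z))) \<le> 1"
    using t by linarith
  then have "2 * (t * (\<rho> * (\<rho> - Re z))) * (1 - r\<^sup>2) \<le> 1 * (1 - r\<^sup>2)"
    by (intro mult_right_mono) (use r in linarith)+
  moreover have "t\<^sup>2 * (cmod q)\<^sup>2 \<le> t\<^sup>2 * 16"
    using q4 by (intro mult_left_mono) auto
  ultimately have "(cmod (z - of_real t * q))\<^sup>2 \<le> 1 - 2 * (t * m) + 16 * t\<^sup>2"
    unfolding eq by (simp add: algebra_simps)
  also have "\<dots> \<le> (1 - t * m + 16 * t\<^sup>2)\<^sup>2"
  proof -
    have "(1 - t * m + 16 * t\<^sup>2)\<^sup>2 = (1 - 2 * (t * m) + 16 * t\<^sup>2) + ((t * m)\<^sup>2 + (16 * t\<^sup>2)\<^sup>2 + 16 * t\<^sup>2 * (1 - 2 * (t * m)))"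
      by (simp add: power2_eq_square algebra_simps)
    moreover have "0 \<le> 16 * t\<^sup>2 * (1 - 2 * (t * m))" using tm by simp
    ultimately show ?thesis by simp
  qed
  finally have "cmod (z - of_real t * q) \<le> 1 - t * m + 16 * t\<^sup>2"
    by (rule power2_le_imp_le) (use tm in \<open>simp add: add_nonneg_nonneg\<close>)
  moreover have "cmod (of_real t * w) \<le> t * m"
    using w t by (simp add: norm_mult m_def mult_left_mono)
  ultimately have "cmod ((z - of_real t * q) + of_real t * w) \<le> 1 + 16 * t\<^sup>2"
    using norm_triangle_ineq[of "z - of_real t * q" "of_real t * w"] by linarith
  then have "cmod (z + of_real t * (w - q)) \<le> 1 + 16 * t\<^sup>2"
    by (simp add: algebra_simps)
  then show ?thesis by (simp add: q_def)
qed

lemma cmod_Blaschke_le: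
  assumes z: "cmod z \<le> 1" and \<rho>: "0 \<le> \<rho>" "\<rho> < 1"
  shows "cmod (z - of_real \<rho>) \<le> cmod (1 - of_real \<rho> * z)"
proof -
  have "(cmod (1 - of_real \<rho> * z))\<^sup>2 - (cmod (z - of_real \<rho>))\<^sup>2 = (1 - \<rho>\<^sup>2) * (1 - (cmod z)\<^sup>2)"
    unfolding cmod_power2 by (simp add: power2_eq_square algebra_simps)
  moreover have "\<dots> \<ge> 0"
    using z \<rho> by (intro mult_nonneg_nonneg) (simp_all add: power_le_one)
  ultimately have "(cmod (z - of_real \<rho>))\<^sup>2 \<le> (cmod (1 - of_real \<rho> * z))\<^sup>2" by linarith
  then show ?thesis by (rule power2_le_imp_le) (rule norm_ge_zero)
qed

text \<open>Truncating the geometric series of \<open>1 / (1 - \<rho> z)\<close> turns the Blaschke factor \<open>(z - \<rho>) / (1 - \<rho> z)\<close> into a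
  polynomial and costs a factor of at most \<open>1 + \<rho>\<^sup>n\<close>.\<close>

lemma cmod_partial_Blaschke_le:
  assumes z: "cmod z \<le> 1" and \<rho>: "0 \<le> \<rho>" "\<rho> < 1"
  shows "cmod ((z - of_real \<rho>) * (\<Sum>k<n. (of_real \<rho> * z) ^ k)) \<le> 1 + \<rho> ^ n"
proof -
  have \<rho>z: "cmod (of_real \<rho> * z) \<le> \<rho>" using z \<rho> by (simp add: norm_mult mult_left_le)
  have "cmod (z - of_real \<rho>) * cmod (\<Sum>k<n. (of_real \<rho> * z) ^ k)
      \<le> cmod (1 - of_real \<rho> * z) * cmod (\<Sum>k<n. (of_real \<rho> * z) ^ k)"
    by (intro mult_right_mono cmod_Blaschke_le assms) simp
  also have "\<dots> = cmod (1 - (of_real \<rho> * z) ^ n)"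
    by (simp add: one_diff_power_eq norm_mult)
  also have "\<dots> \<le> 1 + cmod (of_real \<rho> * z) ^ n"
    using norm_triangle_ineq4[of 1 "(of_real \<rho> * z) ^ n"] by (simp add: norm_power)
  also have "\<dots> \<le> 1 + \<rho> ^ n"
    using power_mono[OF \<rho>z] by simp
  finally show ?thesis by (simp add: norm_mult)
qed

section \<open>The extremal argument\<close>

text \<open>What the extremal argument needs to know about \<open>A\<close>: the polynomial calculus is bounded for the supremum norm on
  \<open>E\<close>, by some constant, and every \<open>h\<close> in the unit ball has a companion \<open>G\<close> in the unit ball such that
  \<open>h(A) + G(A)\<^sup>*\<close> has norm at most 2, up to an arbitrarily small error.\<close>

locale Crouzeix_Palencia =
  fixes A :: "'a::complex_inner \<Rightarrow> 'a" and E :: "complex set" and K :: real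
  assumes A: "bounded_clinear A"
    and K: "\<And>p x. (\<And>z. z \<in> E \<Longrightarrow> cmod (poly p z) \<le> 1) \<Longrightarrow> norm (poly_op p A x) \<le> K * norm x"
    and conjugate: "\<And>h e. 0 < e \<Longrightarrow> (\<And>z. z \<in> E \<Longrightarrow> cmod (poly h z) \<le> 1) \<Longrightarrow>
      \<exists>G. (\<forall>z\<in>E. cmod (poly G z) \<le> 1) \<and>
        (\<forall>u v. cmod (cinner (poly_op h A u) v + cinner u (poly_op G A v)) \<le> (2 + e) * (norm u * norm v))"
begin

definition unit_ball :: "complex poly set"
  where "unit_ball = {p. \<forall>z\<in>E. cmod (poly p z) \<le> 1}"

definition \<phi> :: "'a \<Rightarrow> complex poly \<Rightarrow> complex"
  where "\<phi> x p = cinner (poly_op p A x) x"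

lemma \<phi>_simps:
  "\<phi> x (p + q) = \<phi> x p + \<phi> x q" "\<phi> x (p - q) = \<phi> x p - \<phi> x q" "\<phi> x (- p) = - \<phi> x p"
  "\<phi> x (smult c p) = c * \<phi> x p" "\<phi> x [:c:] = c * of_real ((norm x)\<^sup>2)" "\<phi> x 1 = of_real ((norm x)\<^sup>2)"
  by (simp_all add: \<phi>_def poly_op_add poly_op_diff poly_op_minus poly_op_smult cinner_add_left
      cinner_diff_left cinner_minus_left cinner_scaleC_left cinner_self)

definition \<omega> :: real
  where "\<omega> = Sup {Re (\<phi> x p) |x p. norm x = 1 \<and> p \<in> unit_ball}"

lemma bdd_above_extremal: "bdd_above {Re (\<phi> x p) |x p. norm x = 1 \<and> p \<in> unit_ball}"
proof (rule bdd_aboveI[where M = K])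
  fix y assume "y \<in> {Re (\<phi> x p) |x p. norm x = 1 \<and> p \<in> unit_ball}"
  then obtain x p where y: "y = Re (\<phi> x p)" and x: "norm x = 1" and p: "p \<in> unit_ball" by blast
  have "y \<le> cmod (cinner (poly_op p A x) x)"
    unfolding y \<phi>_def by (rule complex_Re_le_cmod)
  also have "\<dots> \<le> norm (poly_op p A x) * norm x" by (rule cmod_cinner_le)
  also have "\<dots> \<le> K" using K[of p x] p x by (simp add: unit_ball_def)
  finally show "y \<le> K" .
qed

lemma Re_\<phi>_le: "Re (\<phi> x p) \<le> \<omega>" if "norm x = 1" "p \<in> unit_ball"
  unfolding \<omega>_def by (rule cSup_upper[OF _ bdd_above_extremal]) (use that in blast)

lemma cmod_le_of_rotations:
  fixes c :: complex
  assumes "\<And>k. cmod k = 1 \<Longrightarrow> Re (k * c) \<le> M"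
  shows "cmod c \<le> M"
proof (cases "c = 0")
  case False
  have "(cnj c / of_real (cmod c)) * c = of_real (cmod c)"
    using False complex_norm_square[of c] by (simp add: field_simps power2_eq_square)
  then show ?thesis
    using assms[of "cnj c / of_real (cmod c)"] False by (simp add: norm_divide)
qed (use assms[of 1] in simp)

lemma cmod_\<phi>_le:
  assumes x: "norm x = 1" and p: "\<And>z. z \<in> E \<Longrightarrow> cmod (poly p z) \<le> M" and M: "0 < M"
  shows "cmod (\<phi> x p) \<le> \<omega> * M"
proof (rule cmod_le_of_rotations)
  fix k :: complex assume k: "cmod k = 1"
  have "smult (k / of_real M) p \<in> unit_ball"
    using p M k by (auto simp: unit_ball_def norm_mult norm_divide field_simps)
  from Re_\<phi>_le[OF x this] show "Re (k * \<phi> x p) \<le> \<omega> * M"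
    using M by (simp add: \<phi>_simps field_simps)
qed

lemma one_le_\<omega>: "1 \<le> \<omega>" if "norm (x::'a) = 1"
  using Re_\<phi>_le[OF that, of 1] that by (simp add: \<phi>_simps unit_ball_def)

lemma cmod_cinner_poly_op_le:
  assumes "p \<in> unit_ball"
  shows "cmod (cinner (poly_op p A x) x) \<le> \<omega> * (norm x)\<^sup>2"
proof (cases "x = 0")
  case False
  define y where "y = complex_of_real (1 / norm x) *\<^sub>C x"
  have "norm y = 1" using False by (simp add: y_def norm_divide)
  then have "cmod (\<phi> y p) \<le> \<omega> * 1"
    by (rule cmod_\<phi>_le) (use assms in \<open>auto simp: unit_ball_def\<close>)
  moreover have "\<phi> y p = of_real (1 / (norm x)\<^sup>2) * cinner (poly_op p A x) x"
    by (simp add: \<phi>_def y_def bounded_clinear_scaleC[OF bounded_clinear_poly_op[OF A]]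
        cinner_scaleC_left cinner_scaleC_right power2_eq_square)
  ultimately show ?thesis using False by (simp add: norm_mult norm_divide norm_power field_simps)
qed (simp add: bounded_clinear_zero[OF bounded_clinear_poly_op[OF A]])

text \<open>The form \<open>N(u, v) = 2\<omega> \<langle>u, v\<rangle> - \<langle>S u, v\<rangle> - \<langle>u, S v\<rangle>\<close> is positive semidefinite, since \<open>\<omega>\<close> bounds the numerical
  radius of \<open>S = f(A)\<close>, and \<open>N(x, x)\<close> is small. By Cauchy-Schwarz \<open>N(x, w)\<close> is small for all \<open>w\<close>: nearly,
  \<open>S x + S\<^sup>* x = 2\<omega> x\<close>.\<close>

lemma near_eigenvector:
  assumes f: "f \<in> unit_ball" and x: "norm x = 1" and e: "0 \<le> e" "\<omega> - e\<^sup>2 \<le> Re (\<phi> x f)"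
  defines "S \<equiv> poly_op f A"
  shows "cmod (2 * of_real \<omega> * cinner x w - cinner (S x) w - cinner x (S w)) \<le> e * sqrt (8 * \<omega>) * norm w"
proof -
  define N where "N u v = 2 * of_real \<omega> * cinner u v - cinner (S u) v - cinner u (S v)" for u v
  note S = bounded_clinear_poly_op[OF A, of f, folded S_def]
  have \<omega>: "1 \<le> \<omega>" by (rule one_le_\<omega>[OF x])
  have Sw: "\<bar>Re (cinner (S u) u)\<bar> \<le> \<omega> * (norm u)\<^sup>2" for u
    using cmod_cinner_poly_op_le[OF f, of u] abs_Re_le_cmod[of "cinner (S u) u"] unfolding S_def by linarith
  have ReN: "Re (N u u) = 2 * \<omega> * (norm u)\<^sup>2 - 2 * Re (cinner (S u) u)" for u
    using Re_cinner_commute[of u "S u"] by (simp add: N_def cinner_self)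
  have "(cmod (N x w))\<^sup>2 \<le> Re (N x x) * Re (N w w)"
  proof (rule Cauchy_Schwarz_hermitian)
    show "N (u + v) z = N u z + N v z" for u v z
      by (simp add: N_def bounded_clinear_add[OF S] cinner_add_left algebra_simps)
    show "N (a *\<^sub>C u) v = a * N u v" for a u v
      by (simp add: N_def bounded_clinear_scaleC[OF S] cinner_scaleC_left algebra_simps)
    show "N u v = cnj (N v u)" for u v
      unfolding N_def complex_cnj_diff complex_cnj_mult cinner_commute[of v u, symmetric]
      by (simp add: cinner_commute[symmetric])
    show "0 \<le> Re (N u u)" for u using Sw[of u] unfolding ReN by linarith
  qed
  also have "\<dots> \<le> (2 * e\<^sup>2) * (4 * \<omega> * (norm w)\<^sup>2)"
  proof (rule mult_mono)
    show "Re (N x x) \<le> 2 * e\<^sup>2" unfolding ReN using e x by (simp add: \<phi>_def S_def)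
    show "Re (N w w) \<le> 4 * \<omega> * (norm w)\<^sup>2" "0 \<le> Re (N w w)" using Sw[of w] unfolding ReN by linarith+
  qed simp
  also have "\<dots> = (e * sqrt (8 * \<omega>) * norm w)\<^sup>2"
    using \<omega> by (simp add: power_mult_distrib)
  finally show ?thesis
    unfolding N_def[symmetric] by (rule power2_le_imp_le) (use \<omega> e in simp)
qed

text \<open>Compare the value of \<open>\<phi> x\<close> at \<open>f\<close> with its value at \<open>f \<plusminus> e (1 - f\<^sup>2)\<close>, which is in the unit ball up to second order in \<open>e\<close>.
  A deviation of \<open>e\<^sup>2\<close> from extremality becomes \<open>e\<close> after division by the size of the perturbation.\<close>

lemma near_moment_2:
  assumes f: "f \<in> unit_ball" and x: "norm x = 1"
    and e: "0 < e" "e \<le> 1/8" "\<omega> - e\<^sup>2 \<le> Re (\<phi> x f)"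
  shows "\<bar>Re (\<phi> x (f * f)) - 1\<bar> \<le> e + 2 * \<omega> * e"
proof -
  have *: "t * (1 - Re (\<phi> x (f * f))) \<le> e\<^sup>2 + 2 * \<omega> * e\<^sup>2" if t: "\<bar>t\<bar> = e" for t
  proof -
    have "cmod (poly (f + smult (of_real t) (1 - f * f)) z) \<le> 1 + 2 * t\<^sup>2" if "z \<in> E" for z
      using cmod_perturb_le[of "poly f z" t] f that t e
      by (simp add: unit_ball_def power2_eq_square)
    then have "cmod (\<phi> x (f + smult (of_real t) (1 - f * f))) \<le> \<omega> * (1 + 2 * t\<^sup>2)"
      by (rule cmod_\<phi>_le[OF x]) (simp_all add: add_pos_nonneg)
    then have "Re (\<phi> x f) + t * (1 - Re (\<phi> x (f * f))) \<le> \<omega> * (1 + 2 * t\<^sup>2)"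
      using complex_Re_le_cmod[of "\<phi> x (f + smult (of_real t) (1 - f * f))"] x
      by (simp add: \<phi>_simps)
    moreover have "t\<^sup>2 = e\<^sup>2" using t by (metis power2_abs)
    ultimately show ?thesis using e by (simp add: algebra_simps)
  qed
  have "e * (1 - Re (\<phi> x (f * f))) \<le> e * (e + 2 * \<omega> * e)" "e * (Re (\<phi> x (f * f)) - 1) \<le> e * (e + 2 * \<omega> * e)"
    using *[of e] *[of "- e"] e by (simp_all add: algebra_simps power2_eq_square)
  then show ?thesis using e by (simp add: mult_le_cancel_left_pos abs_le_iff)
qed

text \<open>Perturb \<open>f\<close> by \<open>e\<close> times \<open>k g (f - \<rho>)\<^sup>2 - (f - \<rho>) (1 - \<rho> f)\<close> for a constant \<open>k\<close> of modulus 1. In the limit the bound is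
  \<open>2 \<rho> (\<omega>\<^sup>2 - 1)\<close> when \<open>1 + \<rho>\<^sup>2 = 2 \<rho> \<omega>\<close>.\<close>

lemma near_moment_Blaschke:
  assumes f: "f \<in> unit_ball" and g: "g \<in> unit_ball" and x: "norm x = 1"
    and e: "0 < e" "e \<le> 1/8" "\<omega> - e\<^sup>2 \<le> Re (\<phi> x f)" and \<rho>: "0 \<le> \<rho>" "\<rho> \<le> 1"
  shows "cmod (\<phi> x (g * (f - [:of_real \<rho>:]) * (f - [:of_real \<rho>:])))
    \<le> (1 + \<rho>\<^sup>2) * Re (\<phi> x f) - \<rho> - \<rho> * Re (\<phi> x (f * f)) + e + 16 * \<omega> * e"
proof (rule cmod_le_of_rotations)
  fix k :: complex assume k: "cmod k = 1"
  define r where "r = [:complex_of_real \<rho>:]"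
  define W where "W = g * (f - r) * (f - r)"
  define F where "F = f + smult (of_real e) (smult k W - (f - r) * (1 - smult (of_real \<rho>) f))"
  have Q: "(f - r) * (1 - smult (of_real \<rho>) f)
      = smult (1 + (of_real \<rho>)\<^sup>2) f - r - smult (of_real \<rho>) (f * f)"
    by (simp add: r_def algebra_simps power2_eq_square smult_add_left)
  have "cmod (poly F z) \<le> 1 + 16 * e\<^sup>2" if z: "z \<in> E" for z
  proof -
    have "cmod (poly f z) \<le> 1" "cmod (poly g z) \<le> 1" using f g z by (auto simp: unit_ball_def)
    moreover have "cmod (k * poly W z) \<le> (cmod (poly f z - of_real \<rho>))\<^sup>2"
    proof -
      have "cmod (poly g z) * (cmod (poly f z - of_real \<rho>))\<^sup>2 \<le> 1 * (cmod (poly f z - of_real \<rho>))\<^sup>2"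
        by (intro mult_right_mono calculation) simp
      then show ?thesis using k by (simp add: W_def r_def norm_mult power2_eq_square mult.assoc)
    qed
    ultimately show ?thesis
      using cmod_Blaschke_perturb_le[of "poly f z" "k * poly W z" \<rho> e] e \<rho>
      by (simp add: F_def r_def)
  qed
  then have "cmod (\<phi> x F) \<le> \<omega> * (1 + 16 * e\<^sup>2)"
    by (rule cmod_\<phi>_le[OF x]) (simp_all add: add_pos_nonneg)
  then have "Re (\<phi> x F) \<le> \<omega> * (1 + 16 * e\<^sup>2)"
    using complex_Re_le_cmod[of "\<phi> x F"] by linarith
  moreover have "Re (\<phi> x F) = Re (\<phi> x f) + e * (Re (k * \<phi> x W)
      - ((1 + \<rho>\<^sup>2) * Re (\<phi> x f) - \<rho> - \<rho> * Re (\<phi> x (f * f))))"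
  proof -
    have "\<phi> x F = \<phi> x f + of_real e * (k * \<phi> x W
      - (of_real (1 + \<rho>\<^sup>2) * \<phi> x f - of_real \<rho> - of_real \<rho> * \<phi> x (f * f)))"
      unfolding F_def Q by (simp add: \<phi>_simps r_def x)
    then show ?thesis by (simp add: Re_complex_of_real)
  qed
  ultimately have "e * (Re (k * \<phi> x W)) \<le> e * ((1 + \<rho>\<^sup>2) * Re (\<phi> x f) - \<rho> - \<rho> * Re (\<phi> x (f * f)) + e + 16 * \<omega> * e)"
    using e by (simp add: algebra_simps power2_eq_square)
  then show "Re (k * \<phi> x (g * (f - [:of_real \<rho>:]) * (f - [:of_real \<rho>:]))) \<le>
     (1 + \<rho>\<^sup>2) * Re (\<phi> x f) - \<rho> - \<rho> * Re (\<phi> x (f * f)) + e + 16 * \<omega> * e"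
    using e unfolding W_def r_def by (simp add: mult_le_cancel_left_pos)
qed

text \<open>The companion of a truncated Blaschke factor of \<open>f\<close> is tested on \<open>u = (1 - \<rho> S) x\<close> and \<open>v = (S - \<rho>) x\<close>, whose norms are
  \<open>U\<close> and \<open>V\<close>.\<close>

lemma extremal_inequality:
  assumes f: "f \<in> unit_ball" and x: "norm x = 1"
    and e: "0 < e" "e \<le> 1/8" "\<omega> - e\<^sup>2 \<le> Re (\<phi> x f)"
    and \<rho>: "0 \<le> \<rho>" "\<rho> < 1" "1 + \<rho>\<^sup>2 = 2 * \<rho> * \<omega>"
  defines "a \<equiv> Re (\<phi> x f)" and "b \<equiv> Re (\<phi> x (f * f))"
    and "s2 \<equiv> (norm (poly_op f A x))\<^sup>2" and "\<eta> \<equiv> e * sqrt (8 * \<omega>)"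
  defines "U \<equiv> sqrt (1 - 2 * \<rho> * a + \<rho>\<^sup>2 * s2)" and "V \<equiv> sqrt (s2 - 2 * \<rho> * a + \<rho>\<^sup>2)"
  shows "\<bar>2 * \<omega> * a - s2 - b\<bar> \<le> \<eta> * K"
    and "1 / (1 + \<rho> ^ n) * (V\<^sup>2 - 2 * K * \<rho> ^ n * V)
      \<le> (2 + e) * (U * V) + \<rho> * ((1 + \<rho>\<^sup>2) * a - \<rho> - \<rho> * b + e + 16 * \<omega> * e) + \<rho> * (\<eta> * (K * V))"
proof -
  define S where "S = poly_op f A"
  note S = bounded_clinear_poly_op[OF A, of f, folded S_def]
  have SS: "S (S w) = poly_op (f * f) A w" for w by (simp add: S_def poly_op_mult[OF A])
  have \<omega>: "1 \<le> \<omega>" by (rule one_le_\<omega>[OF x])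
  have \<eta>0: "0 \<le> \<eta>" using e \<omega> by (simp add: \<eta>_def)
  have near: "cmod (2 * of_real \<omega> * cinner x w - cinner (S x) w - cinner x (S w)) \<le> \<eta> * norm w" for w
    using near_eigenvector[OF f x, of e w] e unfolding S_def \<eta>_def by simp
  have Kp: "norm (poly_op p A w) \<le> K * norm w" if "p \<in> unit_ball" for p w
    using K[of p w] that by (simp add: unit_ball_def)
  have nS: "norm (S x) \<le> K" using Kp[OF f, of x] x by (simp add: S_def)
  have cxx: "cinner x x = 1" using x by (simp add: cinner_self)
  have cSS: "cinner (S x) (S x) = of_real s2" by (simp add: cinner_self s2_def S_def)
  have aRe: "Re (cinner (S x) x) = a" "Re (cinner x (S x)) = a"
    using Re_cinner_commute[of x "S x"] by (simp_all add: a_def \<phi>_def S_def)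
  have bRe: "Re (cinner x (S (S x))) = b"
    using Re_cinner_commute[of x "S (S x)"] by (simp add: b_def \<phi>_def SS)
  have "\<bar>2 * \<omega> * a - s2 - b\<bar> = \<bar>Re (2 * of_real \<omega> * cinner x (S x) - cinner (S x) (S x) - cinner x (S (S x)))\<bar>"
    using aRe bRe cSS by simp
  also have "\<dots> \<le> \<eta> * norm (S x)" using near[of "S x"] abs_Re_le_cmod order_trans by blast
  also have "\<dots> \<le> \<eta> * K" using nS \<eta>0 by (rule mult_left_mono)
  finally show "\<bar>2 * \<omega> * a - s2 - b\<bar> \<le> \<eta> * K" .

  define u where "u = x - of_real \<rho> *\<^sub>C S x"
  define v where "v = S x - of_real \<rho> *\<^sub>C x"
  have "(norm u)\<^sup>2 = Re (cinner u u)" "(norm v)\<^sup>2 = Re (cinner v v)" by (simp_all add: cinner_self)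
  moreover have "Re (cinner u u) = 1 - 2 * \<rho> * a + \<rho>\<^sup>2 * s2"
    unfolding u_def by (simp add: cinner_diff_left cinner_diff_right cinner_scaleC_left cinner_scaleC_right
        aRe cxx cSS power2_eq_square algebra_simps)
  moreover have "Re (cinner v v) = s2 - 2 * \<rho> * a + \<rho>\<^sup>2"
    unfolding v_def by (simp add: cinner_diff_left cinner_diff_right cinner_scaleC_left cinner_scaleC_right
        aRe cxx cSS power2_eq_square algebra_simps)
  ultimately have uU: "norm u = U" and vV: "norm v = V"
    unfolding U_def V_def by (metis norm_ge_zero real_sqrt_abs abs_of_nonneg)+

  define r where "r = [:complex_of_real \<rho>:]"
  define h where "h = smult (of_real (1 / (1 + \<rho> ^ n))) ((f - r) * (\<Sum>k<n. (smult (of_real \<rho>) f) ^ k))"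
  define d where "d = poly_op ((f - r) * f ^ n) A x"
  have \<rho>n: "0 \<le> \<rho> ^ n" using \<rho> by simp
  have "cmod (poly h z) \<le> 1" if "z \<in> E" for z
  proof -
    have "cmod (poly f z) \<le> 1" using f that by (simp add: unit_ball_def)
    from cmod_partial_Blaschke_le[OF this \<rho>(1,2), of n] show ?thesis
      using \<rho>n by (simp add: h_def r_def poly_sum poly_power norm_mult norm_divide del: of_real_add of_real_power
          of_real_divide)
  qed
  from conjugate[OF e(1) this] obtain G where G: "G \<in> unit_ball"
    and Gh: "\<And>u v. cmod (cinner (poly_op h A u) v + cinner u (poly_op G A v)) \<le> (2 + e) * (norm u * norm v)"
    unfolding unit_ball_def by blast
  have "u = poly_op (1 - smult (of_real \<rho>) f) A x"
    by (simp add: u_def S_def poly_op_diff poly_op_smult)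
  then have "poly_op h A u = poly_op (h * (1 - smult (of_real \<rho>) f)) A x"
    by (simp add: poly_op_mult[OF A])
  also have "h * (1 - smult (of_real \<rho>) f)
      = smult (of_real (1 / (1 + \<rho> ^ n))) ((f - r) - smult (of_real (\<rho> ^ n)) ((f - r) * f ^ n))"
  proof -
    have "(\<Sum>k<n. (smult (of_real \<rho>) f) ^ k) * (1 - smult (of_real \<rho>) f) = 1 - (smult (of_real \<rho>) f) ^ n"
      by (simp add: one_diff_power_eq mult.commute)
    then have "h * (1 - smult (of_real \<rho>) f)
        = smult (of_real (1 / (1 + \<rho> ^ n))) ((f - r) * (1 - (smult (of_real \<rho>) f) ^ n))"
      unfolding h_def by (simp only: mult_smult_left mult.assoc)
    then show ?thesis by (simp add: smult_power right_diff_distrib)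
  qed
  finally have hu: "poly_op h A u = of_real (1 / (1 + \<rho> ^ n)) *\<^sub>C (v - of_real (\<rho> ^ n) *\<^sub>C d)"
    by (simp only: poly_op_smult poly_op_diff d_def v_def S_def r_def poly_op_const)
  have nd: "norm d \<le> 2 * K"
  proof -
    have "smult (1/2) ((f - r) * f ^ n) \<in> unit_ball"
    proof -
      have "cmod (poly (smult (1/2) ((f - r) * f ^ n)) z) \<le> 1" if "z \<in> E" for z
      proof -
        have f1: "cmod (poly f z) \<le> 1" using f that by (simp add: unit_ball_def)
        have "cmod (poly f z - of_real \<rho>) \<le> 2"
          using norm_triangle_ineq4[of "poly f z" "of_real \<rho>"] f1 \<rho> by simp
        moreover have "cmod (poly f z) ^ n \<le> 1" using f1 by (simp add: power_le_one)
        ultimately have "cmod (poly f z - of_real \<rho>) * cmod (poly f z) ^ n \<le> 2 * 1"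
          by (intro mult_mono) auto
        then show ?thesis by (simp add: r_def norm_mult norm_power poly_power)
      qed
      then show ?thesis by (simp add: unit_ball_def)
    qed
    from Kp[OF this, of x] show ?thesis by (simp add: poly_op_smult d_def x)
  qed
  have low: "1 / (1 + \<rho> ^ n) * (V\<^sup>2 - 2 * K * \<rho> ^ n * V) \<le> cmod (cinner (poly_op h A u) v)"
  proof -
    have "V\<^sup>2 = cmod (cinner v v)" by (simp add: cinner_self vV norm_power)
    also have "\<dots> \<le> cmod (cinner (v - of_real (\<rho> ^ n) *\<^sub>C d) v) + cmod (of_real (\<rho> ^ n) * cinner d v)"
      using norm_triangle_ineq[of "cinner (v - of_real (\<rho> ^ n) *\<^sub>C d) v" "of_real (\<rho> ^ n) * cinner d v"]
      by (simp add: cinner_diff_left cinner_scaleC_left)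
    also have "cmod (of_real (\<rho> ^ n) * cinner d v) = \<rho> ^ n * cmod (cinner d v)"
      using \<rho>n by (simp only: norm_mult norm_of_real abs_of_nonneg)
    also have "\<rho> ^ n * cmod (cinner d v) \<le> \<rho> ^ n * (2 * K * V)"
      using order_trans[OF cmod_cinner_le[of d v] mult_right_mono[OF nd norm_ge_zero[of v]]] \<rho>n vV
      by (intro mult_left_mono) auto
    finally have "V\<^sup>2 - 2 * K * \<rho> ^ n * V \<le> cmod (cinner (v - of_real (\<rho> ^ n) *\<^sub>C d) v)"
      by (simp add: algebra_simps)
    then have "1 / (1 + \<rho> ^ n) * (V\<^sup>2 - 2 * K * \<rho> ^ n * V) \<le> 1 / (1 + \<rho> ^ n) * cmod (cinner (v - of_real (\<rho> ^ n) *\<^sub>C d) v)"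
      using \<rho>n by (intro mult_left_mono) auto
    also have "\<dots> = cmod (cinner (poly_op h A u) v)"
      unfolding hu cinner_scaleC_left norm_mult norm_of_real using \<rho>n by simp
    finally show ?thesis .
  qed

  define w where "w = poly_op G A v"
  have nw: "norm w \<le> K * V" using Kp[OF G, of v] by (simp add: w_def vV)
  have up: "cmod (cinner u w) \<le> \<rho> * ((1 + \<rho>\<^sup>2) * a - \<rho> - \<rho> * b + e + 16 * \<omega> * e) + \<rho> * (\<eta> * (K * V))"
  proof -
    define N where "N = 2 * of_real \<omega> * cinner x w - cinner (S x) w - cinner x (S w)"
    \<comment> \<open>Up to the error \<open>N\<close>, replace \<open>S x\<close> by \<open>2\<omega> x - S\<^sup>* x\<close>; the choice of \<open>\<rho>\<close> turns \<open>u\<close> into \<open>\<rho> (S\<^sup>* - \<rho>) x\<close>.\<close>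
    have "cinner u w = cinner x w - of_real \<rho> * (2 * of_real \<omega> * cinner x w - cinner x (S w) - N)"
      by (simp add: u_def N_def cinner_diff_left cinner_scaleC_left)
    also have "\<dots> = (1 - of_real (2 * \<rho> * \<omega>)) * cinner x w + of_real \<rho> * (cinner x (S w) + N)"
      by (simp add: algebra_simps)
    also have "1 - of_real (2 * \<rho> * \<omega>) = - (complex_of_real \<rho>)\<^sup>2"
      unfolding \<rho>(3)[symmetric] by simp
    also have "- (complex_of_real \<rho>)\<^sup>2 * cinner x w + of_real \<rho> * (cinner x (S w) + N)
        = of_real \<rho> * cinner x (S w - of_real \<rho> *\<^sub>C w) + of_real \<rho> * N"
      by (simp add: cinner_diff_right cinner_scaleC_right power2_eq_square algebra_simps)
    finally have "cmod (cinner u w) \<le> \<rho> * cmod (cinner x (S w - of_real \<rho> *\<^sub>C w)) + \<rho> * cmod N"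
      using norm_triangle_ineq[of "of_real \<rho> * cinner x (S w - of_real \<rho> *\<^sub>C w)" "of_real \<rho> * N"] \<rho>
      by (simp add: norm_mult)
    moreover have "cmod N \<le> \<eta> * (K * V)"
      using near[of w] mult_left_mono[OF nw \<eta>0] unfolding N_def by linarith
    then have "\<rho> * cmod N \<le> \<rho> * (\<eta> * (K * V))" using \<rho> by (intro mult_left_mono) auto
    moreover have "cinner x (S w - of_real \<rho> *\<^sub>C w) = cnj (\<phi> x (G * (f - r) * (f - r)))"
    proof -
      have "S w - of_real \<rho> *\<^sub>C w = poly_op (f - r) A (poly_op G A (poly_op (f - r) A x))"
        by (simp add: poly_op_diff r_def S_def v_def w_def)
      also have "\<dots> = poly_op ((f - r) * (G * (f - r))) A x"
        by (simp only: poly_op_mult[OF A])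
      also have "(f - r) * (G * (f - r)) = G * (f - r) * (f - r)" by (simp add: mult_ac)
      finally show ?thesis unfolding \<phi>_def by (simp add: cinner_commute[symmetric])
    qed
    then have "\<rho> * cmod (cinner x (S w - of_real \<rho> *\<^sub>C w)) \<le> \<rho> * ((1 + \<rho>\<^sup>2) * a - \<rho> - \<rho> * b + e + 16 * \<omega> * e)"
      using near_moment_Blaschke[OF f G x e, of \<rho>] \<rho> unfolding r_def a_def b_def
      by (intro mult_left_mono) auto
    ultimately show ?thesis by linarith
  qed
  have "cmod (cinner (poly_op h A u) v)
      \<le> cmod (cinner (poly_op h A u) v + cinner u w) + cmod (cinner u w)"
    using norm_triangle_ineq4[of "cinner (poly_op h A u) v + cinner u w" "cinner u w"] by simp
  then show "1 / (1 + \<rho> ^ n) * (V\<^sup>2 - 2 * K * \<rho> ^ n * V)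
      \<le> (2 + e) * (U * V) + \<rho> * ((1 + \<rho>\<^sup>2) * a - \<rho> - \<rho> * b + e + 16 * \<omega> * e) + \<rho> * (\<eta> * (K * V))"
    using low up Gh[of u v] unfolding uU vV w_def by linarith
qed

theorem \<omega>_le_sqrt_2:
  assumes x0: "norm (x0::'a) = 1"
  shows "\<omega> \<le> sqrt 2"
proof (rule ccontr)
  assume "\<not> \<omega> \<le> sqrt 2"
  then have \<omega>: "\<omega> > sqrt 2" by simp
  then have \<omega>2: "\<omega>\<^sup>2 > 2"
    using power_strict_mono[of "sqrt 2" \<omega> 2] by simp
  have \<omega>1: "1 \<le> \<omega>" by (rule one_le_\<omega>[OF x0])
  define s where "s = sqrt (\<omega>\<^sup>2 - 1)"
  have s2: "s\<^sup>2 = \<omega>\<^sup>2 - 1" using \<omega>2 by (simp add: s_def)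
  have s1: "s > 1" using \<omega>2 by (simp add: s_def)
  define \<rho> where "\<rho> = \<omega> - s"
  have "s < \<omega>" unfolding s_def using \<omega>1 by (intro real_less_lsqrt) auto
  then have \<rho>0: "0 < \<rho>" by (simp add: \<rho>_def)
  have \<rho>\<omega>: "1 + \<rho>\<^sup>2 = 2 * \<rho> * \<omega>" and \<rho>s: "1 - \<rho>\<^sup>2 = 2 * \<rho> * s"
    using s2 by (simp_all add: \<rho>_def power2_eq_square algebra_simps)
  have "\<rho>\<^sup>2 < 1" using \<rho>s \<rho>0 s1 by (smt (verit) mult_pos_pos)
  then have \<rho>1: "\<rho> < 1" using \<rho>0 by (simp add: power_less_one_iff)
  define e where "e n = 1 / (real n + 8)" for n
  have e: "0 < e n" "e n \<le> 1/8" for n by (auto simp: e_def field_simps)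
  have elim: "e \<longlonglongrightarrow> 0" unfolding e_def by real_asymp
  have "\<exists>x f. norm x = 1 \<and> f \<in> unit_ball \<and> \<omega> - (e n)\<^sup>2 < Re (\<phi> x f)" for n
  proof -
    have "\<omega> - (e n)\<^sup>2 < Sup {Re (\<phi> x p) |x p. norm x = 1 \<and> p \<in> unit_ball}"
      using e[of n] unfolding \<omega>_def[symmetric] by simp
    moreover have "{Re (\<phi> x p) |x p. norm x = 1 \<and> p \<in> unit_ball} \<noteq> {}"
    proof -
      have "0 \<in> unit_ball" by (simp add: unit_ball_def)
      then show ?thesis using x0 by blast
    qed
    ultimately show ?thesis using less_cSup_iff[OF _ bdd_above_extremal] by auto
  qed
  then obtain x f where x: "\<And>n. norm (x n :: 'a) = 1" and f: "\<And>n. f n \<in> unit_ball"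
    and xf: "\<And>n. \<omega> - (e n)\<^sup>2 < Re (\<phi> (x n) (f n))" by metis
  define a where "a n = Re (\<phi> (x n) (f n))" for n
  define b where "b n = Re (\<phi> (x n) (f n * f n))" for n
  define t where "t n = (norm (poly_op (f n) A (x n)))\<^sup>2" for n
  define \<eta> where "\<eta> n = e n * sqrt (8 * \<omega>)" for n
  define U where "U n = sqrt (1 - 2 * \<rho> * a n + \<rho>\<^sup>2 * t n)" for n
  define V where "V n = sqrt (t n - 2 * \<rho> * a n + \<rho>\<^sup>2)" for n
  note ext = extremal_inequality[OF f x e order_less_imp_le[OF xf] order_less_imp_le[OF \<rho>0] \<rho>1 \<rho>\<omega>]
  have alim: "a \<longlonglongrightarrow> \<omega>"
  proof (rule tendsto_sandwich)
    show "(\<lambda>n. \<omega> - (e n)\<^sup>2) \<longlonglongrightarrow> \<omega>" using elim by (auto intro!: tendsto_eq_intros)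
    show "\<forall>\<^sub>F n in sequentially. a n \<le> \<omega>" using Re_\<phi>_le[OF x f] by (simp add: a_def)
  qed (use xf in \<open>auto simp: a_def less_imp_le\<close>)
  have blim: "b \<longlonglongrightarrow> 1"
  proof (rule LIM_zero_cancel, rule Lim_null_comparison)
    show "\<forall>\<^sub>F n in sequentially. norm (b n - 1) \<le> e n + 2 * \<omega> * e n"
      using near_moment_2[OF f x e order_less_imp_le[OF xf]] by (simp add: b_def)
    show "(\<lambda>n. e n + 2 * \<omega> * e n) \<longlonglongrightarrow> 0" using elim by (auto intro!: tendsto_eq_intros)
  qed
  have \<eta>lim: "\<eta> \<longlonglongrightarrow> 0" unfolding \<eta>_def using elim by (auto intro!: tendsto_eq_intros)
  have tlim: "t \<longlonglongrightarrow> 2 * \<omega>\<^sup>2 - 1"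
  proof -
    have "(\<lambda>n. 2 * \<omega> * a n - t n - b n) \<longlonglongrightarrow> 0"
    proof (rule Lim_null_comparison)
      show "\<forall>\<^sub>F n in sequentially. norm (2 * \<omega> * a n - t n - b n) \<le> \<eta> n * K"
        using ext(1) by (simp add: a_def b_def t_def \<eta>_def)
      show "(\<lambda>n. \<eta> n * K) \<longlonglongrightarrow> 0" using \<eta>lim by (auto intro!: tendsto_eq_intros)
    qed
    then have "(\<lambda>n. 2 * \<omega> * a n - b n - (2 * \<omega> * a n - t n - b n)) \<longlonglongrightarrow> 2 * \<omega> * \<omega> - 1 - 0"
      by (intro tendsto_intros alim blim)
    then show ?thesis by (simp add: power2_eq_square mult.assoc)
  qed
  have U2: "1 - 2 * \<rho> * \<omega> + \<rho>\<^sup>2 * (2 * \<omega>\<^sup>2 - 1) = 2 * (\<rho> * s)\<^sup>2"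
    unfolding \<rho>\<omega>[symmetric] power_mult_distrib s2 by (simp add: algebra_simps)
  have V2: "2 * \<omega>\<^sup>2 - 1 - 2 * \<rho> * \<omega> + \<rho>\<^sup>2 = 2 * s\<^sup>2"
    unfolding \<rho>\<omega>[symmetric] s2 by simp
  have Ulim: "U \<longlonglongrightarrow> sqrt 2 * (\<rho> * s)"
  proof -
    have "U \<longlonglongrightarrow> sqrt (1 - 2 * \<rho> * \<omega> + \<rho>\<^sup>2 * (2 * \<omega>\<^sup>2 - 1))"
      unfolding U_def by (intro tendsto_intros alim tlim)
    then show ?thesis unfolding U2 real_sqrt_mult real_sqrt_abs using \<rho>0 s1 by simp
  qed
  have Vlim: "V \<longlonglongrightarrow> sqrt 2 * s"
  proof -
    have "V \<longlonglongrightarrow> sqrt (2 * \<omega>\<^sup>2 - 1 - 2 * \<rho> * \<omega> + \<rho>\<^sup>2)"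
      unfolding V_def by (intro tendsto_intros alim tlim)
    then show ?thesis unfolding V2 real_sqrt_mult real_sqrt_abs using s1 by simp
  qed
  have \<rho>lim: "(\<lambda>n. \<rho> ^ n) \<longlonglongrightarrow> 0" using \<rho>0 \<rho>1 by (intro LIMSEQ_power_zero) simp
  have "1 / (1 + 0) * ((sqrt 2 * s)\<^sup>2 - 2 * K * 0 * (sqrt 2 * s))
      \<le> (2 + 0) * ((sqrt 2 * (\<rho> * s)) * (sqrt 2 * s))
        + \<rho> * ((1 + \<rho>\<^sup>2) * \<omega> - \<rho> - \<rho> * 1 + 0 + 16 * \<omega> * 0) + \<rho> * (0 * (K * (sqrt 2 * s)))"
  proof (rule LIMSEQ_le)
    show "(\<lambda>n. 1 / (1 + \<rho> ^ n) * ((V n)\<^sup>2 - 2 * K * \<rho> ^ n * V n))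
        \<longlonglongrightarrow> 1 / (1 + 0) * ((sqrt 2 * s)\<^sup>2 - 2 * K * 0 * (sqrt 2 * s))"
      by (intro tendsto_intros Vlim \<rho>lim) simp
    show "(\<lambda>n. (2 + e n) * (U n * V n)
        + \<rho> * ((1 + \<rho>\<^sup>2) * a n - \<rho> - \<rho> * b n + e n + 16 * \<omega> * e n) + \<rho> * (\<eta> n * (K * V n)))
        \<longlonglongrightarrow> (2 + 0) * ((sqrt 2 * (\<rho> * s)) * (sqrt 2 * s))
        + \<rho> * ((1 + \<rho>\<^sup>2) * \<omega> - \<rho> - \<rho> * 1 + 0 + 16 * \<omega> * 0) + \<rho> * (0 * (K * (sqrt 2 * s)))"
      by (intro tendsto_intros Ulim Vlim alim blim elim \<eta>lim)
    show "\<exists>N. \<forall>n\<ge>N. 1 / (1 + \<rho> ^ n) * ((V n)\<^sup>2 - 2 * K * \<rho> ^ n * V n) \<le> (2 + e n) * (U n * V n)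
        + \<rho> * ((1 + \<rho>\<^sup>2) * a n - \<rho> - \<rho> * b n + e n + 16 * \<omega> * e n) + \<rho> * (\<eta> n * (K * V n))"
      using ext(2) unfolding U_def V_def a_def b_def t_def \<eta>_def by blast
  qed
  then have "2 * s\<^sup>2 \<le> 4 * \<rho> * s\<^sup>2 + \<rho> * ((1 + \<rho>\<^sup>2) * \<omega> - 2 * \<rho>)"
    by (simp add: power2_eq_square power_mult_distrib algebra_simps)
  also have "(1 + \<rho>\<^sup>2) * \<omega> - 2 * \<rho> = 2 * \<rho> * s\<^sup>2"
    unfolding \<rho>\<omega> s2 by (simp add: power2_eq_square algebra_simps)
  finally have "s\<^sup>2 * (1 - \<rho>\<^sup>2) \<le> s\<^sup>2 * (2 * \<rho>)"
    by (simp add: power2_eq_square algebra_simps)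
  then have "2 * \<rho> * s \<le> 2 * \<rho>"
    unfolding \<rho>s[symmetric] using s1 by (simp add: mult_le_cancel_left_pos)
  with \<rho>0 s1 show False by simp
qed

corollary numerical_bound:
  assumes "\<And>z. z \<in> E \<Longrightarrow> cmod (poly p z) \<le> 1"
  shows "cmod (cinner (poly_op p A x) x) \<le> sqrt 2 * (norm x)\<^sup>2"
proof (cases "x = 0")
  case False
  then have "norm (complex_of_real (1 / norm x) *\<^sub>C x) = 1" by (simp add: norm_divide)
  then have "\<omega> \<le> sqrt 2" by (rule \<omega>_le_sqrt_2)
  moreover have "cmod (cinner (poly_op p A x) x) \<le> \<omega> * (norm x)\<^sup>2"
    by (rule cmod_cinner_poly_op_le) (use assms in \<open>simp add: unit_ball_def\<close>)
  ultimately show ?thesis by (meson mult_right_mono order_trans zero_le_power2)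
qed simp

end

section \<open>The numerical radius bound for polynomials\<close>

lemma poly_bound_on_dilation:
  assumes "bounded \<Omega>" and M: "\<And>z. z \<in> closure (dil c r ` \<Omega>) \<Longrightarrow> cmod (poly p z) \<le> M" and e: "0 < e"
  obtains s where "r < s" "\<And>z. z \<in> closure (dil c s ` \<Omega>) \<Longrightarrow> cmod (poly p z) \<le> M + e"
proof -
  define F where "F x = poly p (dil c (fst x) (snd x))" for x :: "real \<times> complex"
  have "continuous_on ({r..r + 1} \<times> closure \<Omega>) F"
    unfolding F_def dil_def by (intro continuous_intros continuous_on_poly)
  moreover have "compact ({r..r + 1} \<times> closure \<Omega>)"
    using assms(1) by (intro compact_Times) (auto simp: compact_closure)
  ultimately have "uniformly_continuous_on ({r..r + 1} \<times> closure \<Omega>) F"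
    by (rule compact_uniformly_continuous)
  then obtain \<delta> where \<delta>: "0 < \<delta>" "\<And>x y. x \<in> {r..r + 1} \<times> closure \<Omega> \<Longrightarrow> y \<in> {r..r + 1} \<times> closure \<Omega>
      \<Longrightarrow> dist y x < \<delta> \<Longrightarrow> dist (F y) (F x) < e"
    unfolding uniformly_continuous_on_def using e by meson
  define s where "s = r + min (\<delta> / 2) 1"
  show thesis
  proof (rule that[of s])
    show "r < s" using \<delta>(1) by (simp add: s_def)
    fix z assume "z \<in> closure (dil c s ` \<Omega>)"
    then obtain w where w: "w \<in> closure \<Omega>" "z = dil c s w" by (auto simp: closure_dil)
    have "dist (F (s, w)) (F (r, w)) < e"
      using w \<delta>(1) by (intro \<delta>(2)) (auto simp: s_def dist_Pair_Pair dist_real_def)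
    then have "cmod (poly p z - poly p (dil c r w)) < e" by (simp add: F_def w dist_norm)
    moreover have "cmod (poly p (dil c r w)) \<le> M" using w by (intro M) (auto simp: closure_dil)
    ultimately show "cmod (poly p z) \<le> M + e"
      using norm_triangle_ineq[of "poly p z - poly p (dil c r w)" "poly p (dil c r w)"] by simp
  qed
qed

text \<open>Take the boundary of the dilation by \<open>s\<close> as the inner curve, and as the outer curve the boundary of a slightly
  larger dilation, on which \<open>h\<close> is still nearly bounded by 1. The boundedness of the calculus absorbs the errors made when
  \<open>h\<close> and \<open>G\<close> are normalized.\<close>

lemma Crouzeix_Palencia_dilated:
  fixes A :: "'a::chilbert_space \<Rightarrow> 'a"
  assumes ct: "convex_contour \<Omega> \<gamma> \<gamma>'" and A: "bounded_clinear A" and W: "numerical_range A \<subseteq> closure \<Omega>"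
    and c: "c \<in> \<Omega>" and s: "1 < s"
  shows "\<exists>K. Crouzeix_Palencia A (closure (dil c s ` \<Omega>)) K"
proof -
  interpret convex_contour \<Omega> \<gamma> \<gamma>' by (rule ct)
  have op: "contour_operator (dil c r ` \<Omega>) (\<lambda>t. dil c r (\<gamma> t)) (\<lambda>t. of_real r * \<gamma>' t) A (closure \<Omega>)"
    if r: "1 < r" for r
  proof -
    interpret r: convex_contour "dil c r ` \<Omega>" "\<lambda>t. dil c r (\<gamma> t)" "\<lambda>t. of_real r * \<gamma>' t"
      by (rule dilated) (use r in simp)
    show ?thesis
    proof
      show "closure \<Omega> \<subseteq> dil c r ` \<Omega>"
        using r by (intro closure_subset_dil open_\<Omega> convex_\<Omega> c)
    qed (use A W c bounded_\<Omega> convex_\<Omega> in \<open>auto simp: convex_closure compact_closure\<close>)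
  qed
  define E where "E = closure (dil c s ` \<Omega>)"
  interpret I: contour_operator "dil c s ` \<Omega>" "\<lambda>t. dil c s (\<gamma> t)" "\<lambda>t. of_real s * \<gamma>' t" A "closure \<Omega>"
    by (rule op[OF s])
  obtain B where B: "0 \<le> B" "\<And>f M u v. continuous_on (frontier (dil c s ` \<Omega>)) f \<Longrightarrow>
      (\<And>z. z \<in> frontier (dil c s ` \<Omega>) \<Longrightarrow> cmod (f z) \<le> M)
    \<Longrightarrow> cmod (contour_integral (\<lambda>t. dil c s (\<gamma> t)) (\<lambda>\<zeta>. f \<zeta> * cinner (I.R \<zeta> u) v)) \<le> B * M * (norm u * norm v)"
    using I.resolvent_integral_bound by blast
  define K where "K = B / (2 * pi)"
  have K0: "0 \<le> K" using B by (simp add: K_def)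
  have Kbound: "norm (poly_op p A x) \<le> K * norm x" if p: "\<And>z. z \<in> E \<Longrightarrow> cmod (poly p z) \<le> 1" for p x
  proof (rule norm_le_of_cinner)
    show "0 \<le> K * norm x" using K0 by simp
    fix v
    have "cmod (2 * pi * \<i> * cinner (poly_op p A x) v) \<le> B * 1 * (norm x * norm v)"
      unfolding I.integral_poly_resolvent[symmetric]
      using p by (intro B(2) continuous_on_poly continuous_intros) (auto simp: E_def frontier_def)
    then show "cmod (cinner (poly_op p A x) v) \<le> K * norm x * norm v"
      by (simp add: K_def norm_mult field_simps)
  qed
  have "Crouzeix_Palencia A E K"
  proof
    show "bounded_clinear A" by (rule A)
    show "norm (poly_op p A x) \<le> K * norm x" if "\<And>z. z \<in> E \<Longrightarrow> cmod (poly p z) \<le> 1" for p x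
      by (rule Kbound[OF that])
    fix h and e :: real
    assume e: "0 < e" and h: "\<And>z. z \<in> E \<Longrightarrow> cmod (poly h z) \<le> 1"
    define d where "d = e / (1 + 2 * K)"
    have K1: "0 < 1 + 2 * K" using K0 by linarith
    have d: "0 < d" "d * (1 + 2 * K) = e" using e K1 by (simp_all add: d_def)
    obtain r where r: "s < r" "\<And>z. z \<in> closure (dil c r ` \<Omega>) \<Longrightarrow> cmod (poly h z) \<le> 1 + d"
      using poly_bound_on_dilation[OF bounded_\<Omega> h[unfolded E_def] d(1)] by blast
    interpret O: convex_contour "dil c r ` \<Omega>" "\<lambda>t. dil c r (\<gamma> t)" "\<lambda>t. of_real r * \<gamma>' t"
      by (rule dilated) (use r s in simp)
    define k where "k = smult (of_real (1 / (1 + d))) h"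
    have "cmod (poly k z) \<le> 1" if "z \<in> closure (dil c r ` \<Omega>)" for z
      using r(2)[OF that] d(1) unfolding k_def poly_smult norm_mult norm_of_real by simp
    from exists_conjugate_polynomial[OF op[OF s] O.convex_contour_axioms
        dil_subset[OF open_\<Omega> convex_\<Omega> c, of s r] this d(1)] r s
    obtain G where G: "\<And>z. z \<in> E \<Longrightarrow> cmod (poly G z) \<le> 1 + d"
      and Gk: "\<And>u v. cmod (cinner (poly_op k A u) v + cinner u (poly_op G A v)) \<le> (2 + d) * (norm u * norm v)"
      unfolding E_def by auto
    define G' where "G' = smult (of_real (1 / (1 + d))) G"
    have G'1: "cmod (poly G' z) \<le> 1" if "z \<in> E" for z
      using G[OF that] d(1) unfolding G'_def poly_smult norm_mult norm_of_real by simp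
    have GG: "G = smult (of_real (1 + d)) G'" and hk: "h = smult (of_real (1 + d)) k"
      using d(1) by (simp_all add: G'_def k_def flip: of_real_mult of_real_add)
    have bound: "cmod (cinner (poly_op h A u) v + cinner u (poly_op G' A v)) \<le> (2 + e) * (norm u * norm v)" for u v
    proof -
      define x where "x = cinner (poly_op k A u) v"
      define y where "y = cinner u (poly_op G' A v)"
      have hx: "cinner (poly_op h A u) v = of_real (1 + d) * x"
        by (simp only: hk poly_op_smult cinner_scaleC_left x_def)
      have Gy: "cinner u (poly_op G A v) = of_real (1 + d) * y"
        by (simp only: GG poly_op_smult cinner_scaleC_right y_def complex_cnj_complex_of_real)
      have "cmod x \<le> norm (poly_op k A u) * norm v" unfolding x_def by (rule cmod_cinner_le)
      also have "\<dots> \<le> K * norm u * norm v"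
      proof (intro mult_right_mono Kbound)
        have "E \<subseteq> closure (dil c r ` \<Omega>)"
          unfolding E_def using dil_subset[OF open_\<Omega> convex_\<Omega> c, of s r] r s closure_subset by fastforce
        then show "cmod (poly k z) \<le> 1" if "z \<in> E" for z
          using r(2)[of z] that d(1) unfolding k_def poly_smult norm_mult norm_of_real by auto
      qed simp
      finally have x: "d * cmod x \<le> d * (K * norm u * norm v)" using d(1) by (intro mult_left_mono) auto
      have "cmod y \<le> norm u * norm (poly_op G' A v)" unfolding y_def by (rule cmod_cinner_le)
      also have "\<dots> \<le> norm u * (K * norm v)"
        by (intro mult_left_mono Kbound G'1) auto
      finally have y: "d * cmod y \<le> d * (norm u * (K * norm v))" using d(1) by (intro mult_left_mono) auto
      have "cinner (poly_op h A u) v + cinner u (poly_op G' A v)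
          = (x + cinner u (poly_op G A v)) + of_real d * x - of_real d * y"
        unfolding hx Gy by (simp add: y_def[symmetric] distrib_right)
      then have "cmod (cinner (poly_op h A u) v + cinner u (poly_op G' A v))
          \<le> cmod (x + cinner u (poly_op G A v)) + d * cmod x + d * cmod y"
        using norm_triangle_ineq4[of "(x + cinner u (poly_op G A v)) + of_real d * x" "of_real d * y"]
          norm_triangle_ineq[of "x + cinner u (poly_op G A v)" "of_real d * x"] d(1)
        by (simp add: norm_mult)
      also have "\<dots> \<le> (2 + d) * (norm u * norm v) + d * (K * norm u * norm v) + d * (norm u * (K * norm v))"
        using Gk[of u v] x y unfolding x_def by linarith
      also have "\<dots> = (2 + d * (1 + 2 * K)) * (norm u * norm v)" by (simp add: algebra_simps)
      also have "\<dots> = (2 + e) * (norm u * norm v)" by (simp only: d(2))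
      finally show ?thesis .
    qed
    show "\<exists>G. (\<forall>z\<in>E. cmod (poly G z) \<le> 1) \<and>
        (\<forall>u v. cmod (cinner (poly_op h A u) v + cinner u (poly_op G A v)) \<le> (2 + e) * (norm u * norm v))"
      using G'1 bound by blast
  qed
  then show ?thesis unfolding E_def by blast
qed

text \<open>The extremal argument on a dilation with factor \<open>s > 1\<close>, as \<open>s\<close> tends to 1.\<close>

theorem numerical_bound_poly:
  fixes A :: "'a::chilbert_space \<Rightarrow> 'a"
  assumes ct: "convex_contour \<Omega> \<gamma> \<gamma>'" and A: "bounded_clinear A" and W: "numerical_range A \<subseteq> closure \<Omega>"
    and ne: "\<Omega> \<noteq> {}" and M: "\<And>z. z \<in> closure \<Omega> \<Longrightarrow> cmod (poly p z) \<le> M"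
  shows "cmod (cinner (poly_op p A x) x) \<le> sqrt 2 * M * (norm x)\<^sup>2"
proof -
  interpret convex_contour \<Omega> \<gamma> \<gamma>' by (rule ct)
  obtain c where c: "c \<in> \<Omega>" using ne by blast
  then have M0: "0 \<le> M" using M[of c] closure_subset norm_ge_zero order_trans by blast
  have *: "cmod (cinner (poly_op p A x) x) \<le> sqrt 2 * (M + e) * (norm x)\<^sup>2" if e: "0 < e" for e
  proof -
    have "cmod (poly p z) \<le> M" if "z \<in> closure (dil c 1 ` \<Omega>)" for z
      using that M by simp
    from poly_bound_on_dilation[OF bounded_\<Omega> this e]
    obtain s where s: "1 < s" "\<And>z. z \<in> closure (dil c s ` \<Omega>) \<Longrightarrow> cmod (poly p z) \<le> M + e" by blast
    obtain K where "Crouzeix_Palencia A (closure (dil c s ` \<Omega>)) K"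
      using Crouzeix_Palencia_dilated[OF ct A W c s(1)] by blast
    then interpret Crouzeix_Palencia A "closure (dil c s ` \<Omega>)" K .
    have Me: "0 < M + e" using M0 e by simp
    have "cmod (poly (smult (of_real (1 / (M + e))) p) z) \<le> 1" if "z \<in> closure (dil c s ` \<Omega>)" for z
      using s(2)[OF that] Me unfolding poly_smult norm_mult norm_of_real by simp
    then have "cmod (cinner (poly_op (smult (of_real (1 / (M + e))) p) A x) x) \<le> sqrt 2 * (norm x)\<^sup>2"
      by (rule numerical_bound)
    then show ?thesis
      using Me unfolding poly_op_smult cinner_scaleC_left norm_mult norm_of_real
      by (simp add: field_simps)
  qed
  have "((\<lambda>e. sqrt 2 * (M + e) * (norm x)\<^sup>2) \<longlongrightarrow> sqrt 2 * (M + 0) * (norm x)\<^sup>2) (at_right 0)"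
    by (intro tendsto_intros)
  moreover have "\<forall>\<^sub>F e in at_right 0. cmod (cinner (poly_op p A x) x) \<le> sqrt 2 * (M + e) * (norm x)\<^sup>2"
    unfolding eventually_at_right_field using * by (intro exI[of _ 1]) auto
  ultimately have "cmod (cinner (poly_op p A x) x) \<le> sqrt 2 * (M + 0) * (norm x)\<^sup>2"
    by (intro tendsto_lowerbound) auto
  then show ?thesis by simp
qed

section \<open>Mergelyan's theorem for convex domains\<close>

text \<open>A contraction of the variable towards an interior point makes \<open>f\<close> holomorphic on a neighbourhood of the closure and changes it
  little; then Cauchy's formula on a dilated boundary applies.\<close>

theorem poly_approximable_holo_alg:
  assumes ct: "convex_contour \<Omega> \<gamma> \<gamma>'" and ne: "\<Omega> \<noteq> {}" and f: "f \<in> holo_alg \<Omega>"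
  shows "poly_approximable (closure \<Omega>) f"
  unfolding poly_approximable_def
proof (intro allI impI)
  fix e :: real assume e: "0 < e"
  interpret convex_contour \<Omega> \<gamma> \<gamma>' by (rule ct)
  obtain c where c: "c \<in> \<Omega>" using ne by blast
  have hol: "f holomorphic_on \<Omega>" and cont_f: "continuous_on (closure \<Omega>) f"
    using f by (auto simp: holo_alg_def)
  have comp: "compact (closure \<Omega>)" using bounded_\<Omega> by (simp add: compact_closure)
  have in_cl: "dil c r z \<in> closure \<Omega>" if "0 \<le> r" "r \<le> 1" "z \<in> closure \<Omega>" for r z
  proof -
    have "(1 - r) *\<^sub>R c + r *\<^sub>R z \<in> closure \<Omega>"
      using that c closure_subset by (intro convexD[OF convex_closure[OF convex_\<Omega>]]) auto
    moreover have "(1 - r) *\<^sub>R c + r *\<^sub>R z = dil c r z"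
      by (simp add: dil_def scaleR_conv_of_real algebra_simps)
    ultimately show ?thesis by simp
  qed
  define F where "F x = f (dil c (fst x) (snd x))" for x :: "real \<times> complex"
  have "continuous_on ({0..1} \<times> closure \<Omega>) F"
    unfolding F_def
  proof (rule continuous_on_compose2[OF cont_f])
    show "continuous_on ({0..1} \<times> closure \<Omega>) (\<lambda>x. dil c (fst x) (snd x))"
      unfolding dil_def by (intro continuous_intros)
  qed (use in_cl in auto)
  moreover have "compact ({0..1::real} \<times> closure \<Omega>)" by (intro compact_Times comp) auto
  ultimately have "uniformly_continuous_on ({0..1} \<times> closure \<Omega>) F"
    by (rule compact_uniformly_continuous)
  then obtain \<delta> where \<delta>: "0 < \<delta>" "\<And>x y. x \<in> {0..1} \<times> closure \<Omega> \<Longrightarrow> y \<in> {0..1} \<times> closure \<Omega>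
      \<Longrightarrow> dist y x < \<delta> \<Longrightarrow> dist (F y) (F x) < e / 2"
    unfolding uniformly_continuous_on_def using e by (meson half_gt_zero)
  define r where "r = 1 - min (\<delta> / 2) (1 / 2)"
  have r: "0 < r" "r < 1" "1 - r < \<delta>" using \<delta>(1) by (auto simp: r_def)
  have fr: "cmod (f z - f (dil c r z)) \<le> e / 2" if z: "z \<in> closure \<Omega>" for z
    using \<delta>(2)[of "(r, z)" "(1, z)"] r z by (simp add: F_def dist_Pair_Pair dist_real_def dist_norm)
  define s where "s = (1 + 1 / r) / 2"
  have s: "1 < s" "s < 1 / r" using r by (auto simp: s_def field_simps)
  interpret s: convex_contour "dil c s ` \<Omega>" "\<lambda>t. dil c s (\<gamma> t)" "\<lambda>t. of_real s * \<gamma>' t"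
    by (rule dilated) (use s in simp)
  have "poly_approximable (closure \<Omega>) (\<lambda>z. f (dil c r z))"
  proof (rule s.poly_approximable_holomorphic)
    show "open (dil c (1 / r) ` \<Omega>)" "convex (dil c (1 / r) ` \<Omega>)"
      using r by (auto intro: open_dil open_\<Omega> convex_dil convex_\<Omega>)
    show "closure (dil c s ` \<Omega>) \<subseteq> dil c (1 / r) ` \<Omega>"
      using s by (intro dil_subset open_\<Omega> convex_\<Omega> c) auto
    show "(\<lambda>z. f (dil c r z)) holomorphic_on dil c (1 / r) ` \<Omega>"
    proof (rule holomorphic_on_compose_gen[OF _ hol, unfolded o_def])
      show "dil c r holomorphic_on dil c (1 / r) ` \<Omega>"
        unfolding dil_def[abs_def] by (intro holomorphic_intros)
      show "dil c r ` dil c (1 / r) ` \<Omega> \<subseteq> \<Omega>"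
        using r by (auto simp: dil_dil)
    qed
    show "closure \<Omega> \<subseteq> dil c s ` \<Omega>" by (intro closure_subset_dil open_\<Omega> convex_\<Omega> c s)
  qed (use comp convex_\<Omega> in \<open>auto simp: convex_closure\<close>)
  then obtain p where p: "\<And>z. z \<in> closure \<Omega> \<Longrightarrow> cmod (f (dil c r z) - poly p z) \<le> e / 2"
    using poly_approximableD[of _ _ "e / 2"] e by (meson half_gt_zero)
  have "cmod (f z - poly p z) \<le> e" if "z \<in> closure \<Omega>" for z
    using norm_triangle_ineq[of "f z - f (dil c r z)" "f (dil c r z) - poly p z"] fr[OF that] p[OF that] by simp
  then show "\<exists>p. \<forall>z\<in>closure \<Omega>. cmod (f z - poly p z) \<le> e" by blast
qed

section \<open>The functional calculus\<close>

locale fun_calc_setting =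
  fixes \<Omega> :: "complex set" and A :: "'a::chilbert_space \<Rightarrow> 'a" and f :: "complex \<Rightarrow> complex" and C :: real
  assumes A: "bounded_clinear A" and C: "0 < C"
    and bound: "\<And>p M x. (\<And>z. z \<in> closure \<Omega> \<Longrightarrow> cmod (poly p z) \<le> M) \<Longrightarrow> norm (poly_op p A x) \<le> C * M * norm x"
    and approx: "poly_approximable (closure \<Omega>) f"
begin

lemma bound_diff:
  assumes "\<And>z. z \<in> closure \<Omega> \<Longrightarrow> cmod (f z - poly p z) \<le> M" "\<And>z. z \<in> closure \<Omega> \<Longrightarrow> cmod (f z - poly q z) \<le> N"
  shows "norm (poly_op p A x - poly_op q A x) \<le> C * (M + N) * norm x"
proof -
  have "cmod (poly (p - q) z) \<le> M + N" if "z \<in> closure \<Omega>" for z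
    using norm_triangle_ineq4[of "f z - poly q z" "f z - poly p z"] assms(1,2)[OF that] by simp
  from bound[OF this] show ?thesis by (simp add: poly_op_diff)
qed

lemma approximating_sequence:
  obtains q where "\<And>n z. z \<in> closure \<Omega> \<Longrightarrow> cmod (f z - poly (q n) z) \<le> 1 / (real n + 1)"
proof -
  have "\<exists>p. \<forall>z\<in>closure \<Omega>. cmod (f z - poly p z) \<le> 1 / (real n + 1)" for n
    by (rule poly_approximableD[OF approx]) simp
  then show thesis using that by metis
qed

lemma inverse_Suc_lim: "(\<lambda>n. 1 / (real n + 1)) \<longlonglongrightarrow> 0"
  by real_asymp

lemma limit_operator:
  obtains T where "bounded_clinear T"
    "\<And>p M x. (\<And>z. z \<in> closure \<Omega> \<Longrightarrow> cmod (f z - poly p z) \<le> M) \<Longrightarrow> norm (poly_op p A x - T x) \<le> C * M * norm x"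
proof -
  obtain q where q: "\<And>n z. z \<in> closure \<Omega> \<Longrightarrow> cmod (f z - poly (q n) z) \<le> 1 / (real n + 1)"
    by (rule approximating_sequence) blast
  have "convergent (\<lambda>n. poly_op (q n) A x)" for x
  proof (rule Cauchy_convergent, rule metric_CauchyI)
    fix e :: real assume e: "0 < e"
    have "(\<lambda>n. C * (1 / (real n + 1) + 1 / (real n + 1)) * norm x) \<longlonglongrightarrow> C * (0 + 0) * norm x"
      by (intro tendsto_intros inverse_Suc_lim)
    then have "\<forall>\<^sub>F n in sequentially. C * (1 / (real n + 1) + 1 / (real n + 1)) * norm x < e"
      using e by (intro order_tendstoD(2)[of _ 0]) simp_all
    then obtain N where N: "C * (1 / (real N + 1) + 1 / (real N + 1)) * norm x < e"
      by (auto simp: eventually_sequentially)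
    show "\<exists>M. \<forall>m\<ge>M. \<forall>n\<ge>M. dist (poly_op (q m) A x) (poly_op (q n) A x) < e"
    proof (intro exI[of _ N] allI impI)
      fix m n assume mn: "N \<le> m" "N \<le> n"
      have "norm (poly_op (q m) A x - poly_op (q n) A x) \<le> C * (1 / (real m + 1) + 1 / (real n + 1)) * norm x"
        by (rule bound_diff; rule q)
      also have "\<dots> \<le> C * (1 / (real N + 1) + 1 / (real N + 1)) * norm x"
        using mn C by (intro mult_right_mono mult_left_mono add_mono divide_left_mono) auto
      finally show "dist (poly_op (q m) A x) (poly_op (q n) A x) < e" using N by (simp add: dist_norm)
    qed
  qed
  then have lim: "(\<lambda>n. poly_op (q n) A x) \<longlonglongrightarrow> lim (\<lambda>n. poly_op (q n) A x)" for x
    by (simp add: convergent_LIMSEQ_iff)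
  define T where "T x = lim (\<lambda>n. poly_op (q n) A x)" for x
  note lim = lim[folded T_def]
  have T: "norm (poly_op p A x - T x) \<le> C * M * norm x"
    if p: "\<And>z. z \<in> closure \<Omega> \<Longrightarrow> cmod (f z - poly p z) \<le> M" for p M x
  proof (rule LIMSEQ_le)
    show "(\<lambda>n. norm (poly_op p A x - poly_op (q n) A x)) \<longlonglongrightarrow> norm (poly_op p A x - T x)"
      by (intro tendsto_intros lim)
    have "(\<lambda>n. C * (M + 1 / (real n + 1)) * norm x) \<longlonglongrightarrow> C * (M + 0) * norm x"
      by (intro tendsto_intros inverse_Suc_lim)
    then show "(\<lambda>n. C * (M + 1 / (real n + 1)) * norm x) \<longlonglongrightarrow> C * M * norm x" by simp
    show "\<exists>N. \<forall>n\<ge>N. norm (poly_op p A x - poly_op (q n) A x) \<le> C * (M + 1 / (real n + 1)) * norm x"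
      using bound_diff[OF p q] by blast
  qed
  obtain K where K: "\<And>x. norm (poly_op (q 0) A x) \<le> norm x * K"
    using bounded_clinear_poly_op[OF A, of "q 0"] unfolding bounded_clinear_def by (meson bounded_linear.bounded)
  have "bounded_clinear T"
  proof (rule bounded_clinearI)
    show "T (x + y) = T x + T y" for x y
    proof (rule LIMSEQ_unique[OF lim])
      show "(\<lambda>n. poly_op (q n) A (x + y)) \<longlonglongrightarrow> T x + T y"
        unfolding bounded_clinear_add[OF bounded_clinear_poly_op[OF A]] by (intro tendsto_intros lim)
    qed
    show "T (c *\<^sub>C x) = c *\<^sub>C T x" for c x
    proof (rule LIMSEQ_unique[OF lim])
      have "bounded_linear (\<lambda>y. c *\<^sub>C (y::'a))"
        by (rule bounded_linear_intro[where K = "cmod c"])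
          (simp_all add: scaleC_add_right scaleR_conv_scaleC mult.commute)
      then show "(\<lambda>n. poly_op (q n) A (c *\<^sub>C x)) \<longlonglongrightarrow> c *\<^sub>C T x"
        unfolding bounded_clinear_scaleC[OF bounded_clinear_poly_op[OF A]]
        by (rule bounded_linear.tendsto) (rule lim)
    qed
    show "norm (T x) \<le> norm x * (K + C)" for x
      using T[OF q, of 0 x] K[of x] norm_triangle_ineq4[of "poly_op (q 0) A x" "poly_op (q 0) A x - T x"]
      by (simp add: algebra_simps)
  qed
  with T show thesis using that by blast
qed

lemma bounded_linear_poly_op_diff: "bounded_linear (\<lambda>x. poly_op p A x - T x)" if "bounded_clinear T"
  using bounded_clinear_poly_op[OF A, of p] that unfolding bounded_clinear_def by (intro bounded_linear_sub) auto

text \<open>Uniqueness rests on the existence of one approximating sequence: any operator that satisfies the defining condition is its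
  limit.\<close>

lemma fun_calc_eqI:
  assumes T: "bounded_clinear T"
    and near: "\<And>p M x. (\<And>z. z \<in> closure \<Omega> \<Longrightarrow> cmod (f z - poly p z) \<le> M) \<Longrightarrow> norm (poly_op p A x - T x) \<le> C * M * norm x"
  shows "fun_calc \<Omega> f A = T"
  unfolding fun_calc_def
proof (rule the_equality, intro conjI allI impI)
  show "bounded_clinear T" by (rule T)
  fix p :: "nat \<Rightarrow> complex poly"
  assume p: "uniform_limit (closure \<Omega>) (\<lambda>n. poly (p n)) f sequentially"
  show "(\<lambda>n. onorm (\<lambda>x. poly_op (p n) A x - T x)) \<longlonglongrightarrow> 0"
  proof (rule tendstoI)
    fix e :: real assume e: "0 < e"
    then have "0 < e / (2 * C)" using C by simp
    from uniform_limitD[OF p this]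
    show "\<forall>\<^sub>F n in sequentially. dist (onorm (\<lambda>x. poly_op (p n) A x - T x)) 0 < e"
    proof eventually_elim
      case (elim n)
      have "onorm (\<lambda>x. poly_op (p n) A x - T x) \<le> C * (e / (2 * C))"
      proof (rule onorm_bound)
        show "norm (poly_op (p n) A x - T x) \<le> C * (e / (2 * C)) * norm x" for x
          using elim by (intro near) (auto simp: dist_norm norm_minus_commute less_imp_le)
      qed (use C e in simp)
      also have "\<dots> = e / 2" using C by simp
      finally show ?case using onorm_pos_le[OF bounded_linear_poly_op_diff[OF T]] e by (simp add: dist_real_def)
    qed
  qed
next
  fix T' :: "'a \<Rightarrow> 'a"
  assume T': "bounded_clinear T' \<and> (\<forall>p :: nat \<Rightarrow> complex poly. uniform_limit (closure \<Omega>) (\<lambda>n. poly (p n)) f sequentially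
      \<longrightarrow> (\<lambda>n. onorm (\<lambda>x. poly_op (p n) A x - T' x)) \<longlonglongrightarrow> 0)"
  obtain q where q: "\<And>n z. z \<in> closure \<Omega> \<Longrightarrow> cmod (f z - poly (q n) z) \<le> 1 / (real n + 1)"
    by (rule approximating_sequence) blast
  have "uniform_limit (closure \<Omega>) (\<lambda>n. poly (q n)) f sequentially"
  proof (rule uniform_limitI)
    fix e :: real assume "0 < e"
    with inverse_Suc_lim have "\<forall>\<^sub>F n in sequentially. 1 / (real n + 1) < e" by (rule order_tendstoD)
    then show "\<forall>\<^sub>F n in sequentially. \<forall>z\<in>closure \<Omega>. dist (poly (q n) z) (f z) < e"
    proof eventually_elim
      case (elim n)
      then show ?case using q[of _ n] by (fastforce simp: dist_norm norm_minus_commute)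
    qed
  qed
  then have on: "(\<lambda>n. onorm (\<lambda>x. poly_op (q n) A x - T' x)) \<longlonglongrightarrow> 0" using T' by blast
  show "T' = T"
  proof
    fix x
    have "(\<lambda>n. poly_op (q n) A x - T' x) \<longlonglongrightarrow> 0"
    proof (rule Lim_null_comparison)
      show "\<forall>\<^sub>F n in sequentially. norm (poly_op (q n) A x - T' x) \<le> onorm (\<lambda>x. poly_op (q n) A x - T' x) * norm x"
        using onorm[OF bounded_linear_poly_op_diff] T' by (intro always_eventually) blast
      show "(\<lambda>n. onorm (\<lambda>x. poly_op (q n) A x - T' x) * norm x) \<longlonglongrightarrow> 0"
        using tendsto_mult_right[OF on, of "norm x"] by simp
    qed
    moreover have "(\<lambda>n. poly_op (q n) A x - T x) \<longlonglongrightarrow> 0"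
    proof (rule Lim_null_comparison)
      show "\<forall>\<^sub>F n in sequentially. norm (poly_op (q n) A x - T x) \<le> C * (1 / (real n + 1)) * norm x"
        using near[OF q] by (intro always_eventually) blast
      have "(\<lambda>n. C * (1 / (real n + 1)) * norm x) \<longlonglongrightarrow> C * 0 * norm x"
        by (intro tendsto_intros inverse_Suc_lim)
      then show "(\<lambda>n. C * (1 / (real n + 1)) * norm x) \<longlonglongrightarrow> 0" by simp
    qed
    ultimately have "(\<lambda>n. (poly_op (q n) A x - T x) - (poly_op (q n) A x - T' x)) \<longlonglongrightarrow> 0 - 0"
      by (intro tendsto_diff)
    then show "T' x = T x" by (simp add: LIMSEQ_const_iff)
  qed
qed

end

theorem corollary7:
  fixes \<Omega> :: "complex set" and A :: "'a::chilbert_space \<Rightarrow> 'a"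
  assumes "open \<Omega>" and "\<Omega> \<noteq> {}" and "convex \<Omega>" and "bounded \<Omega>" and "smooth_boundary \<Omega>"
    and "bounded_clinear A"
    and "numerical_range A \<subseteq> closure \<Omega>"
  shows "\<forall>f \<in> holo_alg \<Omega>. numerical_radius (fun_calc \<Omega> f A) \<le> sqrt 2 * sup_norm \<Omega> f"
proof
  fix f assume f: "f \<in> holo_alg \<Omega>"
  obtain \<gamma> \<gamma>' where ct: "convex_contour \<Omega> \<gamma> \<gamma>'"
    using smooth_boundary_convex_contour assms by blast
  have num: "cmod (cinner (poly_op p A x) x) \<le> sqrt 2 * M * (norm x)\<^sup>2"
    if "\<And>z. z \<in> closure \<Omega> \<Longrightarrow> cmod (poly p z) \<le> M" for p M x
    by (rule numerical_bound_poly[OF ct assms(6,7,2) that])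
  interpret fun_calc_setting \<Omega> A f "2 * sqrt 2"
  proof
    show "norm (poly_op p A x) \<le> 2 * sqrt 2 * M * norm x"
      if "\<And>z. z \<in> closure \<Omega> \<Longrightarrow> cmod (poly p z) \<le> M" for p M x
    proof -
      have "norm (poly_op p A x) \<le> 2 * (sqrt 2 * M) * norm x"
        by (rule norm_le_2_of_numerical_bound[OF bounded_clinear_poly_op[OF assms(6)]]) (rule num[OF that])
      then show ?thesis by (simp only: mult.assoc)
    qed
  qed (use assms(6) poly_approximable_holo_alg[OF ct assms(2) f] in auto)
  obtain T where T: "bounded_clinear T"
    and near: "\<And>p M x. (\<And>z. z \<in> closure \<Omega> \<Longrightarrow> cmod (f z - poly p z) \<le> M) \<Longrightarrow>
      norm (poly_op p A x - T x) \<le> 2 * sqrt 2 * M * norm x"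
    using limit_operator by blast
  have fT: "fun_calc \<Omega> f A = T" by (rule fun_calc_eqI[OF T near])
  define N where "N = sup_norm \<Omega> f"
  have "compact (closure \<Omega>)" using assms(4) by (simp add: compact_closure)
  moreover have "continuous_on (closure \<Omega>) (\<lambda>z. cmod (f z))"
    using f by (intro continuous_intros) (simp add: holo_alg_def)
  ultimately have bdd: "bdd_above ((\<lambda>z. cmod (f z)) ` closure \<Omega>)"
    by (intro bounded_imp_bdd_above compact_imp_bounded compact_continuous_image)
  have fN: "cmod (f z) \<le> N" if "z \<in> closure \<Omega>" for z
    unfolding N_def sup_norm_def by (rule cSUP_upper[OF that bdd])
  have N0: "0 \<le> N"
  proof -
    obtain z where "z \<in> closure \<Omega>" using assms(2) closure_subset by blast
    then show ?thesis using fN[of z] norm_ge_zero[of "f z"] by linarith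
  qed
  have key: "cmod (cinner (T x) x) \<le> sqrt 2 * N" if x: "norm x = 1" for x
  proof -
    obtain q where q: "\<And>n z. z \<in> closure \<Omega> \<Longrightarrow> cmod (f z - poly (q n) z) \<le> 1 / (real n + 1)"
      by (rule approximating_sequence) blast
    have "cmod (cinner (T x) x) \<le> sqrt 2 * (N + 1 / (real n + 1)) + 2 * sqrt 2 * (1 / (real n + 1))" for n
    proof -
      have "cmod (poly (q n) z) \<le> N + 1 / (real n + 1)" if "z \<in> closure \<Omega>" for z
        using norm_triangle_ineq4[of "f z" "f z - poly (q n) z"] q[OF that, of n] fN[OF that] by simp
      from num[OF this, of x] have "cmod (cinner (poly_op (q n) A x) x) \<le> sqrt 2 * (N + 1 / (real n + 1))"
        by (simp add: x)
      moreover have "norm (poly_op (q n) A x - T x) \<le> 2 * sqrt 2 * (1 / (real n + 1)) * norm x"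
        by (rule near) (rule q)
      then have "cmod (cinner (poly_op (q n) A x - T x) x) \<le> 2 * sqrt 2 * (1 / (real n + 1))"
        using cmod_cinner_le[of "poly_op (q n) A x - T x" x] x by simp
      ultimately show ?thesis
        using norm_triangle_ineq4[of "cinner (poly_op (q n) A x) x" "cinner (poly_op (q n) A x - T x) x"]
        by (simp add: cinner_diff_left)
    qed
    moreover have "(\<lambda>n. sqrt 2 * (N + 1 / (real n + 1)) + 2 * sqrt 2 * (1 / (real n + 1))) \<longlonglongrightarrow> sqrt 2 * (N + 0) + 2 * sqrt 2 * 0"
      by (intro tendsto_intros inverse_Suc_lim)
    ultimately have "cmod (cinner (T x) x) \<le> sqrt 2 * (N + 0) + 2 * sqrt 2 * 0"
      by (intro LIMSEQ_le_const) auto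
    then show ?thesis by simp
  qed
  show "numerical_radius (fun_calc \<Omega> f A) \<le> sqrt 2 * sup_norm \<Omega> f"
    unfolding fT numerical_radius_def N_def[symmetric]
    by (rule cSup_least) (use key N0 in \<open>auto simp: numerical_range_def\<close>)
qed

end
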